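(* Let $K$ be a PL sphere of Picard number $p\le 4$ (with $p\geq 1$). Then $K$ supports a fan-giving characteristic map $\lambda$ such that $(K,\lambda)$ has an optimal partition if and only if $K$ is (up to isomorphism) obtained by a finite (possibly empty) sequence of wedge operations from the boundary complex of \begin{itemize} \item a $1$-simplex, if $p=1$; \item a square, if $p=2$; \item a $3$-dimensional cross polytope, if $p=3$; \item either a hexagon or a $4$-dimensional cross polytope, if $p=4$. \end{itemize} Moreover, each of the boundary complexes listed above supports, up to D-J equivalence, a unique fan-giving characteristic map having an optimal partition; and thus any fan-giving characteristic map $\lambda$ over $K$ such that $(K,\lambda)$ has an optimal partition is, up to D-J equivalence, obtained from it by a sequence of canonical extensions.
   Context: All simplicial complexes are finite and abstract, and every element of the vertex set is a vertex. For a simplicial complex $K$ of dimension $n-1$ with vertex set $[m]$, the Picard number is $m-n$. A simplicial complex of dimension $n-1$ is a PL sphere if some subdivision of it is isomorphic to some subdivision of the boundary complex of the $n$-simplex. Wedge: for a vertex $v$ of $K$, $\mathrm{Lk}_K(v)=\{\tau\setminus\{v\}: v\in\tau\in K\}$, $K\setminus v$ is the complex of faces of $K$ not containing $v$, and $\mathrm{wed}_v(K)=(I*\mathrm{Lk}_K(v))\cup(\partial I*(K\setminus v))$, where $*$ is the simplicial join, $I$ is a $1$-simplex on two new vertices and $\partial I$ is its boundary (two points). Characteristic maps: a characteristic map over $K$ is a map $\lambda:[m]\to\mathbb{Z}^n$ such that for every face $\{i_1,\dots,i_k\}$ of $K$, $\{\lambda(i_1),\dots,\lambda(i_k)\}$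 is part of a $\mathbb{Z}$-basis of $\mathbb{Z}^n$; it is identified with the $n\times m$ matrix with columns $\lambda(1),\dots,\lambda(m)$. Two characteristic maps over $K$ are D-J equivalent if one matrix is obtained from the other by left multiplication by an element of $\mathrm{GL}(n,\mathbb{Z})$. A characteristic map $\lambda$ over $K$ is fan-giving if the cones $\mathrm{cone}(\{\lambda(i)\}_{i\in\sigma})$, $\sigma\in K$, form a complete non-singular fan in $\mathbb{R}^n$ whose underlying simplicial complex is $K$ (with $\lambda(i)$ the primitive generator of the ray corresponding to $i$). Optimal partition: a partition $P$ of the vertex set of $K$ is an optimal partition for $(K,\lambda)$ if every block $\{v_1,\dots,v_k\}\in P$ is a minimal non-face of $K$ and satisfies $\lambda(v_1)+\dots+\lambda(v_k)=0$. Canonical extension: given a characteristic map $\lambda$ over $K$ and a vertex $v$, relabel the vertices so that $v=1$ and $\{1,\dots,n\}$ is a facet of $K$, and replace $\lambda$ by the D-J equivalent matrix $\begin{bmatrix}1&0&\mathbf a\\0&I_{n-1}&A\end{bmatrix}$. The canonical extension of $\lambda$ at $v$ is the characteristic map over $\mathrm{wed}_v(K)$ given by $\begin{bmatrix}1&0&0&\mathbf a\\0&1&0&\mathbf a\\0&0&I_{n-1}&A\end{bmatrix}$, where the first two columns correspond to the two new vertices of $\mathrm{wed}_v(K)$ and the other columns to the vertices $2,\dots,m$ of $K$. *)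

theory Defs
  imports Complex_Main "HOL-Library.Disjoint_Sets" "Jordan_Normal_Form.Matrix"
begin

section \<open>Simplicial complexes\<close>

text \<open>A complex is given by its set of faces \<open>K\<close>; its vertex set is \<open>\<Union>K\<close>, so that every element
  of the vertex set is a vertex.\<close>

definition abstract_complex :: "'a set set \<Rightarrow> bool" where
  "abstract_complex K \<longleftrightarrow> finite (\<Union>K) \<and> {} \<in> K \<and> (\<forall>\<sigma>\<in>K. \<forall>\<tau>. \<tau> \<subseteq> \<sigma> \<longrightarrow> \<tau> \<in> K)"

text \<open>The number \<open>n\<close> such that \<open>K\<close> has dimension \<open>n - 1\<close>.\<close>

definition cdim :: "'a set set \<Rightarrow> nat" where
  "cdim K = Max (card ` K)"

definition picard :: "'a set set \<Rightarrow> int" where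
  "picard K = int (card (\<Union>K)) - int (cdim K)"

definition complex_iso :: "('a \<Rightarrow> 'b) \<Rightarrow> 'a set set \<Rightarrow> 'b set set \<Rightarrow> bool" where
  "complex_iso f K L \<longleftrightarrow> inj_on f (\<Union>K) \<and> (\<lambda>\<sigma>. f ` \<sigma>) ` K = L"

definition minimal_nonface :: "'a set set \<Rightarrow> 'a set \<Rightarrow> bool" where
  "minimal_nonface K N \<longleftrightarrow> N \<subseteq> \<Union>K \<and> N \<notin> K \<and> (\<forall>\<sigma>. \<sigma> \<subset> N \<longrightarrow> \<sigma> \<in> K)"

section \<open>PL spheres\<close>

text \<open>The standard geometric realization, in barycentric coordinates.\<close>

definition geom_real :: "'a set set \<Rightarrow> ('a \<Rightarrow> real) set" where
  "geom_real K = {x. (\<forall>v. 0 \<le> x v) \<and> {v. x v \<noteq> 0} \<in> K \<and> (\<Sum>v\<in>\<Union>K. x v) = 1}"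

text \<open>\<open>subdivides L K\<close> says that \<open>L\<close> is (isomorphic to) a subdivision of \<open>K\<close>: placing each vertex \<open>w\<close>
  of \<open>L\<close> at a point \<open>\<phi> w\<close> of the realization of \<open>K\<close>, so that every face of \<open>L\<close> lies in a face of \<open>K\<close>,
  and extending affinely over the faces of \<open>L\<close>, identifies the realization of \<open>L\<close> with that of \<open>K\<close>.
  (Injectivity says that the images of the faces of \<open>L\<close> are geometric simplices that meet in common
  faces; surjectivity says that they cover the realization of \<open>K\<close>.)\<close>

definition subdivides :: "'b set set \<Rightarrow> 'a set set \<Rightarrow> bool" where
  "subdivides L K \<longleftrightarrow> abstract_complex L \<and>
     (\<exists>\<phi>. (\<forall>w\<in>\<Union>L. \<phi> w \<in> geom_real K) \<and>
          (\<forall>\<sigma>\<in>L. \<exists>\<tau>\<in>K. \<forall>w\<in>\<sigma>. {v. \<phi> w v \<noteq> 0} \<subseteq> \<tau>) \<and>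
          bij_betw (\<lambda>x v. \<Sum>w\<in>\<Union>L. x w * \<phi> w v) (geom_real L) (geom_real K))"

text \<open>The boundary complex of the \<open>n\<close>-simplex on the vertices \<open>0, \<dots>, n\<close>.\<close>

definition bd_simplex :: "nat \<Rightarrow> nat set set" where
  "bd_simplex n = {\<sigma>. \<sigma> \<subset> {..n}}"

definition pl_sphere :: "'a set set \<Rightarrow> bool" where
  "pl_sphere K \<longleftrightarrow> abstract_complex K \<and>
     (\<exists>(L :: nat set set) (L' :: nat set set) f.
        subdivides L K \<and> subdivides L' (bd_simplex (cdim K)) \<and> complex_iso f L L')"

section \<open>Wedges\<close>

definition join :: "'a set set \<Rightarrow> 'a set set \<Rightarrow> 'a set set" where
  "join K L = {\<sigma> \<union> \<tau> |\<sigma> \<tau>. \<sigma> \<in> K \<and> \<tau> \<in> L}"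

definition lk :: "'a set set \<Rightarrow> 'a \<Rightarrow> 'a set set" where
  "lk K v = {\<tau> - {v} |\<tau>. \<tau> \<in> K \<and> v \<in> \<tau>}"

definition del :: "'a set set \<Rightarrow> 'a \<Rightarrow> 'a set set" where
  "del K v = {\<tau> \<in> K. v \<notin> \<tau>}"

text \<open>The wedge of \<open>K\<close> at \<open>v\<close>, where \<open>a\<close> and \<open>b\<close> are the two new vertices replacing \<open>v\<close>.\<close>

definition wed :: "'a set set \<Rightarrow> 'a \<Rightarrow> 'a \<Rightarrow> 'a \<Rightarrow> 'a set set" where
  "wed K v a b = join {{}, {a}, {b}, {a, b}} (lk K v) \<union> join {{}, {a}, {b}} (del K v)"

inductive wedge_seq :: "'a set set \<Rightarrow> 'a set set \<Rightarrow> bool" for K\<^sub>0 where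
  refl: "wedge_seq K\<^sub>0 K\<^sub>0"
| step: "wedge_seq K\<^sub>0 K \<Longrightarrow> v \<in> \<Union>K \<Longrightarrow> a \<notin> \<Union>K \<Longrightarrow> b \<notin> \<Union>K \<Longrightarrow> a \<noteq> b \<Longrightarrow>
           wedge_seq K\<^sub>0 (wed K v a b)"

section \<open>Characteristic maps\<close>

text \<open>\<open>B\<close> is a basis of the free abelian group of integer vectors of length \<open>n\<close>: every vector is a
  unique integer combination of \<open>B\<close>.\<close>

definition int_basis :: "nat \<Rightarrow> int vec set \<Rightarrow> bool" where
  "int_basis n B \<longleftrightarrow> finite B \<and> B \<subseteq> carrier_vec n \<and>
     (\<forall>x\<in>carrier_vec n. \<exists>!c. (\<forall>b. b \<notin> B \<longrightarrow> c b = 0) \<and> x = vec n (\<lambda>j. \<Sum>b\<in>B. c b * b $ j))"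

text \<open>That the vectors \<open>lam i\<close>, \<open>i \<in> \<sigma>\<close>, are part of a basis is read for the indexed family, so they
  are required to be distinct. Values of \<open>lam\<close> outside the vertex set are irrelevant.\<close>

definition char_map :: "'a set set \<Rightarrow> ('a \<Rightarrow> int vec) \<Rightarrow> bool" where
  "char_map K lam \<longleftrightarrow> (\<forall>v\<in>\<Union>K. lam v \<in> carrier_vec (cdim K)) \<and>
     (\<forall>\<sigma>\<in>K. inj_on lam \<sigma> \<and> (\<exists>B. int_basis (cdim K) B \<and> lam ` \<sigma> \<subseteq> B))"

definition GL_int :: "nat \<Rightarrow> int mat set" where
  "GL_int n = {G \<in> carrier_mat n n. invertible_mat G}"

definition dj_equiv :: "'a set set \<Rightarrow> ('a \<Rightarrow> int vec) \<Rightarrow> ('a \<Rightarrow> int vec) \<Rightarrow> bool" where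
  "dj_equiv K lam mu \<longleftrightarrow> (\<exists>G\<in>GL_int (cdim K). \<forall>v\<in>\<Union>K. mu v = G *\<^sub>v lam v)"

section \<open>Fans\<close>

definition gen_cone :: "nat \<Rightarrow> int vec set \<Rightarrow> real vec set" where
  "gen_cone n S = {vec n (\<lambda>j. \<Sum>s\<in>S. c s * real_of_int (s $ j)) |c. \<forall>s\<in>S. 0 \<le> c s}"

definition rational_cone :: "nat \<Rightarrow> real vec set \<Rightarrow> bool" where
  "rational_cone n C \<longleftrightarrow> (\<exists>S. finite S \<and> S \<subseteq> carrier_vec n \<and> C = gen_cone n S)"

definition strongly_convex :: "nat \<Rightarrow> real vec set \<Rightarrow> bool" where
  "strongly_convex n C \<longleftrightarrow> (\<forall>x\<in>C. - x \<in> C \<longrightarrow> x = 0\<^sub>v n)"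

definition cone_face :: "nat \<Rightarrow> real vec set \<Rightarrow> real vec set \<Rightarrow> bool" where
  "cone_face n F C \<longleftrightarrow> (\<exists>u\<in>carrier_vec n. (\<forall>x\<in>C. 0 \<le> u \<bullet> x) \<and> F = {x \<in> C. u \<bullet> x = 0})"

definition is_fan :: "nat \<Rightarrow> real vec set set \<Rightarrow> bool" where
  "is_fan n \<Delta> \<longleftrightarrow> finite \<Delta> \<and> \<Delta> \<noteq> {} \<and>
     (\<forall>C\<in>\<Delta>. rational_cone n C \<and> strongly_convex n C) \<and>
     (\<forall>C\<in>\<Delta>. \<forall>F. cone_face n F C \<longrightarrow> F \<in> \<Delta>) \<and>
     (\<forall>C\<in>\<Delta>. \<forall>D\<in>\<Delta>. cone_face n (C \<inter> D) C \<and> cone_face n (C \<inter> D) D)"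

definition complete_fan :: "nat \<Rightarrow> real vec set set \<Rightarrow> bool" where
  "complete_fan n \<Delta> \<longleftrightarrow> \<Union>\<Delta> = carrier_vec n"

definition nonsingular_fan :: "nat \<Rightarrow> real vec set set \<Rightarrow> bool" where
  "nonsingular_fan n \<Delta> \<longleftrightarrow> (\<forall>C\<in>\<Delta>. \<exists>B S. int_basis n B \<and> S \<subseteq> B \<and> C = gen_cone n S)"

definition primitive_vec :: "nat \<Rightarrow> int vec \<Rightarrow> bool" where
  "primitive_vec n u \<longleftrightarrow> u \<in> carrier_vec n \<and> (\<forall>d. (\<forall>j<n. d dvd u $ j) \<longrightarrow> d dvd 1)"

text \<open>The primitive generators of the rays (one-dimensional faces) of a cone.\<close>

definition ray_gens :: "nat \<Rightarrow> real vec set \<Rightarrow> int vec set" where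
  "ray_gens n C = {u. primitive_vec n u \<and> cone_face n (gen_cone n {u}) C}"

text \<open>The underlying simplicial complex of a simplicial fan, a ray being represented by its
  primitive generator.\<close>

definition fan_complex :: "nat \<Rightarrow> real vec set set \<Rightarrow> int vec set set" where
  "fan_complex n \<Delta> = ray_gens n ` \<Delta>"

text \<open>The last condition says that the underlying complex of the fan is \<open>K\<close>, with \<open>lam i\<close> the
  primitive generator of the ray corresponding to the vertex \<open>i\<close>.\<close>

definition fan_giving :: "'a set set \<Rightarrow> ('a \<Rightarrow> int vec) \<Rightarrow> bool" where
  "fan_giving K lam \<longleftrightarrow> char_map K lam \<and>
     (let n = cdim K; \<Delta> = (\<lambda>\<sigma>. gen_cone n (lam ` \<sigma>)) ` K in
        is_fan n \<Delta> \<and> complete_fan n \<Delta> \<and> nonsingular_fan n \<Delta> \<and>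
        complex_iso lam K (fan_complex n \<Delta>))"

section \<open>Optimal partitions\<close>

definition optimal_partition :: "'a set set \<Rightarrow> ('a \<Rightarrow> int vec) \<Rightarrow> 'a set set \<Rightarrow> bool" where
  "optimal_partition K lam P \<longleftrightarrow> partition_on (\<Union>K) P \<and>
     (\<forall>N\<in>P. minimal_nonface K N \<and> vec (cdim K) (\<lambda>j. \<Sum>v\<in>N. lam v $ j) = 0\<^sub>v (cdim K))"

section \<open>Canonical extensions\<close>

text \<open>\<open>canonical_ext K lam v a b mu\<close>: \<open>mu\<close> is a canonical extension of \<open>lam\<close> at \<open>v\<close>, a map over
  \<open>wed K v a b\<close>. The facet containing \<open>v\<close> is enumerated by \<open>w\<close>, with \<open>w 0 = v\<close>, and \<open>G\<close> brings \<open>lam\<close>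
  to the form in which the columns of this facet are the unit vectors. The column of a vertex other
  than \<open>v\<close> is then extended by repeating its first entry. The relation depends on the choice of
  \<open>w\<close>; different choices give D-J equivalent maps.\<close>

definition canonical_ext ::
  "'a set set \<Rightarrow> ('a \<Rightarrow> int vec) \<Rightarrow> 'a \<Rightarrow> 'a \<Rightarrow> 'a \<Rightarrow> ('a \<Rightarrow> int vec) \<Rightarrow> bool" where
  "canonical_ext K lam v a b mu \<longleftrightarrow>
     (let n = cdim K in
      \<exists>w. \<exists>G\<in>GL_int n. inj_on w {..<n} \<and> w ` {..<n} \<in> K \<and> 0 < n \<and> w 0 = v \<and>
        (\<forall>i<n. G *\<^sub>v lam (w i) = unit_vec n i) \<and>
        mu a = unit_vec (Suc n) 0 \<and> mu b = unit_vec (Suc n) 1 \<and>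
        (\<forall>u\<in>\<Union>K - {v}. mu u =
           vec (Suc n) (\<lambda>j. if j = 0 then (G *\<^sub>v lam u) $ 0 else (G *\<^sub>v lam u) $ (j - 1))))"

inductive canonical_seq ::
  "'a set set \<Rightarrow> ('a \<Rightarrow> int vec) \<Rightarrow> 'a set set \<Rightarrow> ('a \<Rightarrow> int vec) \<Rightarrow> bool" for K\<^sub>0 lam\<^sub>0 where
  refl: "canonical_seq K\<^sub>0 lam\<^sub>0 K\<^sub>0 lam\<^sub>0"
| step: "canonical_seq K\<^sub>0 lam\<^sub>0 K lam \<Longrightarrow>
           v \<in> \<Union>K \<Longrightarrow> a \<notin> \<Union>K \<Longrightarrow> b \<notin> \<Union>K \<Longrightarrow> a \<noteq> b \<Longrightarrow> canonical_ext K lam v a b mu \<Longrightarrow>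
           canonical_seq K\<^sub>0 lam\<^sub>0 (wed K v a b) mu"

section \<open>The basic boundary complexes\<close>

definition polygon :: "nat \<Rightarrow> nat set set" where
  "polygon k = {{}} \<union> {{i} |i. i < k} \<union> {{i, Suc i mod k} |i. i < k}"

text \<open>The boundary complex of the \<open>d\<close>-dimensional cross polytope; \<open>2 * i\<close> and \<open>2 * i + 1\<close> are
  antipodal vertices.\<close>

definition bd_cross_polytope :: "nat \<Rightarrow> nat set set" where
  "bd_cross_polytope d = {\<sigma>. \<sigma> \<subseteq> {..<2 * d} \<and> (\<forall>i<d. \<not> {2 * i, 2 * i + 1} \<subseteq> \<sigma>)}"

definition base_complexes :: "int \<Rightarrow> nat set set set" where
  "base_complexes p =
     (if p = 1 then {bd_simplex 1}
      else if p = 2 then {polygon 4}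
      else if p = 3 then {bd_cross_polytope 3}
      else if p = 4 then {polygon 6, bd_cross_polytope 4}
      else {})"

end

theory Submission
  imports Defs
begin

text \<open>Let \<open>P\<close> be an optimal partition for \<open>(K, lam)\<close>. Every block sums to zero, and its proper subsets are faces.
  The whole argument compares non-negative combinations of the vectors \<open>lam v\<close>: in a complete simplicial
  fan each vector has exactly one such expression whose support is a face
  (\<open>fan_giving_unique_coordinates\<close>; the converse is \<open>fan_givingI\<close>).

  The blocks contribute \<open>card P\<close> independent linear relations to a space of relations whose dimension is
  the Picard number \<open>p\<close>. If there are no further relations, then \<open>K\<close> is the join of the boundaries of the simplices
  on the blocks, and the fan is that of a product of projective spaces (\<open>product_case\<close>). A further relation
  cannot live on one or two blocks, up to constants: it would equate two combinations supported on
  different faces (\<open>constant_on_block\<close>). So it involves at least three blocks, and since there are fewer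
  than \<open>p \<le> 4\<close> blocks, there are three blocks and \<open>p = 4\<close>. The same comparison exhibits certain facets
  (\<open>crossing_facet\<close>), whose unimodularity forces the extra relation to be, up to constants, the indicator
  function of a set that cuts each block into two non-empty parts. The six parts are arranged like the
  vertices of a hexagon, the two parts of a block being antipodal (\<open>hexagonal_case\<close>).

  In both cases the vertex set maps onto that of a base complex, and the complex as well as its relations are pulled
  back along this map. Such pullbacks are exactly the iterated wedges: a single wedge is the
  pullback along the map that identifies the two new vertices (\<open>wed_pullback\<close>), and the relations of a
  canonical extension are the pulled back ones (\<open>canonical_ext_exists\<close>). As a characteristic map
  is determined up to D-J equivalence by its relations (\<open>dj_equivI\<close>), every pullback is realized by a
  sequence of canonical extensions (\<open>canonical_realization\<close>). Pulling back preserves unimodularity,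
  unique coordinates and optimal partitions (locale \<open>pulled_back\<close>), so every iterated wedge of a
  base complex supports a fan with an optimal partition. The classification, applied to the base complexes
  themselves, shows that their relations are determined (\<open>base_fan\<close>).\<close>

section \<open>Integer bases and unimodular sets\<close>

lemma ex1_eq: "\<exists>!x. P x \<Longrightarrow> P a \<Longrightarrow> P b \<Longrightarrow> a = b" by blast

text \<open>The functions \<open>g v\<close> are the rows of the inverse of the matrix with columns \<open>lam v\<close>, \<open>v \<in> \<tau>\<close>.
  Both products are recorded, because a basis is not known to have \<open>n\<close> elements beforehand.\<close>

definition dual_coordinates :: "nat \<Rightarrow> ('a \<Rightarrow> int vec) \<Rightarrow> 'a set \<Rightarrow> ('a \<Rightarrow> nat \<Rightarrow> int) \<Rightarrow> bool" where
  "dual_coordinates n lam \<tau> g \<longleftrightarrow>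
     (\<forall>i<n. \<forall>j<n. (\<Sum>v\<in>\<tau>. lam v $ i * g v j) = (if i = j then 1 else 0)) \<and>
     (\<forall>u\<in>\<tau>. \<forall>v\<in>\<tau>. (\<Sum>j<n. g u j * lam v $ j) = (if u = v then 1 else 0))"

lemma dual_coordinatesD:
  assumes "dual_coordinates n lam \<tau> g"
  shows "\<And>i j. i < n \<Longrightarrow> j < n \<Longrightarrow> (\<Sum>v\<in>\<tau>. lam v $ i * g v j) = (if i = j then 1 else 0)"
    "\<And>u v. u \<in> \<tau> \<Longrightarrow> v \<in> \<tau> \<Longrightarrow> (\<Sum>j<n. g u j * lam v $ j) = (if u = v then 1 else 0)"
  using assms by (auto simp: dual_coordinates_def)

text \<open>The function \<open>\<lambda>b. g b j\<close> lists the coordinates of the \<open>j\<close>-th unit vector. That it is dual to the basis on the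
  other side as well is the uniqueness of coordinates, applied to the elements of \<open>B\<close>.\<close>

lemma int_basis_dual:
  assumes "int_basis n B"
  obtains g where "dual_coordinates n (\<lambda>b. b) B g"
proof -
  have fin: "finite B" and car: "B \<subseteq> carrier_vec n"
    and uniq: "\<And>x. x \<in> carrier_vec n \<Longrightarrow>
      \<exists>!c. (\<forall>b. b \<notin> B \<longrightarrow> c b = 0) \<and> x = vec n (\<lambda>j. \<Sum>b\<in>B. c b * b $ j)"
    using assms by (auto simp: int_basis_def)
  have "\<forall>j. \<exists>c. unit_vec n j = vec n (\<lambda>i. \<Sum>b\<in>B. c b * b $ i)"
    using uniq[OF unit_vec_carrier] by blast
  then obtain c where c: "\<And>j. unit_vec n j = vec n (\<lambda>i. \<Sum>b\<in>B. c j b * b $ i)"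
    by metis
  define g where "g b j = c j b" for b j
  have 1: "(\<Sum>b\<in>B. b $ i * g b j) = (if i = j then 1 else 0)" if "i < n" "j < n" for i j
  proof -
    have "(\<Sum>b\<in>B. b $ i * g b j) = unit_vec n j $ i"
      using that by (subst c) (simp add: g_def mult.commute)
    then show ?thesis using that by simp
  qed
  have 2: "(\<Sum>j<n. g b j * b' $ j) = (if b = b' then 1 else 0)" if b: "b \<in> B" "b' \<in> B" for b b'
  proof -
    let ?c = "\<lambda>b. if b \<in> B then \<Sum>j<n. g b j * b' $ j else 0"
    let ?d = "\<lambda>b. if b = b' then 1 else 0 :: int"
    have "b' = vec n (\<lambda>i. \<Sum>b\<in>B. ?c b * b $ i)"
    proof (rule eq_vecI)
      fix i assume "i < dim_vec (vec n (\<lambda>i. \<Sum>b\<in>B. ?c b * b $ i))"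
      then have i: "i < n" by simp
      have "(\<Sum>b\<in>B. ?c b * b $ i) = (\<Sum>b\<in>B. \<Sum>j<n. b' $ j * (b $ i * g b j))"
        by (intro sum.cong) (auto simp: sum_distrib_left sum_distrib_right mult_ac)
      also have "\<dots> = (\<Sum>j<n. b' $ j * (\<Sum>b\<in>B. b $ i * g b j))"
        by (subst sum.swap) (simp add: sum_distrib_left)
      also have "\<dots> = (\<Sum>j<n. if i = j then b' $ j else 0)"
        using i by (intro sum.cong) (auto simp: 1)
      finally show "b' $ i = vec n (\<lambda>i. \<Sum>b\<in>B. ?c b * b $ i) $ i"
        using i by simp
    qed (use car b in auto)
    moreover have "b' = vec n (\<lambda>i. \<Sum>b\<in>B. ?d b * b $ i)"
    proof (rule eq_vecI)
      fix i assume "i < dim_vec (vec n (\<lambda>i. \<Sum>b\<in>B. ?d b * b $ i))"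
      moreover have "(\<Sum>b\<in>B. ?d b * b $ i) = (\<Sum>b\<in>B. if b = b' then b $ i else 0)"
        by (intro sum.cong) auto
      ultimately show "b' $ i = vec n (\<lambda>i. \<Sum>b\<in>B. ?d b * b $ i) $ i"
        using b fin by (simp add: sum.delta)
    qed (use car b in auto)
    ultimately have "?c = ?d"
      using b car by (intro ex1_eq[OF uniq[of b']]) auto
    then show ?thesis using b by (auto dest: fun_cong[of _ _ b])
  qed
  show thesis by (rule that[of g]) (use 1 2 in \<open>simp add: dual_coordinates_def\<close>)
qed

lemma int_basis_of_dual:
  fixes g :: "int vec \<Rightarrow> nat \<Rightarrow> int"
  assumes fin: "finite B" and car: "B \<subseteq> carrier_vec n"
    and 1: "\<And>i j. i < n \<Longrightarrow> j < n \<Longrightarrow> (\<Sum>b\<in>B. b $ i * g b j) = (if i = j then 1 else 0)"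
    and 2: "\<And>b b'. b \<in> B \<Longrightarrow> b' \<in> B \<Longrightarrow> (\<Sum>j<n. g b j * b' $ j) = (if b = b' then 1 else 0)"
  shows "int_basis n B"
  unfolding int_basis_def
proof (intro conjI ballI fin car)
  fix x :: "int vec" assume x: "x \<in> carrier_vec n"
  show "\<exists>!c. (\<forall>b. b \<notin> B \<longrightarrow> c b = 0) \<and> x = vec n (\<lambda>j. \<Sum>b\<in>B. c b * b $ j)"
  proof (rule ex1I[of _ "\<lambda>b. if b \<in> B then \<Sum>j<n. g b j * x $ j else 0"], intro conjI)
    let ?c = "\<lambda>b. if b \<in> B then \<Sum>j<n. g b j * x $ j else 0"
    show "x = vec n (\<lambda>i. \<Sum>b\<in>B. ?c b * b $ i)"
    proof (rule eq_vecI)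
      fix i assume "i < dim_vec (vec n (\<lambda>i. \<Sum>b\<in>B. ?c b * b $ i))"
      then have i: "i < n" by simp
      have "(\<Sum>b\<in>B. ?c b * b $ i) = (\<Sum>b\<in>B. \<Sum>j<n. x $ j * (b $ i * g b j))"
        by (intro sum.cong) (auto simp: sum_distrib_left sum_distrib_right mult_ac)
      also have "\<dots> = (\<Sum>j<n. x $ j * (\<Sum>b\<in>B. b $ i * g b j))"
        by (subst sum.swap) (simp add: sum_distrib_left)
      also have "\<dots> = (\<Sum>j<n. if i = j then x $ j else 0)"
        using i by (intro sum.cong) (auto simp: 1)
      finally show "x $ i = vec n (\<lambda>i. \<Sum>b\<in>B. ?c b * b $ i) $ i"
        using i by simp
    qed (use x in auto)
    fix c :: "int vec \<Rightarrow> int"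
    assume c: "(\<forall>b. b \<notin> B \<longrightarrow> c b = 0) \<and> x = vec n (\<lambda>j. \<Sum>b\<in>B. c b * b $ j)"
    show "c = ?c"
    proof
      fix b
      show "c b = ?c b"
      proof (cases "b \<in> B")
        case True
        have "(\<Sum>j<n. g b j * x $ j) = (\<Sum>j<n. g b j * (\<Sum>b\<in>B. c b * b $ j))"
          by (rule sum.cong) (use c in auto)
        also have "\<dots> = (\<Sum>j<n. \<Sum>b'\<in>B. c b' * (g b j * b' $ j))"
          by (simp add: sum_distrib_left mult_ac)
        also have "\<dots> = (\<Sum>b'\<in>B. c b' * (\<Sum>j<n. g b j * b' $ j))"
          by (subst sum.swap) (simp add: sum_distrib_left)
        also have "\<dots> = (\<Sum>b'\<in>B. if b = b' then c b' else 0)"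
          by (rule sum.cong) (auto simp: 2 True)
        also have "\<dots> = c b" using True fin by simp
        finally show ?thesis using True by simp
      qed (use c in simp)
    qed
  qed simp
qed

definition unimodular :: "nat \<Rightarrow> ('a \<Rightarrow> int vec) \<Rightarrow> 'a set \<Rightarrow> bool" where
  "unimodular n lam \<tau> \<longleftrightarrow> inj_on lam \<tau> \<and> int_basis n (lam ` \<tau>)"

lemma unimodular_dual:
  assumes "unimodular n lam \<tau>"
  obtains g where "dual_coordinates n lam \<tau> g"
proof -
  have inj: "inj_on lam \<tau>" and bas: "int_basis n (lam ` \<tau>)"
    using assms by (auto simp: unimodular_def)
  obtain g where "dual_coordinates n (\<lambda>b. b) (lam ` \<tau>) g"
    by (rule int_basis_dual[OF bas])
  note g = dual_coordinatesD[OF this]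
  show thesis
    by (rule that[of "\<lambda>v. g (lam v)"], unfold dual_coordinates_def)
      (use g inj in \<open>auto simp: sum.reindex dest: inj_onD\<close>)
qed

lemma unimodular_finite: "unimodular n lam \<tau> \<Longrightarrow> finite \<tau>"
  by (auto simp: unimodular_def int_basis_def dest: finite_imageD)

lemma unimodularI:
  fixes g :: "'a \<Rightarrow> nat \<Rightarrow> int"
  assumes fin: "finite \<tau>" and car: "\<And>v. v \<in> \<tau> \<Longrightarrow> lam v \<in> carrier_vec n"
    and 1: "\<And>i j. i < n \<Longrightarrow> j < n \<Longrightarrow> (\<Sum>v\<in>\<tau>. lam v $ i * g v j) = (if i = j then 1 else 0)"
    and 2: "\<And>u v. u \<in> \<tau> \<Longrightarrow> v \<in> \<tau> \<Longrightarrow> (\<Sum>j<n. g u j * lam v $ j) = (if u = v then 1 else 0)"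
  shows "unimodular n lam \<tau>"
proof -
  have inj: "inj_on lam \<tau>"
    using 2 by (intro inj_onI) (metis zero_neq_one)
  define h where "h b = g (the_inv_into \<tau> lam b)" for b
  have h: "h (lam v) = g v" if "v \<in> \<tau>" for v
    using that inj by (simp add: h_def the_inv_into_f_f)
  have "int_basis n (lam ` \<tau>)"
    by (rule int_basis_of_dual[of _ _ h])
      (use fin car 1 2 h inj in \<open>auto simp: sum.reindex dest: inj_onD\<close>)
  then show ?thesis using inj by (simp add: unimodular_def)
qed

text \<open>The trace of a product of two matrices does not depend on their order, and the two products
  here are identity matrices of sizes \<open>n\<close> and \<open>card \<tau>\<close>.\<close>

lemma unimodular_card:
  assumes "unimodular n lam \<tau>"
  shows "card \<tau> = n"
proof -
  obtain g where "dual_coordinates n lam \<tau> g"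
    by (rule unimodular_dual[OF assms])
  note g = dual_coordinatesD[OF this]
  have "int (card \<tau>) = (\<Sum>v\<in>\<tau>. \<Sum>j<n. g v j * lam v $ j)"
    using g(2) by simp
  also have "\<dots> = (\<Sum>j<n. \<Sum>v\<in>\<tau>. lam v $ j * g v j)"
    by (subst sum.swap) (simp add: mult.commute)
  also have "\<dots> = int n" using g(1) by simp
  finally show ?thesis by simp
qed

lemma int_basis_card: "int_basis n B \<Longrightarrow> card B = n"
  using unimodular_card[of n id B] by (simp add: unimodular_def)

lemma char_map_unimodular:
  assumes "char_map K lam" "\<tau> \<in> K" "card \<tau> = cdim K"
  shows "unimodular (cdim K) lam \<tau>"
proof -
  obtain B where B: "int_basis (cdim K) B" "lam ` \<tau> \<subseteq> B" and inj: "inj_on lam \<tau>"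
    using assms by (auto simp: char_map_def)
  have "lam ` \<tau> = B"
    by (rule card_subset_eq)
      (use B inj assms(3) int_basis_card[OF B(1)] in \<open>auto simp: card_image int_basis_def\<close>)
  then show ?thesis using B inj by (simp add: unimodular_def)
qed

section \<open>Linear relations\<close>

abbreviation comb :: "'a set \<Rightarrow> ('a \<Rightarrow> int vec) \<Rightarrow> ('a \<Rightarrow> real) \<Rightarrow> nat \<Rightarrow> real" where
  "comb V lam c j \<equiv> (\<Sum>v\<in>V. c v * real_of_int (lam v $ j))"

text \<open>The relations are taken with real coefficients, because they compare points of real cones. They
  determine a characteristic map up to D-J equivalence, and they behave better than the map itself
  under wedges; so all arguments below are about relations.\<close>

definition relations :: "nat \<Rightarrow> 'a set \<Rightarrow> ('a \<Rightarrow> int vec) \<Rightarrow> ('a \<Rightarrow> real) set" where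
  "relations n V lam = {c. \<forall>j<n. comb V lam c j = 0}"

lemma relationsD: "c \<in> relations n V lam \<Longrightarrow> j < n \<Longrightarrow> comb V lam c j = 0"
  by (simp add: relations_def)

lemma relations_cong: "(\<And>v. v \<in> V \<Longrightarrow> c v = d v) \<Longrightarrow> c \<in> relations n V lam \<longleftrightarrow> d \<in> relations n V lam"
  by (simp add: relations_def cong: sum.cong)

lemma relations_add: "c \<in> relations n V lam \<Longrightarrow> d \<in> relations n V lam \<Longrightarrow> (\<lambda>v. c v + d v) \<in> relations n V lam"
  by (simp add: relations_def sum.distrib ring_distribs)

lemma relations_diff: "c \<in> relations n V lam \<Longrightarrow> d \<in> relations n V lam \<Longrightarrow> (\<lambda>v. c v - d v) \<in> relations n V lam"
  by (simp add: relations_def sum_subtractf ring_distribs)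

lemma relations_scale: "c \<in> relations n V lam \<Longrightarrow> (\<lambda>v. s * c v) \<in> relations n V lam"
  by (simp add: relations_def mult.assoc flip: sum_distrib_left)

lemma relations_sum: "(\<And>i. i \<in> I \<Longrightarrow> c i \<in> relations n V lam) \<Longrightarrow> (\<lambda>v. \<Sum>i\<in>I. c i v) \<in> relations n V lam"
  unfolding relations_def
  by (auto simp: sum_distrib_right) (subst sum.swap, simp)

lemma dual_real:
  fixes g :: "'a \<Rightarrow> nat \<Rightarrow> int" and lam :: "'a \<Rightarrow> int vec"
  assumes "\<And>u v. u \<in> \<tau> \<Longrightarrow> v \<in> \<tau> \<Longrightarrow> (\<Sum>j<n. g u j * lam v $ j) = (if u = v then 1 else 0)"
    and "finite \<tau>" "u \<in> \<tau>"
  shows "(\<Sum>j<n. real_of_int (g u j) * comb \<tau> lam c j) = c u"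
proof -
  have "(\<Sum>j<n. real_of_int (g u j) * comb \<tau> lam c j)
      = (\<Sum>j<n. \<Sum>v\<in>\<tau>. c v * real_of_int (g u j * lam v $ j))"
    by (simp add: sum_distrib_left mult_ac)
  also have "\<dots> = (\<Sum>v\<in>\<tau>. c v * real_of_int (\<Sum>j<n. g u j * lam v $ j))"
    by (subst sum.swap) (simp add: sum_distrib_left)
  also have "\<dots> = (\<Sum>v\<in>\<tau>. if u = v then c v else 0)"
    using assms by (intro sum.cong) auto
  finally show ?thesis using assms by simp
qed

lemma unimodular_relation_zero:
  assumes un: "unimodular n lam \<tau>" and sub: "\<tau> \<subseteq> V" "finite V"
    and c: "c \<in> relations n V lam" "\<And>v. v \<in> V - \<tau> \<Longrightarrow> c v = 0" and v: "v \<in> V"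
  shows "c v = 0"
proof (cases "v \<in> \<tau>")
  case True
  obtain g where "dual_coordinates n lam \<tau> g"
    by (rule unimodular_dual[OF un])
  note g = dual_coordinatesD[OF this]
  have "comb \<tau> lam c j = 0" if "j < n" for j
    using relationsD[OF c(1) that] sum.mono_neutral_right[of V \<tau> "\<lambda>v. c v * real_of_int (lam v $ j)"] sub c(2)
    by auto
  then show ?thesis
    using dual_real[where \<tau> = \<tau> and n = n and g = g and lam = lam and u = v and c = c] g(2) True unimodular_finite[OF un] by simp
qed (use c v in auto)

text \<open>Every vector is an integer combination of a unimodular set. So a relation may be prescribed
  outside a facet, and the resulting coefficients are integers; this is where non-singularity
  enters the classification.\<close>

lemma unimodular_relation:
  assumes un: "unimodular n lam \<tau>" and sub: "\<tau> \<subseteq> V" "finite V" and u: "u \<in> V - \<tau>"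
  obtains x :: "'a \<Rightarrow> int" where "(\<lambda>v. real_of_int (x v)) \<in> relations n V lam"
    "x u = 1" "\<And>v. v \<in> V - \<tau> \<Longrightarrow> v \<noteq> u \<Longrightarrow> x v = 0"
proof -
  obtain g where "dual_coordinates n lam \<tau> g"
    by (rule unimodular_dual[OF un])
  note g = dual_coordinatesD[OF this]
  define x where "x v = (if v = u then 1 else if v \<in> \<tau> then - (\<Sum>j<n. g v j * lam u $ j) else 0)" for v
  have fin: "finite \<tau>" by (rule unimodular_finite[OF un])
  have "(\<Sum>v\<in>V. x v * lam v $ i) = 0" if i: "i < n" for i
  proof -
    have "(\<Sum>v\<in>\<tau>. (\<Sum>j<n. g v j * lam u $ j) * lam v $ i)
        = (\<Sum>v\<in>\<tau>. \<Sum>j<n. lam u $ j * (lam v $ i * g v j))"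
      by (simp add: sum_distrib_left sum_distrib_right mult_ac)
    also have "\<dots> = (\<Sum>j<n. lam u $ j * (\<Sum>v\<in>\<tau>. lam v $ i * g v j))"
      by (subst sum.swap) (simp add: sum_distrib_left)
    also have "\<dots> = (\<Sum>j<n. if i = j then lam u $ j else 0)"
      using i by (intro sum.cong) (auto simp: g(1))
    finally have *: "(\<Sum>v\<in>\<tau>. (\<Sum>j<n. g v j * lam u $ j) * lam v $ i) = lam u $ i"
      using i by simp
    have "(\<Sum>v\<in>V. x v * lam v $ i) = (\<Sum>v\<in>insert u \<tau>. x v * lam v $ i)"
      by (rule sum.mono_neutral_right) (use sub u in \<open>auto simp: x_def\<close>)
    also have "\<dots> = x u * lam u $ i + (\<Sum>v\<in>\<tau>. x v * lam v $ i)"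
      using u fin by simp
    also have "(\<Sum>v\<in>\<tau>. x v * lam v $ i) = (\<Sum>v\<in>\<tau>. - ((\<Sum>j<n. g v j * lam u $ j) * lam v $ i))"
      using u by (intro sum.cong) (auto simp: x_def)
    finally show ?thesis using * by (simp add: sum_negf x_def)
  qed
  then have "(\<lambda>v. real_of_int (x v)) \<in> relations n V lam"
    by (auto simp: relations_def simp flip: of_int_mult of_int_sum)
  then show thesis
    by (rule that) (use u in \<open>auto simp: x_def\<close>)
qed

text \<open>Once one unimodular set is known, unimodularity of another set is a property of the relations
  alone: the set must span, by integer relations, and carry no relation of its own. This allows
  the transfer of unimodularity between maps whose relations correspond.\<close>

lemma unimodular_exchange:
  assumes un: "unimodular n lam \<tau>\<^sub>0" and sub: "\<tau>\<^sub>0 \<subseteq> V" "\<tau> \<subseteq> V" "finite V"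
    and car: "\<And>v. v \<in> V \<Longrightarrow> lam v \<in> carrier_vec n"
    and span: "\<And>u. u \<in> V - \<tau> \<Longrightarrow> \<exists>x :: 'a \<Rightarrow> int. (\<lambda>v. real_of_int (x v)) \<in> relations n V lam \<and>
        x u = 1 \<and> (\<forall>v\<in>V - \<tau>. v \<noteq> u \<longrightarrow> x v = 0)"
    and indep: "\<And>c v. c \<in> relations n V lam \<Longrightarrow> (\<And>v. v \<in> V - \<tau> \<Longrightarrow> c v = 0) \<Longrightarrow> v \<in> V \<Longrightarrow> c v = 0"
  shows "unimodular n lam \<tau>"
proof -
  have fin: "finite \<tau>" "finite \<tau>\<^sub>0" using sub finite_subset by auto
  have "\<forall>u\<in>V. \<exists>k :: 'a \<Rightarrow> int. \<forall>i<n. (\<Sum>v\<in>\<tau>. k v * lam v $ i) = lam u $ i"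
  proof
    fix u assume u: "u \<in> V"
    show "\<exists>k :: 'a \<Rightarrow> int. \<forall>i<n. (\<Sum>v\<in>\<tau>. k v * lam v $ i) = lam u $ i"
    proof (cases "u \<in> \<tau>")
      case True
      then show ?thesis
        using fin by (intro exI[of _ "\<lambda>v. if v = u then 1 else 0"])
          (simp add: if_distrib[of "\<lambda>x. x * _"] cong: if_cong)
    next
      case False
      then obtain x :: "'a \<Rightarrow> int" where x: "(\<lambda>v. real_of_int (x v)) \<in> relations n V lam"
        "x u = 1" "\<forall>v\<in>V - \<tau>. v \<noteq> u \<longrightarrow> x v = 0"
        using span[of u] u by blast
      have "(\<Sum>v\<in>\<tau>. (- x v) * lam v $ i) = lam u $ i" if i: "i < n" for i
      proof -
        have "real_of_int (\<Sum>v\<in>V. x v * lam v $ i) = 0"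
          using relationsD[OF x(1) i] by simp
        then have "(\<Sum>v\<in>V. x v * lam v $ i) = 0" by linarith
        moreover have "(\<Sum>v\<in>V. x v * lam v $ i) = (\<Sum>v\<in>insert u \<tau>. x v * lam v $ i)"
          by (rule sum.mono_neutral_right) (use sub u x in auto)
        ultimately show ?thesis using False fin x(2) by (simp add: sum_negf)
      qed
      then show ?thesis by (intro exI[of _ "\<lambda>v. - x v"]) auto
    qed
  qed
  then obtain k :: "'a \<Rightarrow> 'a \<Rightarrow> int" where
    k: "\<And>u i. u \<in> V \<Longrightarrow> i < n \<Longrightarrow> (\<Sum>v\<in>\<tau>. k u v * lam v $ i) = lam u $ i"
    by metis
  obtain g0 where "dual_coordinates n lam \<tau>\<^sub>0 g0"
    by (rule unimodular_dual[OF un])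
  note g0 = dual_coordinatesD[OF this]
  define g where "g v j = (\<Sum>u\<in>\<tau>\<^sub>0. k u v * g0 u j)" for v j
  have 1: "(\<Sum>v\<in>\<tau>. lam v $ i * g v j) = (if i = j then 1 else 0)" if ij: "i < n" "j < n" for i j
  proof -
    have "(\<Sum>v\<in>\<tau>. lam v $ i * g v j) = (\<Sum>v\<in>\<tau>. \<Sum>u\<in>\<tau>\<^sub>0. k u v * lam v $ i * g0 u j)"
      by (simp add: g_def sum_distrib_left mult_ac)
    also have "\<dots> = (\<Sum>u\<in>\<tau>\<^sub>0. (\<Sum>v\<in>\<tau>. k u v * lam v $ i) * g0 u j)"
      by (subst sum.swap) (simp add: sum_distrib_right)
    also have "\<dots> = (\<Sum>u\<in>\<tau>\<^sub>0. lam u $ i * g0 u j)"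
      by (rule sum.cong) (use k ij sub in auto)
    finally show ?thesis using g0(1) ij by simp
  qed
  have 2: "(\<Sum>j<n. g u j * lam v $ j) = (if u = v then 1 else 0)" if uv: "u \<in> \<tau>" "v \<in> \<tau>" for u v
  proof -
    define c where "c u = (if u \<in> \<tau> then (\<Sum>j<n. g u j * lam v $ j) - (if u = v then 1 else 0) else 0)" for u
    have "(\<Sum>u\<in>V. c u * lam u $ i) = 0" if i: "i < n" for i
    proof -
      have "(\<Sum>u\<in>V. c u * lam u $ i) = (\<Sum>u\<in>\<tau>. c u * lam u $ i)"
        by (rule sum.mono_neutral_right) (use sub in \<open>auto simp: c_def\<close>)
      also have "\<dots> = (\<Sum>u\<in>\<tau>. (\<Sum>j<n. lam v $ j * (lam u $ i * g u j)) - (if u = v then lam u $ i else 0))"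
        by (rule sum.cong) (auto simp: c_def algebra_simps sum_distrib_left sum_distrib_right)
      also have "\<dots> = (\<Sum>j<n. lam v $ j * (\<Sum>u\<in>\<tau>. lam u $ i * g u j)) - lam v $ i"
        by (subst sum_subtractf, subst sum.swap) (use uv fin in \<open>simp add: sum_distrib_left\<close>)
      also have "(\<Sum>j<n. lam v $ j * (\<Sum>u\<in>\<tau>. lam u $ i * g u j)) = (\<Sum>j<n. if i = j then lam v $ j else 0)"
        by (rule sum.cong) (use i 1 in auto)
      finally show ?thesis using i by simp
    qed
    then have "(\<lambda>u. real_of_int (c u)) \<in> relations n V lam"
      by (auto simp: relations_def simp flip: of_int_mult of_int_sum)
    then have "real_of_int (c u) = 0"
      by (rule indep[where v = u]) (use uv sub in \<open>auto simp: c_def\<close>)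
    then have "c u = 0" by (simp only: of_int_eq_0_iff)
    then show ?thesis using uv by (simp add: c_def)
  qed
  show ?thesis
    by (rule unimodularI[of _ _ _ g]) (use fin car sub 1 2 in auto)
qed

section \<open>Unimodular fans and unique coordinates\<close>

text \<open>Cones are generated by sets of vectors; for an injective family the coefficients may be indexed
  by the vertices instead.\<close>

lemma gen_cone_family:
  assumes inj: "inj_on lam \<sigma>"
  shows "gen_cone n (lam ` \<sigma>) =
    {vec n (\<lambda>j. comb \<sigma> lam c j) |c. \<forall>v\<in>\<sigma>. 0 \<le> c v}" (is "_ = ?R")
proof
  show "gen_cone n (lam ` \<sigma>) \<subseteq> ?R"
  proof
    fix x assume "x \<in> gen_cone n (lam ` \<sigma>)"
    then obtain c where c: "\<forall>s\<in>lam ` \<sigma>. 0 \<le> c s"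
      "x = vec n (\<lambda>j. \<Sum>s\<in>lam ` \<sigma>. c s * real_of_int (s $ j))"
      unfolding gen_cone_def by blast
    then show "x \<in> ?R"
      using inj by (auto intro!: exI[of _ "\<lambda>v. c (lam v)"] simp: sum.reindex)
  qed
  show "?R \<subseteq> gen_cone n (lam ` \<sigma>)"
  proof
    fix x assume "x \<in> ?R"
    then obtain c where c: "\<forall>s\<in>\<sigma>. 0 \<le> c s"
      "x = vec n (\<lambda>j. comb \<sigma> lam c j)" by blast
    have *: "c (the_inv_into \<sigma> lam (lam v)) = c v" if "v \<in> \<sigma>" for v
      using that inj by (simp add: the_inv_into_f_f)
    show "x \<in> gen_cone n (lam ` \<sigma>)"
      unfolding gen_cone_def mem_Collect_eq
      by (rule exI[of _ "\<lambda>s. c (the_inv_into \<sigma> lam s)"])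
        (use c inj * in \<open>auto simp: sum.reindex cong: sum.cong\<close>)
  qed
qed

lemma scalar_prod_comb:
  fixes u :: "real vec" and f :: "'a \<Rightarrow> nat \<Rightarrow> real"
  shows "u \<bullet> vec n (\<lambda>j. \<Sum>s\<in>S. c s * f s j) = (\<Sum>s\<in>S. c s * (\<Sum>j<n. u $ j * f s j))"
proof -
  have "u \<bullet> vec n (\<lambda>j. \<Sum>s\<in>S. c s * f s j) = (\<Sum>j<n. \<Sum>s\<in>S. c s * (u $ j * f s j))"
    by (simp add: scalar_prod_def sum_distrib_left mult_ac atLeast0LessThan)
  also have "\<dots> = (\<Sum>s\<in>S. c s * (\<Sum>j<n. u $ j * f s j))"
    by (subst sum.swap) (simp add: sum_distrib_left)
  finally show ?thesis .
qed

text \<open>A supporting functional matters only through its values \<open>h\<close> on the generators.\<close>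

lemma cone_face_weights:
  assumes fin: "finite \<sigma>" and inj: "inj_on lam \<sigma>" and face: "cone_face n F (gen_cone n (lam ` \<sigma>))"
  obtains h :: "'a \<Rightarrow> real" where "\<And>v. v \<in> \<sigma> \<Longrightarrow> 0 \<le> h v"
    "F = {vec n (\<lambda>j. comb \<sigma> lam c j) |c.
        (\<forall>v\<in>\<sigma>. 0 \<le> c v) \<and> (\<Sum>v\<in>\<sigma>. c v * h v) = 0}"
proof -
  let ?x = "\<lambda>c. vec n (\<lambda>j. comb \<sigma> lam c j)"
  obtain u where u: "u \<in> carrier_vec n" "\<And>x. x \<in> gen_cone n (lam ` \<sigma>) \<Longrightarrow> 0 \<le> u \<bullet> x"
    and F: "F = {x \<in> gen_cone n (lam ` \<sigma>). u \<bullet> x = 0}"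
    using face unfolding cone_face_def by auto
  define h where "h v = (\<Sum>j<n. u $ j * real_of_int (lam v $ j))" for v
  have ux: "u \<bullet> ?x c = (\<Sum>v\<in>\<sigma>. c v * h v)" for c
    unfolding h_def by (rule scalar_prod_comb)
  have "0 \<le> h v" if v: "v \<in> \<sigma>" for v
  proof -
    have "?x (\<lambda>w. if w = v then 1 else 0) \<in> gen_cone n (lam ` \<sigma>)"
      unfolding gen_cone_family[OF inj] by auto
    from u(2)[OF this] show ?thesis
      unfolding ux using v fin by (simp add: if_distrib[of "\<lambda>x. x * _"] cong: if_cong)
  qed
  moreover have "F = {?x c |c. (\<forall>v\<in>\<sigma>. 0 \<le> c v) \<and> (\<Sum>v\<in>\<sigma>. c v * h v) = 0}"
    unfolding F gen_cone_family[OF inj] using ux by auto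
  ultimately show thesis by (rule that)
qed

lemma cone_face_subset:
  assumes fin: "finite \<sigma>" and inj: "inj_on lam \<sigma>" and face: "cone_face n F (gen_cone n (lam ` \<sigma>))"
  obtains \<sigma>' where "\<sigma>' \<subseteq> \<sigma>" "F = gen_cone n (lam ` \<sigma>')"
proof -
  let ?x = "\<lambda>c. vec n (\<lambda>j. comb \<sigma> lam c j)"
  obtain h where h: "\<And>v. v \<in> \<sigma> \<Longrightarrow> 0 \<le> h v"
    and F: "F = {?x c |c. (\<forall>v\<in>\<sigma>. 0 \<le> c v) \<and> (\<Sum>v\<in>\<sigma>. c v * h v) = 0}"
    using cone_face_weights[OF assms] by blast
  define \<sigma>' where "\<sigma>' = {v \<in> \<sigma>. h v = 0}"
  have sub: "\<sigma>' \<subseteq> \<sigma>" by (auto simp: \<sigma>'_def)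
  have inj': "inj_on lam \<sigma>'" using inj sub by (rule inj_on_subset)
  let ?x' = "\<lambda>c. vec n (\<lambda>j. comb \<sigma>' lam c j)"
  have eq: "?x c = ?x' c" if "\<forall>v\<in>\<sigma> - \<sigma>'. c v = 0" for c
    using that sub fin by (intro eq_vecI) (auto intro: sum.mono_neutral_right)
  have "F = gen_cone n (lam ` \<sigma>')"
  proof (intro equalityI subsetI)
    fix x assume "x \<in> F"
    then obtain c where c: "x = ?x c" "\<forall>v\<in>\<sigma>. 0 \<le> c v" "(\<Sum>v\<in>\<sigma>. c v * h v) = 0"
      unfolding F by blast
    have "\<forall>v\<in>\<sigma>. c v * h v = 0"
      using c h fin by (subst (asm) sum_nonneg_eq_0_iff) auto
    then have "\<forall>v\<in>\<sigma> - \<sigma>'. c v = 0" by (auto simp: \<sigma>'_def)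
    from eq[OF this] show "x \<in> gen_cone n (lam ` \<sigma>')"
      unfolding gen_cone_family[OF inj'] using c sub by auto
  next
    fix x assume "x \<in> gen_cone n (lam ` \<sigma>')"
    then obtain c where c: "x = ?x' c" "\<forall>v\<in>\<sigma>'. 0 \<le> c v"
      unfolding gen_cone_family[OF inj'] by blast
    define d where "d v = (if v \<in> \<sigma>' then c v else 0)" for v
    have "x = ?x' d" using c(1) by (auto simp: d_def intro!: eq_vecI sum.cong)
    also have "\<dots> = ?x d" by (rule eq[symmetric]) (auto simp: d_def)
    finally have "x = ?x d" .
    moreover have "\<forall>v\<in>\<sigma>. 0 \<le> d v" using c by (auto simp: d_def)
    moreover have "(\<Sum>v\<in>\<sigma>. d v * h v) = 0"
      by (rule sum.neutral) (auto simp: d_def \<sigma>'_def)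
    ultimately show "x \<in> F" unfolding F by blast
  qed
  with sub show thesis by (rule that)
qed

lemma part_of_basis_finite:
  "int_basis n B \<Longrightarrow> lam ` \<sigma> \<subseteq> B \<Longrightarrow> inj_on lam \<sigma> \<Longrightarrow> finite \<sigma>"
  unfolding int_basis_def by (meson finite_imageD finite_subset)

lemma part_of_basis_unimodular:
  assumes "int_basis n B" "lam ` \<sigma> \<subseteq> B" "inj_on lam \<sigma>"
  obtains g :: "'a \<Rightarrow> nat \<Rightarrow> int" where
    "\<And>u v. u \<in> \<sigma> \<Longrightarrow> v \<in> \<sigma> \<Longrightarrow> (\<Sum>j<n. g u j * lam v $ j) = (if u = v then 1 else 0)"
proof -
  obtain g where "dual_coordinates n (\<lambda>b. b) B g"
    by (rule int_basis_dual[OF assms(1)])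
  note g = dual_coordinatesD[OF this]
  show thesis
    by (rule that[of "\<lambda>v. g (lam v)"])
      (use g(2) assms(2) in \<open>simp add: image_subset_iff inj_on_eq_iff[OF assms(3)]\<close>)
qed

lemma part_of_basis_coefficients:
  assumes bas: "int_basis n B" "lam ` \<sigma> \<subseteq> B" "inj_on lam \<sigma>"
    and eq: "\<And>j. j < n \<Longrightarrow> comb \<sigma> lam c j = comb \<sigma> lam d j"
    and v: "v \<in> \<sigma>"
  shows "c v = d v"
proof -
  have fin: "finite \<sigma>"
    by (rule part_of_basis_finite[OF bas])
  obtain g :: "'a \<Rightarrow> nat \<Rightarrow> int" where
    g: "\<And>u v. u \<in> \<sigma> \<Longrightarrow> v \<in> \<sigma> \<Longrightarrow> (\<Sum>j<n. g u j * lam v $ j) = (if u = v then 1 else 0)"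
    using part_of_basis_unimodular[OF bas] by blast
  have "c v = (\<Sum>j<n. real_of_int (g v j) * comb \<sigma> lam c j)"
    by (rule dual_real[symmetric]) (use g fin v in auto)
  also have "\<dots> = (\<Sum>j<n. real_of_int (g v j) * comb \<sigma> lam d j)"
    by (rule sum.cong) (use eq in auto)
  also have "\<dots> = d v"
    by (rule dual_real) (use g fin v in auto)
  finally show ?thesis .
qed

text \<open>The supporting functional is the sum of the dual coordinates of the generators that are left out.\<close>

lemma cone_face_of_part:
  assumes bas: "int_basis n B" "lam ` \<sigma> \<subseteq> B" "inj_on lam \<sigma>" and sub: "\<rho> \<subseteq> \<sigma>"
  shows "cone_face n (gen_cone n (lam ` \<rho>)) (gen_cone n (lam ` \<sigma>))"
proof -
  let ?x = "\<lambda>\<sigma> c. vec n (\<lambda>j. comb \<sigma> lam c j)"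
  have fin: "finite \<sigma>"
    by (rule part_of_basis_finite[OF bas])
  have inj': "inj_on lam \<rho>" using bas(3) sub by (rule inj_on_subset)
  obtain g :: "'a \<Rightarrow> nat \<Rightarrow> int" where
    g: "\<And>u v. u \<in> \<sigma> \<Longrightarrow> v \<in> \<sigma> \<Longrightarrow> (\<Sum>j<n. g u j * lam v $ j) = (if u = v then 1 else 0)"
    using part_of_basis_unimodular[OF bas] by blast
  define u where "u = vec n (\<lambda>j. real_of_int (\<Sum>w\<in>\<sigma> - \<rho>. g w j))"
  have h: "(\<Sum>j<n. u $ j * real_of_int (lam v $ j)) = (if v \<in> \<sigma> - \<rho> then 1 else 0)" if v: "v \<in> \<sigma>" for v
  proof -
    have "(\<Sum>j<n. u $ j * real_of_int (lam v $ j)) = real_of_int (\<Sum>j<n. \<Sum>w\<in>\<sigma> - \<rho>. g w j * lam v $ j)"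
      by (simp add: u_def sum_distrib_right)
    also have "(\<Sum>j<n. \<Sum>w\<in>\<sigma> - \<rho>. g w j * lam v $ j) = (\<Sum>w\<in>\<sigma> - \<rho>. if w = v then 1 else 0)"
      by (subst sum.swap, rule sum.cong) (use g v in auto)
    finally show ?thesis using fin by simp
  qed
  have ux: "u \<bullet> ?x \<sigma> c = (\<Sum>v\<in>\<sigma> - \<rho>. c v)" for c
  proof -
    have "u \<bullet> ?x \<sigma> c = (\<Sum>v\<in>\<sigma>. c v * (if v \<in> \<sigma> - \<rho> then 1 else 0))"
      unfolding scalar_prod_comb by (rule sum.cong) (use h in auto)
    also have "\<dots> = (\<Sum>v\<in>\<sigma> - \<rho>. c v * (if v \<in> \<sigma> - \<rho> then 1 else 0))"
      by (rule sum.mono_neutral_right) (use fin in auto)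
    finally show ?thesis by simp
  qed
  have eq: "?x \<sigma> c = ?x \<rho> c" if "\<forall>v\<in>\<sigma> - \<rho>. c v = 0" for c
    using that sub fin by (intro eq_vecI) (auto intro: sum.mono_neutral_right)
  have "gen_cone n (lam ` \<rho>) = {x \<in> gen_cone n (lam ` \<sigma>). u \<bullet> x = 0}"
  proof (intro equalityI subsetI)
    fix x assume "x \<in> gen_cone n (lam ` \<rho>)"
    then obtain c where c: "x = ?x \<rho> c" "\<forall>v\<in>\<rho>. 0 \<le> c v"
      unfolding gen_cone_family[OF inj'] by blast
    define d where "d v = (if v \<in> \<rho> then c v else 0)" for v
    have "x = ?x \<rho> d" using c(1) by (auto simp: d_def intro!: eq_vecI sum.cong)
    also have "\<dots> = ?x \<sigma> d" by (rule eq[symmetric]) (auto simp: d_def)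
    finally have x: "x = ?x \<sigma> d" .
    moreover have "\<forall>v\<in>\<sigma>. 0 \<le> d v" using c by (auto simp: d_def)
    ultimately have "x \<in> gen_cone n (lam ` \<sigma>)" unfolding gen_cone_family[OF bas(3)] by blast
    moreover have "u \<bullet> x = 0" unfolding x ux by (rule sum.neutral) (auto simp: d_def)
    ultimately show "x \<in> {x \<in> gen_cone n (lam ` \<sigma>). u \<bullet> x = 0}" by simp
  next
    fix x assume "x \<in> {x \<in> gen_cone n (lam ` \<sigma>). u \<bullet> x = 0}"
    then obtain c where c: "x = ?x \<sigma> c" "\<forall>v\<in>\<sigma>. 0 \<le> c v" "u \<bullet> x = 0"
      unfolding gen_cone_family[OF bas(3)] by blast
    have "(\<Sum>v\<in>\<sigma> - \<rho>. c v) = 0" using c(3) unfolding c(1) ux .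
    then have "\<forall>v\<in>\<sigma> - \<rho>. c v = 0"
      using c(2) fin by (subst (asm) sum_nonneg_eq_0_iff) auto
    from eq[OF this] show "x \<in> gen_cone n (lam ` \<rho>)"
      unfolding gen_cone_family[OF inj'] using c sub by auto
  qed
  moreover have "0 \<le> u \<bullet> x" if x: "x \<in> gen_cone n (lam ` \<sigma>)" for x
  proof -
    obtain c where c: "x = ?x \<sigma> c" "\<forall>v\<in>\<sigma>. 0 \<le> c v"
      using x unfolding gen_cone_family[OF bas(3)] by blast
    show ?thesis unfolding c(1) ux by (rule sum_nonneg) (use c in auto)
  qed
  moreover have "u \<in> carrier_vec n" by (simp add: u_def)
  ultimately show ?thesis unfolding cone_face_def by blast
qed

text \<open>Let \<open>u\<close> generate a ray of the cone. By \<open>cone_face_subset\<close> the ray is generated by some \<open>S'\<close>, so every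
  \<open>s \<in> S'\<close> is a multiple of \<open>u\<close>, while \<open>u\<close> is a combination of \<open>S'\<close>. Independence leaves a single \<open>s\<close>, and
  primitivity makes the factor \<open>1\<close>.\<close>

lemma ray_gens_gen_cone:
  assumes bas: "int_basis n B" "S \<subseteq> B"
  shows "ray_gens n (gen_cone n S) = S"
proof -
  have id: "gen_cone n S' = {vec n (\<lambda>j. \<Sum>v\<in>S'. c v * real_of_int (v $ j)) |c. \<forall>v\<in>S'. 0 \<le> c v}" for S'
    using gen_cone_family[of id S' n] by simp
  have fin: "finite S" and car: "S \<subseteq> carrier_vec n"
    using bas finite_subset by (auto simp: int_basis_def)
  obtain g :: "int vec \<Rightarrow> nat \<Rightarrow> int" where
    g: "\<And>u v. u \<in> S \<Longrightarrow> v \<in> S \<Longrightarrow> (\<Sum>j<n. g u j * v $ j) = (if u = v then 1 else 0)"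
    using part_of_basis_unimodular[of n B id S] bas by auto
  have prim: "primitive_vec n s" if s: "s \<in> S" for s
    unfolding primitive_vec_def
  proof (intro conjI allI impI)
    fix d assume "\<forall>j<n. d dvd s $ j"
    then have "d dvd (\<Sum>j<n. g s j * s $ j)" by (auto intro!: dvd_sum)
    then show "d dvd 1" using g s by simp
  qed (use s car in auto)
  show ?thesis
  proof (intro equalityI subsetI)
    fix s assume s: "s \<in> S"
    have "cone_face n (gen_cone n {s}) (gen_cone n S)"
      using cone_face_of_part[of n B id S "{s}"] bas s by simp
    then show "s \<in> ray_gens n (gen_cone n S)" using prim[OF s] by (simp add: ray_gens_def)
  next
    fix u assume "u \<in> ray_gens n (gen_cone n S)"
    then have u: "primitive_vec n u" and face: "cone_face n (gen_cone n {u}) (gen_cone n S)"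
      by (auto simp: ray_gens_def)
    obtain S' where S': "S' \<subseteq> S" "gen_cone n {u} = gen_cone n S'"
      using cone_face_subset[of S id n "gen_cone n {u}"] fin face by auto
    have fin': "finite S'" using fin S'(1) finite_subset by blast
    have "vec n (\<lambda>j. real_of_int (u $ j)) \<in> gen_cone n {u}"
      unfolding id by (auto intro!: exI[of _ "\<lambda>_. 1"])
    then have "vec n (\<lambda>j. real_of_int (u $ j)) \<in> gen_cone n S'"
      unfolding S'(2) .
    then obtain c where c: "vec n (\<lambda>j. real_of_int (u $ j)) = vec n (\<lambda>j. \<Sum>v\<in>S'. c v * real_of_int (v $ j))"
      "\<forall>v\<in>S'. 0 \<le> c v"
      unfolding id by blast
    have uj: "real_of_int (u $ j) = (\<Sum>v\<in>S'. c v * real_of_int (v $ j))" if "j < n" for j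
      using arg_cong[OF c(1), of "\<lambda>x. x $ j"] that by simp
    have "S' \<noteq> {}"
    proof
      assume "S' = {}"
      then have "\<forall>j<n. 2 dvd u $ j" using uj by auto
      then show False using u unfolding primitive_vec_def by fastforce
    qed
    then obtain s where s: "s \<in> S'" by blast
    have "vec n (\<lambda>j. real_of_int (s $ j)) \<in> gen_cone n S'"
      unfolding id using s fin'
      by (auto intro!: exI[of _ "\<lambda>v. if v = s then 1 else 0"] eq_vecI
            simp: if_distrib[of "\<lambda>x. x * _"] cong: if_cong)
    then have "vec n (\<lambda>j. real_of_int (s $ j)) \<in> gen_cone n {u}"
      unfolding S'(2) .
    then obtain k where "vec n (\<lambda>j. real_of_int (s $ j)) = vec n (\<lambda>j. k * real_of_int (u $ j))"
      unfolding id by auto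
    then have k: "real_of_int (s $ j) = k * real_of_int (u $ j)" if "j < n" for j
      using that by (auto dest: arg_cong[of _ _ "\<lambda>x. x $ j"])
    have cv: "c v = real_of_int (\<Sum>j<n. g v j * u $ j)" if v: "v \<in> S'" for v
    proof -
      have "c v = (\<Sum>j<n. real_of_int (g v j) * comb S' id c j)"
        by (rule dual_real[symmetric]) (use g S'(1) fin' v in \<open>simp_all add: subset_iff\<close>)
      then show ?thesis using uj by simp
    qed
    have kc: "k * c v = (if v = s then 1 else 0)" if v: "v \<in> S'" for v
    proof -
      have "k * c v = (\<Sum>j<n. real_of_int (g v j) * real_of_int (s $ j))"
        unfolding cv[OF v] by (simp add: sum_distrib_left k mult_ac)
      also have "\<dots> = real_of_int (\<Sum>j<n. g v j * s $ j)" by simp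
      also have "\<dots> = (if v = s then 1 else 0)" by (subst g) (use v s S'(1) in auto)
      finally show ?thesis .
    qed
    have "c v = 0" if "v \<in> S'" "v \<noteq> s" for v
      using kc[OF that(1)] kc[OF s] that by auto
    then have us: "real_of_int (u $ j) = c s * real_of_int (s $ j)" if "j < n" for j
      unfolding uj[OF that] using s fin' by (subst sum.remove[of S' s]) auto
    define d where "d = (\<Sum>j<n. g s j * u $ j)"
    have ud: "u $ j = d * s $ j" if "j < n" for j
      using us[OF that] unfolding cv[OF s] d_def[symmetric] by (simp flip: of_int_mult)
    then have "\<forall>j<n. d dvd u $ j" by auto
    then have "d dvd 1" using u unfolding primitive_vec_def by blast
    moreover have "0 \<le> d" using c(2) s cv[OF s] by (auto simp: d_def[symmetric])
    ultimately have "d = 1" by simp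
    then have "u = s"
      using ud u s S'(1) car by (intro eq_vecI) (auto simp: primitive_vec_def)
    then show "u \<in> S" using s S'(1) by auto
  qed
qed

definition cone_coordinates :: "'a set set \<Rightarrow> ('a \<Rightarrow> real) \<Rightarrow> bool" where
  "cone_coordinates K c \<longleftrightarrow> (\<forall>v. 0 \<le> c v) \<and> {v. c v \<noteq> 0} \<in> K"

text \<open>The combinatorial content of a complete simplicial fan: every vector lies in the relative interior
  of the cone of exactly one face. Completeness and the intersection property of fans are replaced
  by existence and uniqueness of these coordinates, and uniqueness is phrased by relations.\<close>

definition unique_coordinates :: "'a set set \<Rightarrow> ('a \<Rightarrow> int vec) \<Rightarrow> bool" where
  "unique_coordinates K lam \<longleftrightarrow>
     (\<forall>x. \<exists>c. cone_coordinates K c \<and> (\<forall>j<cdim K. comb (\<Union>K) lam c j = x j)) \<and>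
     (\<forall>c d. cone_coordinates K c \<longrightarrow> cone_coordinates K d \<longrightarrow>
        (\<lambda>v. c v - d v) \<in> relations (cdim K) (\<Union>K) lam \<longrightarrow> c = d)"

text \<open>Besides unimodularity this includes that all facets have the same dimension.\<close>

definition unimodular_complex :: "'a set set \<Rightarrow> ('a \<Rightarrow> int vec) \<Rightarrow> bool" where
  "unimodular_complex K lam \<longleftrightarrow> abstract_complex K \<and> (\<forall>v\<in>\<Union>K. lam v \<in> carrier_vec (cdim K)) \<and>
     (\<forall>\<sigma>\<in>K. \<exists>\<tau>\<in>K. \<sigma> \<subseteq> \<tau> \<and> unimodular (cdim K) lam \<tau>)"

lemma gen_cone_iff:
  assumes inj: "inj_on lam \<sigma>" and sub: "\<sigma> \<subseteq> V" "finite V"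
  shows "x \<in> gen_cone n (lam ` \<sigma>) \<longleftrightarrow>
    (\<exists>c. (\<forall>v. 0 \<le> c v) \<and> {v. c v \<noteq> 0} \<subseteq> \<sigma> \<and> x = vec n (\<lambda>j. comb V lam c j))"
proof
  assume "x \<in> gen_cone n (lam ` \<sigma>)"
  then obtain c where c: "x = vec n (\<lambda>j. comb \<sigma> lam c j)" "\<forall>v\<in>\<sigma>. 0 \<le> c v"
    unfolding gen_cone_family[OF inj] by blast
  define d where "d v = (if v \<in> \<sigma> then c v else 0)" for v
  have "comb \<sigma> lam c j = comb V lam d j" for j
    by (rule sum.mono_neutral_cong_left) (use sub in \<open>auto simp: d_def\<close>)
  then show "\<exists>c. (\<forall>v. 0 \<le> c v) \<and> {v. c v \<noteq> 0} \<subseteq> \<sigma> \<and> x = vec n (\<lambda>j. comb V lam c j)"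
    using c by (intro exI[of _ d]) (auto simp: d_def)
next
  assume "\<exists>c. (\<forall>v. 0 \<le> c v) \<and> {v. c v \<noteq> 0} \<subseteq> \<sigma> \<and> x = vec n (\<lambda>j. comb V lam c j)"
  then obtain c where c: "\<forall>v. 0 \<le> c v" "{v. c v \<noteq> 0} \<subseteq> \<sigma>" "x = vec n (\<lambda>j. comb V lam c j)"
    by blast
  have "comb V lam c j = comb \<sigma> lam c j" for j
    by (rule sum.mono_neutral_right) (use sub c in auto)
  then show "x \<in> gen_cone n (lam ` \<sigma>)" using c unfolding gen_cone_family[OF inj] by auto
qed

text \<open>If a point lies in the relative interiors of two cones of a fan, their intersection is a face of
  each cone that contains an interior point, hence is the whole cone. So the cones agree, and by
  \<open>ray_gens_gen_cone\<close> so do the faces of the complex.\<close>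

lemma fan_giving_unique_coordinates:
  assumes K: "abstract_complex K" and fan: "fan_giving K lam"
  shows "unique_coordinates K lam"
proof -
  define n where "n = cdim K"
  define \<Delta> where "\<Delta> = (\<lambda>\<sigma>. gen_cone n (lam ` \<sigma>)) ` K"
  let ?x = "\<lambda>c. vec n (\<lambda>j. comb (\<Union>K) lam c j)"
  have char: "char_map K lam" and isfan: "is_fan n \<Delta>" and compl: "complete_fan n \<Delta>"
    and injV: "inj_on lam (\<Union>K)"
    using fan by (auto simp: fan_giving_def Let_def n_def \<Delta>_def complex_iso_def)
  have finV: "finite (\<Union>K)" using K by (simp add: abstract_complex_def)
  have inj: "inj_on lam \<sigma>" if "\<sigma> \<in> K" for \<sigma>
    using injV that by (meson Union_upper inj_on_subset)
  have bas: "\<exists>B. int_basis n B \<and> lam ` \<sigma> \<subseteq> B" if "\<sigma> \<in> K" for \<sigma>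
    using char that by (auto simp: char_map_def n_def)
  have ex: "\<exists>c. cone_coordinates K c \<and> (\<forall>j<n. comb (\<Union>K) lam c j = x j)" for x
  proof -
    have "vec n x \<in> \<Union>\<Delta>" using compl by (simp add: complete_fan_def)
    then obtain \<sigma> where \<sigma>: "\<sigma> \<in> K" "vec n x \<in> gen_cone n (lam ` \<sigma>)" by (auto simp: \<Delta>_def)
    then obtain c where c: "\<forall>v. 0 \<le> c v" "{v. c v \<noteq> 0} \<subseteq> \<sigma>" "vec n x = ?x c"
      using gen_cone_iff[OF inj[OF \<sigma>(1)] Union_upper[OF \<sigma>(1)] finV, of "vec n x" n] by blast
    have "cone_coordinates K c"
      using c \<sigma>(1) K by (auto simp: cone_coordinates_def abstract_complex_def)
    moreover have "comb (\<Union>K) lam c j = x j" if "j < n" for j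
      using arg_cong[OF c(3), of "\<lambda>x. x $ j"] that by simp
    ultimately show ?thesis by blast
  qed
  have sub: "gen_cone n (lam ` {v. c v \<noteq> 0}) \<subseteq> gen_cone n (lam ` {v. d v \<noteq> 0})"
    if c: "cone_coordinates K c" and d: "cone_coordinates K d" and eq: "?x c = ?x d" for c d
  proof -
    let ?\<sigma> = "{v. c v \<noteq> 0}" and ?\<tau> = "{v. d v \<noteq> 0}"
    let ?C = "gen_cone n (lam ` ?\<sigma>)" and ?D = "gen_cone n (lam ` ?\<tau>)"
    have \<sigma>: "?\<sigma> \<in> K" and \<tau>: "?\<tau> \<in> K" using c d by (auto simp: cone_coordinates_def)
    have fin: "finite ?\<sigma>" using \<sigma> finV by (meson Union_upper finite_subset)
    have face: "cone_face n (?C \<inter> ?D) ?C"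
      using isfan \<sigma> \<tau> by (auto simp: is_fan_def \<Delta>_def)
    have "?x c \<in> ?C"
      using gen_cone_iff[OF inj[OF \<sigma>] Union_upper[OF \<sigma>] finV] c by (auto simp: cone_coordinates_def)
    moreover have "?x d \<in> ?D"
      using gen_cone_iff[OF inj[OF \<tau>] Union_upper[OF \<tau>] finV] d by (auto simp: cone_coordinates_def)
    ultimately have x: "?x c \<in> ?C \<inter> ?D" using eq by auto
    let ?y = "\<lambda>c. vec n (\<lambda>j. comb ?\<sigma> lam c j)"
    obtain h where h: "\<And>v. v \<in> ?\<sigma> \<Longrightarrow> 0 \<le> h v"
      "?C \<inter> ?D = {?y c' |c'. (\<forall>v\<in>?\<sigma>. 0 \<le> c' v) \<and> (\<Sum>v\<in>?\<sigma>. c' v * h v) = 0}"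
      using cone_face_weights[OF fin inj[OF \<sigma>] face] by blast
    obtain c' where c': "?x c = ?y c'" "\<forall>v\<in>?\<sigma>. 0 \<le> c' v" "(\<Sum>v\<in>?\<sigma>. c' v * h v) = 0"
      using x unfolding h(2) by blast
    have xy: "?x c = ?y c"
      by (intro eq_vecI) (use finV \<sigma> in \<open>auto intro!: sum.mono_neutral_right\<close>)
    obtain B where B: "int_basis n B" "lam ` ?\<sigma> \<subseteq> B" using bas[OF \<sigma>] by blast
    have "c v = c' v" if "v \<in> ?\<sigma>" for v
    proof (rule part_of_basis_coefficients[OF B inj[OF \<sigma>] _ that])
      show "comb ?\<sigma> lam c j = comb ?\<sigma> lam c' j" if "j < n" for j
        using arg_cong[OF trans[OF xy[symmetric] c'(1)], of "\<lambda>x. x $ j"] that by simp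
    qed
    then have pos: "0 < c' v" if "v \<in> ?\<sigma>" for v
      using that c by (auto simp: cone_coordinates_def less_le)
    have "\<forall>v\<in>?\<sigma>. c' v * h v = 0"
      using c' h(1) fin by (subst (asm) sum_nonneg_eq_0_iff) auto
    then have "\<forall>v\<in>?\<sigma>. h v = 0" using pos by force
    then have "?C \<inter> ?D = {?y c' |c'. (\<forall>v\<in>?\<sigma>. 0 \<le> c' v)}"
      unfolding h(2) by (auto intro!: sum.neutral)
    then show "?C \<subseteq> ?D" unfolding gen_cone_family[OF inj[OF \<sigma>]] by blast
  qed
  have uniq: "c = d"
    if c: "cone_coordinates K c" and d: "cone_coordinates K d"
      and rel: "(\<lambda>v. c v - d v) \<in> relations n (\<Union>K) lam" for c d
  proof -
    let ?\<sigma> = "{v. c v \<noteq> 0}" and ?\<tau> = "{v. d v \<noteq> 0}"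
    have \<sigma>: "?\<sigma> \<in> K" and \<tau>: "?\<tau> \<in> K" using c d by (auto simp: cone_coordinates_def)
    have sums: "comb (\<Union>K) lam c j = comb (\<Union>K) lam d j"
      if "j < n" for j
      using relationsD[OF rel that] by (simp add: left_diff_distrib sum_subtractf)
    then have eq: "?x c = ?x d" by (intro eq_vecI) auto
    have "gen_cone n (lam ` ?\<sigma>) = gen_cone n (lam ` ?\<tau>)"
      using sub[OF c d eq] sub[OF d c eq[symmetric]] by blast
    then have "lam ` ?\<sigma> = lam ` ?\<tau>"
      using ray_gens_gen_cone bas[OF \<sigma>] bas[OF \<tau>] by metis
    then have st: "?\<sigma> = ?\<tau>"
      using inj_on_image_eq_iff[OF injV Union_upper[OF \<sigma>] Union_upper[OF \<tau>]] by blast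
    obtain B where B: "int_basis n B" "lam ` ?\<sigma> \<subseteq> B" using bas[OF \<sigma>] by blast
    have "c v = d v" if "v \<in> ?\<sigma>" for v
    proof (rule part_of_basis_coefficients[OF B inj[OF \<sigma>] _ that])
      fix j assume j: "j < n"
      have "comb ?\<sigma> lam c j = comb (\<Union>K) lam c j"
        by (rule sum.mono_neutral_left) (use finV \<sigma> in auto)
      moreover have "comb ?\<sigma> lam d j = comb (\<Union>K) lam d j"
        unfolding st by (rule sum.mono_neutral_left) (use finV \<tau> in auto)
      ultimately show "comb ?\<sigma> lam c j = comb ?\<sigma> lam d j"
        using sums[OF j] by simp
    qed
    moreover have "c v = d v" if "v \<notin> ?\<sigma>" for v
    proof -
      have "v \<notin> ?\<tau>" using that st by simp
      then show ?thesis using that by simp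
    qed
    ultimately show ?thesis by blast
  qed
  show ?thesis
    unfolding unique_coordinates_def using ex uniq by (auto simp: n_def)
qed

lemma unimodular_complex_char_map:
  assumes "unimodular_complex K lam"
  shows "char_map K lam"
  unfolding char_map_def
proof (intro conjI ballI)
  fix \<sigma> assume "\<sigma> \<in> K"
  then obtain \<tau> where \<tau>: "\<sigma> \<subseteq> \<tau>" "unimodular (cdim K) lam \<tau>"
    using assms by (auto simp: unimodular_complex_def)
  then show "inj_on lam \<sigma>" by (auto simp: unimodular_def intro: inj_on_subset)
  show "\<exists>B. int_basis (cdim K) B \<and> lam ` \<sigma> \<subseteq> B"
    using \<tau> by (intro exI[of _ "lam ` \<tau>"]) (auto simp: unimodular_def)
qed (use assms in \<open>auto simp: unimodular_complex_def\<close>)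

text \<open>Conversely, uniqueness of coordinates gives \<open>cone \<sigma> \<inter> cone \<tau> = cone (\<sigma> \<inter> \<tau>)\<close>, and unimodularity makes
  this cone a face of both.\<close>

lemma fan_givingI:
  assumes un: "unimodular_complex K lam" and coords: "unique_coordinates K lam"
  shows "fan_giving K lam"
proof -
  define n where "n = cdim K"
  define \<Delta> where "\<Delta> = (\<lambda>\<sigma>. gen_cone n (lam ` \<sigma>)) ` K"
  let ?x = "\<lambda>c. vec n (\<lambda>j. comb (\<Union>K) lam c j)"
  have char: "char_map K lam" by (rule unimodular_complex_char_map[OF un])
  have K: "abstract_complex K" and car: "\<And>v. v \<in> \<Union>K \<Longrightarrow> lam v \<in> carrier_vec n"
    using un by (auto simp: unimodular_complex_def n_def)
  have finV: "finite (\<Union>K)" using K by (simp add: abstract_complex_def)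
  have down: "\<rho> \<in> K" if "\<sigma> \<in> K" "\<rho> \<subseteq> \<sigma>" for \<rho> \<sigma> using K that by (auto simp: abstract_complex_def)
  have ex: "\<exists>c. cone_coordinates K c \<and> ?x c = vec n x" for x
  proof -
    obtain c where "cone_coordinates K c" "\<forall>j<n. comb (\<Union>K) lam c j = x j"
      using coords unfolding unique_coordinates_def n_def by blast
    then show ?thesis by (intro exI[of _ c]) auto
  qed
  have uniq: "c = d" if c: "cone_coordinates K c" "cone_coordinates K d" "?x c = ?x d" for c d
  proof -
    have "comb (\<Union>K) lam c j = comb (\<Union>K) lam d j" if "j < n" for j
      using arg_cong[OF c(3), of "\<lambda>x. x $ j"] that by simp
    then have "(\<lambda>v. c v - d v) \<in> relations n (\<Union>K) lam"
      by (simp add: relations_def left_diff_distrib sum_subtractf)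
    then show ?thesis using coords c unfolding unique_coordinates_def n_def by blast
  qed
  have injV: "inj_on lam (\<Union>K)"
  proof (rule inj_onI)
    fix u v assume uv: "u \<in> \<Union>K" "v \<in> \<Union>K" "lam u = lam v"
    let ?e = "\<lambda>u w. if w = u then 1 else 0 :: real"
    have "{w. ?e u w \<noteq> 0} = {u}" "{w. ?e v w \<noteq> 0} = {v}" by auto
    moreover have "{u} \<in> K" "{v} \<in> K" using uv down by auto
    ultimately have "cone_coordinates K (?e u)" "cone_coordinates K (?e v)"
      by (simp_all add: cone_coordinates_def)
    moreover have "?x (?e u) = ?x (?e v)"
      using uv finV by (intro eq_vecI) (simp_all add: if_distrib[of "\<lambda>x. x * _"] cong: if_cong)
    ultimately have "?e u = ?e v" by (rule uniq)
    then show "u = v" by (metis zero_neq_one)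
  qed
  have inj: "inj_on lam \<sigma>" if "\<sigma> \<in> K" for \<sigma>
    using injV that by (meson Union_upper inj_on_subset)
  have bas: "\<exists>B. int_basis n B \<and> lam ` \<sigma> \<subseteq> B" if "\<sigma> \<in> K" for \<sigma>
    using char that by (auto simp: char_map_def n_def)
  have fin: "finite \<sigma>" if "\<sigma> \<in> K" for \<sigma>
    using finV that by (meson Union_upper finite_subset)
  have cone: "x \<in> gen_cone n (lam ` \<sigma>) \<longleftrightarrow> (\<exists>c. cone_coordinates K c \<and> {v. c v \<noteq> 0} \<subseteq> \<sigma> \<and> x = ?x c)"
    if "\<sigma> \<in> K" for x \<sigma>
    using gen_cone_iff[OF inj[OF that] Union_upper[OF that] finV, of x n] that down
    unfolding cone_coordinates_def by blast
  have inter: "gen_cone n (lam ` \<sigma>) \<inter> gen_cone n (lam ` \<tau>) = gen_cone n (lam ` (\<sigma> \<inter> \<tau>))"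
    if st: "\<sigma> \<in> K" "\<tau> \<in> K" for \<sigma> \<tau>
  proof -
    have st': "\<sigma> \<inter> \<tau> \<in> K" using st down by blast
    show ?thesis
    proof (intro equalityI subsetI)
      fix x assume "x \<in> gen_cone n (lam ` \<sigma>) \<inter> gen_cone n (lam ` \<tau>)"
      then obtain c d where c: "cone_coordinates K c" "{v. c v \<noteq> 0} \<subseteq> \<sigma>" "x = ?x c"
        and d: "cone_coordinates K d" "{v. d v \<noteq> 0} \<subseteq> \<tau>" "x = ?x d"
        using cone[OF st(1), of x] cone[OF st(2), of x] by blast
      have "c = d" by (rule uniq) (use c d in auto)
      then show "x \<in> gen_cone n (lam ` (\<sigma> \<inter> \<tau>))"
        using c d cone[OF st', of x] by blast
    next
      fix x assume "x \<in> gen_cone n (lam ` (\<sigma> \<inter> \<tau>))"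
      then show "x \<in> gen_cone n (lam ` \<sigma>) \<inter> gen_cone n (lam ` \<tau>)"
        using cone[OF st', of x] cone[OF st(1), of x] cone[OF st(2), of x] by blast
    qed
  qed
  have "is_fan n \<Delta>"
    unfolding is_fan_def
  proof (intro conjI ballI allI impI)
    have "finite K" using finV finite_UnionD by blast
    then show "finite \<Delta>" by (simp add: \<Delta>_def)
    show "\<Delta> \<noteq> {}" using K by (auto simp: \<Delta>_def abstract_complex_def)
  next
    fix C assume "C \<in> \<Delta>"
    then obtain \<sigma> where \<sigma>: "\<sigma> \<in> K" "C = gen_cone n (lam ` \<sigma>)" by (auto simp: \<Delta>_def)
    show "rational_cone n C"
      unfolding rational_cone_def using \<sigma> fin car by (intro exI[of _ "lam ` \<sigma>"]) auto
    show "strongly_convex n C"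
      unfolding strongly_convex_def
    proof (intro ballI impI)
      fix x assume x: "x \<in> C" "- x \<in> C"
      let ?y = "\<lambda>c. vec n (\<lambda>j. comb \<sigma> lam c j)"
      obtain c d where c: "x = ?y c" "\<forall>v\<in>\<sigma>. 0 \<le> c v" and d: "- x = ?y d" "\<forall>v\<in>\<sigma>. 0 \<le> d v"
        using x unfolding \<sigma>(2) gen_cone_family[OF inj[OF \<sigma>(1)]] by blast
      obtain B where B: "int_basis n B" "lam ` \<sigma> \<subseteq> B" using bas[OF \<sigma>(1)] by blast
      have "c v = - d v" if "v \<in> \<sigma>" for v
      proof (rule part_of_basis_coefficients[OF B inj[OF \<sigma>(1)] _ that])
        fix j assume j: "j < n"
        have "comb \<sigma> lam c j = x $ j" using c(1) j by simp
        also have "x $ j = - ((- x) $ j)" using c(1) j by simp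
        also have "\<dots> = (\<Sum>v\<in>\<sigma>. - d v * real_of_int (lam v $ j))" unfolding d(1) using j by (simp add: sum_negf)
        finally show "comb \<sigma> lam c j = (\<Sum>v\<in>\<sigma>. - d v * real_of_int (lam v $ j))" .
      qed
      then have "\<forall>v\<in>\<sigma>. c v = 0" using c(2) d(2) by force
      then show "x = 0\<^sub>v n" unfolding c(1) by (intro eq_vecI) auto
    qed
    fix F assume "cone_face n F C"
    then obtain \<sigma>' where "\<sigma>' \<subseteq> \<sigma>" "F = gen_cone n (lam ` \<sigma>')"
      using cone_face_subset[OF fin[OF \<sigma>(1)] inj[OF \<sigma>(1)]] \<sigma>(2) by metis
    then show "F \<in> \<Delta>" using down \<sigma>(1) by (auto simp: \<Delta>_def)
  next
    fix C D assume "C \<in> \<Delta>" "D \<in> \<Delta>"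
    then obtain \<sigma> \<tau> where \<sigma>: "\<sigma> \<in> K" "C = gen_cone n (lam ` \<sigma>)" and \<tau>: "\<tau> \<in> K" "D = gen_cone n (lam ` \<tau>)"
      by (auto simp: \<Delta>_def)
    obtain B where "int_basis n B" "lam ` \<sigma> \<subseteq> B" using bas[OF \<sigma>(1)] by blast
    then show "cone_face n (C \<inter> D) C"
      unfolding \<sigma>(2) \<tau>(2) inter[OF \<sigma>(1) \<tau>(1)]
      by (rule cone_face_of_part[OF _ _ inj[OF \<sigma>(1)] Int_lower1])
    obtain B where "int_basis n B" "lam ` \<tau> \<subseteq> B" using bas[OF \<tau>(1)] by blast
    then show "cone_face n (C \<inter> D) D"
      unfolding \<sigma>(2) \<tau>(2) inter[OF \<sigma>(1) \<tau>(1)]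
      by (rule cone_face_of_part[OF _ _ inj[OF \<tau>(1)] Int_lower2])
  qed
  moreover have "complete_fan n \<Delta>"
    unfolding complete_fan_def
  proof (intro equalityI subsetI)
    fix x assume "x \<in> \<Union>\<Delta>"
    then show "x \<in> carrier_vec n" by (auto simp: \<Delta>_def gen_cone_def)
  next
    fix x :: "real vec" assume "x \<in> carrier_vec n"
    then have "x = vec n (($) x)" by auto
    then obtain c where "cone_coordinates K c" "?x c = x" using ex by metis
    then show "x \<in> \<Union>\<Delta>" unfolding \<Delta>_def
      by (auto simp: cone cone_coordinates_def intro!: bexI[of _ "{v. c v \<noteq> 0}"])
  qed
  moreover have "nonsingular_fan n \<Delta>"
    unfolding nonsingular_fan_def \<Delta>_def using bas by blast
  moreover have "complex_iso lam K (fan_complex n \<Delta>)"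
    unfolding complex_iso_def fan_complex_def \<Delta>_def image_image
  proof (intro conjI injV image_cong)
    show "lam ` \<sigma> = ray_gens n (gen_cone n (lam ` \<sigma>))" if "\<sigma> \<in> K" for \<sigma>
      using ray_gens_gen_cone bas[OF that] by metis
  qed simp_all
  ultimately show ?thesis
    using char by (simp add: fan_giving_def Let_def n_def \<Delta>_def)
qed

section \<open>Pullbacks of complexes and wedges\<close>

abbreviation full_fibres :: "'a set \<Rightarrow> ('a \<Rightarrow> 'b) \<Rightarrow> 'b set set \<Rightarrow> 'a set \<Rightarrow> 'b set" where
  "full_fibres V q B \<sigma> \<equiv> {w \<in> \<Union>B. \<forall>v\<in>V. q v = w \<longrightarrow> v \<in> \<sigma>}"

text \<open>The vertices of \<open>B\<close> are replaced by the fibres of \<open>q\<close>, and a minimal non-face by the union of its fibres.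
  For a surjective \<open>q\<close> this is an iterated wedge of \<open>B\<close> carried out in one step, with the order of the wedges forgotten.\<close>

definition pullback :: "'a set \<Rightarrow> ('a \<Rightarrow> 'b) \<Rightarrow> 'b set set \<Rightarrow> 'a set set" where
  "pullback V q B = {\<sigma>. \<sigma> \<subseteq> V \<and> full_fibres V q B \<sigma> \<in> B}"

definition pull_relations :: "'a set \<Rightarrow> ('a \<Rightarrow> 'b) \<Rightarrow> ('b \<Rightarrow> real) set \<Rightarrow> ('a \<Rightarrow> real) set" where
  "pull_relations V q R = {c. \<exists>y\<in>R. \<forall>v\<in>V. c v = y (q v)}"

lemma unique_coordinates_ex:
  "unique_coordinates K lam \<Longrightarrow>
    \<exists>c. cone_coordinates K c \<and> (\<forall>j<cdim K. comb (\<Union>K) lam c j = x j)"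
  by (simp add: unique_coordinates_def)

lemma unique_coordinates_unique:
  "unique_coordinates K lam \<Longrightarrow> cone_coordinates K c \<Longrightarrow> cone_coordinates K d \<Longrightarrow>
    (\<lambda>v. c v - d v) \<in> relations (cdim K) (\<Union>K) lam \<Longrightarrow> c = d"
  by (simp add: unique_coordinates_def)

lemma pull_relationsI: "y \<in> R \<Longrightarrow> (\<lambda>v. y (q v)) \<in> pull_relations V q R"
  by (auto simp: pull_relations_def)

lemma abstract_complexD:
  assumes "abstract_complex K"
  shows "finite (\<Union>K)" "{} \<in> K" "\<sigma> \<in> K \<Longrightarrow> \<tau> \<subseteq> \<sigma> \<Longrightarrow> \<tau> \<in> K"
  using assms by (auto simp: abstract_complex_def)

lemma abstract_complex_vertex: "abstract_complex K \<Longrightarrow> v \<in> \<Union>K \<Longrightarrow> {v} \<in> K"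
  by (auto simp: abstract_complex_def)

lemma pullback_abstract:
  assumes B: "abstract_complex B" and fin: "finite V" and surj: "q ` V = \<Union>B"
  shows "abstract_complex (pullback V q B)" "\<Union>(pullback V q B) = V"
proof -
  show V: "\<Union>(pullback V q B) = V"
  proof (intro equalityI subsetI)
    fix v assume v: "v \<in> V"
    then have "{q v} \<in> B" using surj by (intro abstract_complex_vertex[OF B]) auto
    moreover have "{w \<in> \<Union>B. \<forall>u\<in>V. q u = w \<longrightarrow> u \<in> {v}} \<subseteq> {q v}"
      unfolding surj[symmetric] by auto
    ultimately have "{v} \<in> pullback V q B"
      using v abstract_complexD(3)[OF B] by (auto simp: pullback_def)
    then show "v \<in> \<Union>(pullback V q B)" by blast
  qed (auto simp: pullback_def)
  have e: "full_fibres V q B {} = {}"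
    unfolding surj[symmetric] by auto
  have "{} \<in> pullback V q B"
    unfolding pullback_def mem_Collect_eq e using abstract_complexD(2)[OF B] by blast
  moreover have "\<tau> \<in> pullback V q B" if "\<sigma> \<in> pullback V q B" "\<tau> \<subseteq> \<sigma>" for \<sigma> \<tau>
  proof -
    have "full_fibres V q B \<tau> \<subseteq> full_fibres V q B \<sigma>"
      using that by auto
    then have "full_fibres V q B \<tau> \<in> B"
      by (rule abstract_complexD(3)[OF B, rotated]) (use that in \<open>simp add: pullback_def\<close>)
    then show ?thesis using that by (auto simp: pullback_def)
  qed
  ultimately show "abstract_complex (pullback V q B)"
    unfolding abstract_complex_def V using fin by blast
qed

lemma pullback_id: "pullback (\<Union>B) (\<lambda>w. w) B = B"
proof -
  have "{w \<in> \<Union>B. \<forall>v\<in>\<Union>B. v = w \<longrightarrow> v \<in> \<sigma>} = \<sigma>" if "\<sigma> \<subseteq> \<Union>B" for \<sigma>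
    using that by auto
  then show ?thesis unfolding pullback_def by (auto cong: conj_cong)
qed

lemma pullback_comp:
  assumes B: "abstract_complex B" and fin: "finite V2" and surj: "q2 ` V2 = \<Union>B" "q1 ` V = V2"
  shows "pullback V q1 (pullback V2 q2 B) = pullback V (\<lambda>v. q2 (q1 v)) B"
proof -
  have "full_fibres V2 q2 B {u \<in> V2. \<forall>v\<in>V. q1 v = u \<longrightarrow> v \<in> \<sigma>}
      = {w \<in> \<Union>B. \<forall>v\<in>V. q2 (q1 v) = w \<longrightarrow> v \<in> \<sigma>}" for \<sigma>
    using surj by auto
  then show ?thesis
    unfolding pullback_def[of V q1] pullback_abstract(2)[OF B fin surj(1)]
    unfolding pullback_def by auto
qed

lemma pullback_iso:
  assumes f: "bij_betw f V V2" and B: "abstract_complex B" "finite V" "q ` V = \<Union>B"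
    and q: "\<And>v. v \<in> V \<Longrightarrow> q2 (f v) = q v"
  shows "complex_iso f (pullback V q B) (pullback V2 q2 B)"
proof -
  have inj: "inj_on f V" and im: "f ` V = V2" using f by (auto simp: bij_betw_def)
  have full: "full_fibres V2 q2 B (f ` \<sigma>) = full_fibres V q B \<sigma>"
    if "\<sigma> \<subseteq> V" for \<sigma>
  proof -
    have "f v \<in> f ` \<sigma> \<longleftrightarrow> v \<in> \<sigma>" if "v \<in> V" for v
      using inj_on_image_mem_iff[OF inj] that \<open>\<sigma> \<subseteq> V\<close> by blast
    then show ?thesis using q unfolding im[symmetric] by auto
  qed
  have "(\<lambda>\<sigma>. f ` \<sigma>) ` pullback V q B = pullback V2 q2 B"
  proof (intro equalityI subsetI)
    fix \<rho> assume "\<rho> \<in> (\<lambda>\<sigma>. f ` \<sigma>) ` pullback V q B"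
    then obtain \<sigma> where "\<sigma> \<in> pullback V q B" "\<rho> = f ` \<sigma>" by blast
    then show "\<rho> \<in> pullback V2 q2 B" using full[of \<sigma>] im by (auto simp: pullback_def)
  next
    fix \<rho> assume \<rho>: "\<rho> \<in> pullback V2 q2 B"
    then have "\<rho> \<subseteq> f ` V" using im by (auto simp: pullback_def)
    then obtain \<sigma> where \<sigma>: "\<sigma> \<subseteq> V" "\<rho> = f ` \<sigma>" by (metis subset_imageE)
    then have "\<sigma> \<in> pullback V q B" using \<rho> full[OF \<sigma>(1)] by (auto simp: pullback_def)
    then show "\<rho> \<in> (\<lambda>\<sigma>. f ` \<sigma>) ` pullback V q B" using \<sigma>(2) by blast
  qed
  then show ?thesis
    using inj pullback_abstract(2)[OF B] by (simp add: complex_iso_def)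
qed

text \<open>A face \<open>\<rho>\<close> of the wedge comes from the link if it contains both new vertices, and from the complex
  without \<open>v\<close> otherwise. In terms of the map that contracts \<open>a\<close> and \<open>b\<close> to \<open>v\<close> this says that the full
  fibres of \<open>\<rho>\<close> form a face.\<close>

lemma wed_pullback:
  assumes K: "abstract_complex K" and v: "v \<in> \<Union>K" and ab: "a \<notin> \<Union>K" "b \<notin> \<Union>K" "a \<noteq> b"
  shows "wed K v a b = pullback (\<Union>K - {v} \<union> {a, b}) (\<lambda>u. if u = a \<or> u = b then v else u) K"
    (is "_ = pullback ?V ?q K")
proof -
  have full: "{w \<in> \<Union>K. \<forall>u\<in>?V. ?q u = w \<longrightarrow> u \<in> \<rho>} = \<rho> - {a, b} \<union> (if a \<in> \<rho> \<and> b \<in> \<rho> then {v} else {})"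
    if "\<rho> \<subseteq> ?V" for \<rho>
    using that v ab by auto
  have lk: "\<tau> \<in> lk K v \<longleftrightarrow> v \<notin> \<tau> \<and> insert v \<tau> \<in> K" for \<tau>
    by (auto simp: lk_def insert_absorb)
  have del: "\<tau> \<in> del K v \<longleftrightarrow> v \<notin> \<tau> \<and> \<tau> \<in> K" for \<tau>
    by (auto simp: del_def)
  have down: "\<tau> \<in> K" if "insert v \<tau> \<in> K" for \<tau>
    using abstract_complexD(3)[OF K that] by blast
  show ?thesis
  proof (intro equalityI subsetI)
    fix \<rho> assume "\<rho> \<in> wed K v a b"
    then consider \<sigma> \<tau> where "\<rho> = \<sigma> \<union> \<tau>" "\<sigma> \<subseteq> {a, b}" "v \<notin> \<tau>" "insert v \<tau> \<in> K"
      | \<sigma> \<tau> where "\<rho> = \<sigma> \<union> \<tau>" "\<sigma> \<in> {{}, {a}, {b}}" "v \<notin> \<tau>" "\<tau> \<in> K"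
      unfolding wed_def join_def Un_iff mem_Collect_eq lk del by blast
    then show "\<rho> \<in> pullback ?V ?q K"
    proof cases
      case 1
      have ab': "a \<notin> \<tau>" "b \<notin> \<tau>" using 1 ab by auto
      then have eq: "\<rho> - {a, b} = \<tau>" using 1 by auto
      have sub: "\<rho> \<subseteq> ?V" using 1 by auto
      have "\<rho> - {a, b} \<union> (if a \<in> \<rho> \<and> b \<in> \<rho> then {v} else {}) \<in> K"
        unfolding eq using 1(4) down[OF 1(4)] by simp
      then show ?thesis
        unfolding pullback_def mem_Collect_eq full[OF sub] using sub by blast
    next
      case 2
      have ab': "a \<notin> \<tau>" "b \<notin> \<tau>" using 2 ab by auto
      then have eq: "\<rho> - {a, b} = \<tau>" "\<not> (a \<in> \<rho> \<and> b \<in> \<rho>)" using 2 ab(3) by auto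
      have sub: "\<rho> \<subseteq> ?V" using 2 by auto
      have "\<rho> - {a, b} \<union> (if a \<in> \<rho> \<and> b \<in> \<rho> then {v} else {}) \<in> K"
        unfolding eq(1) using eq(2) 2(4) by auto
      then show ?thesis
        unfolding pullback_def mem_Collect_eq full[OF sub] using sub by blast
    qed
  next
    fix \<rho> assume "\<rho> \<in> pullback ?V ?q K"
    then have sub: "\<rho> \<subseteq> ?V" and fu: "\<rho> - {a, b} \<union> (if a \<in> \<rho> \<and> b \<in> \<rho> then {v} else {}) \<in> K"
      using full[of \<rho>] unfolding pullback_def by simp_all
    have dec: "\<rho> = (\<rho> \<inter> {a, b}) \<union> (\<rho> - {a, b})" by blast
    have v': "v \<notin> \<rho> - {a, b}" using sub v ab by auto
    show "\<rho> \<in> wed K v a b"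
    proof (cases "a \<in> \<rho> \<and> b \<in> \<rho>")
      case True
      then have "insert v (\<rho> - {a, b}) \<in> K" using fu by simp
      moreover have "\<rho> \<inter> {a, b} \<in> {{}, {a}, {b}, {a, b}}" using True by auto
      ultimately show ?thesis using dec v' unfolding wed_def join_def Un_iff mem_Collect_eq lk by blast
    next
      case False
      then have "\<rho> - {a, b} \<in> K" using fu by auto
      moreover have "\<rho> \<inter> {a, b} \<in> {{}, {a}, {b}}" using False by auto
      ultimately show ?thesis using dec v' unfolding wed_def join_def Un_iff mem_Collect_eq del by blast
    qed
  qed
qed

lemma wedge_seq_pullback:
  assumes "wedge_seq B L" and B: "abstract_complex B"
  shows "abstract_complex L \<and> (\<exists>q. q ` \<Union>L = \<Union>B \<and> L = pullback (\<Union>L) q B)"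
  using assms(1)
proof induction
  case refl
  then show ?case using B pullback_id[of B] by (intro conjI exI[of _ "\<lambda>w. w"]) auto
next
  case (step L v a b)
  then obtain q where L: "abstract_complex L" and q: "q ` \<Union>L = \<Union>B" "L = pullback (\<Union>L) q B" by blast
  define V where "V = \<Union>L - {v} \<union> {a, b}"
  define k where "k = (\<lambda>u. if u = a \<or> u = b then v else u)"
  have W: "wed L v a b = pullback V k L"
    unfolding V_def k_def by (rule wed_pullback) (use L step in auto)
  have fin: "finite V" "finite (\<Union>L)" using abstract_complexD(1)[OF L] by (auto simp: V_def)
  have surj: "k ` V = \<Union>L" using step.hyps by (auto simp: V_def k_def image_iff)
  have "pullback V k L = pullback V (\<lambda>u. q (k u)) B"
    using pullback_comp[OF B fin(2) q(1) surj] q(2) by simp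
  moreover have "(\<lambda>u. q (k u)) ` V = \<Union>B" using surj q(1) by (metis image_image)
  ultimately show ?case
    unfolding W using pullback_abstract[OF L fin(1) surj] by metis
qed

lemma cdim_eqI:
  assumes K: "abstract_complex K" and pure: "\<And>\<sigma>. \<sigma> \<in> K \<Longrightarrow> \<exists>\<tau>\<in>K. \<sigma> \<subseteq> \<tau> \<and> card \<tau> = n"
  shows "cdim K = n"
  unfolding cdim_def
proof (rule Max_eqI)
  have finV: "finite (\<Union>K)" by (rule abstract_complexD[OF K])
  then show "finite (card ` K)" using finite_UnionD by blast
  show "m \<le> n" if m: "m \<in> card ` K" for m
  proof -
    obtain \<sigma> where "\<sigma> \<in> K" "m = card \<sigma>" using m by blast
    moreover then obtain \<tau> where "\<tau> \<in> K" "\<sigma> \<subseteq> \<tau>" "card \<tau> = n" using pure by blast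
    moreover have "finite \<tau>" using \<open>\<tau> \<in> K\<close> finV by (meson Union_upper finite_subset)
    ultimately show ?thesis using card_mono by metis
  qed
  show "n \<in> card ` K" using pure[OF abstract_complexD(2)[OF K]] by auto
qed

lemma unimodular_surj:
  assumes un: "unimodular n lam \<tau>" and sub: "\<tau> \<subseteq> V" "finite V"
  obtains d :: "'a \<Rightarrow> real" where "\<And>j. j < n \<Longrightarrow> comb V lam d j = x j"
proof -
  obtain g where "dual_coordinates n lam \<tau> g"
    by (rule unimodular_dual[OF un])
  note g = dual_coordinatesD[OF this]
  define d where "d v = (if v \<in> \<tau> then \<Sum>j<n. real_of_int (g v j) * x j else 0)" for v
  have "comb V lam d i = x i" if i: "i < n" for i
  proof -
    have "comb V lam d i
        = (\<Sum>v\<in>\<tau>. \<Sum>j<n. x j * real_of_int (lam v $ i * g v j))"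
      by (rule sum.mono_neutral_cong_right)
        (use sub in \<open>auto simp: d_def sum_distrib_left sum_distrib_right mult_ac\<close>)
    also have "\<dots> = (\<Sum>j<n. x j * real_of_int (\<Sum>v\<in>\<tau>. lam v $ i * g v j))"
      by (subst sum.swap) (simp add: sum_distrib_left)
    also have "\<dots> = (\<Sum>j<n. if i = j then x j else 0)"
      by (rule sum.cong) (auto simp: g(1)[OF i])
    finally show ?thesis using i by simp
  qed
  then show thesis by (rule that)
qed

lemma sum_zero_indicator:
  assumes "N \<subseteq> V" "finite V"
  shows "(\<lambda>v. of_bool (v \<in> N)) \<in> relations n V lam \<longleftrightarrow> vec n (\<lambda>j. \<Sum>v\<in>N. lam v $ j) = 0\<^sub>v n"
proof -
  have "(\<Sum>v\<in>V. of_bool (v \<in> N) * real_of_int (lam v $ j)) = real_of_int (\<Sum>v\<in>N. lam v $ j)" for j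
    using assms by (simp add: sum.mono_neutral_cong_right[of V N _ "\<lambda>v. real_of_int (lam v $ j)"] Int_absorb1)
  then show ?thesis
    by (auto simp: relations_def vec_eq_iff simp del: of_int_sum)
qed

section \<open>Fans over a pullback\<close>

text \<open>The map \<open>lam\<close> over the pullback has the pulled back relations. The set \<open>\<tau>\<^sub>0\<close> makes its values span the
  whole lattice; relations alone do not see a passage to a larger lattice.\<close>

locale pulled_back =
  fixes B :: "'b set set" and mu0 :: "'b \<Rightarrow> int vec" and V :: "'a set" and q :: "'a \<Rightarrow> 'b"
    and n :: nat and lam :: "'a \<Rightarrow> int vec" and \<tau>\<^sub>0 :: "'a set"
  assumes regB: "unimodular_complex B mu0" and finV: "finite V" and surj: "q ` V = \<Union>B"
    and n: "n = cdim B + (card V - card (\<Union>B))"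
    and un0: "unimodular n lam \<tau>\<^sub>0" "\<tau>\<^sub>0 \<subseteq> V" and car: "\<And>v. v \<in> V \<Longrightarrow> lam v \<in> carrier_vec n"
    and rel: "relations n V lam = pull_relations V q (relations (cdim B) (\<Union>B) mu0)"
begin

lemma absB: "abstract_complex B" using regB by (simp add: unimodular_complex_def)

lemmas finB = abstract_complexD(1)[OF absB]
lemmas absK = pullback_abstract(1)[OF absB finV surj]
lemmas vertK = pullback_abstract(2)[OF absB finV surj]

text \<open>A face \<open>\<sigma>\<close> has full fibres over a face \<open>S\<close> of \<open>B\<close>. Extend \<open>S\<close> to a facet \<open>T\<close>, and leave out one point outside
  \<open>\<sigma>\<close> of each fibre that does not lie over \<open>T\<close>.\<close>

lemma extend_face:
  assumes \<sigma>: "\<sigma> \<in> pullback V q B"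
  shows "\<exists>\<tau>\<in>pullback V q B. \<sigma> \<subseteq> \<tau> \<and> unimodular n lam \<tau>"
proof -
  define S where "S = full_fibres V q B \<sigma>"
  have "S \<in> B" and sV: "\<sigma> \<subseteq> V" using \<sigma> by (auto simp: S_def pullback_def)
  then obtain T where T: "T \<in> B" "S \<subseteq> T" and unT: "unimodular (cdim B) mu0 T"
    using regB by (auto simp: unimodular_complex_def)
  have TB: "T \<subseteq> \<Union>B" using T by auto
  have "\<forall>w\<in>\<Union>B - T. \<exists>v\<in>V. q v = w \<and> v \<notin> \<sigma>" using T(2) by (auto simp: S_def)
  then obtain h where h: "\<And>w. w \<in> \<Union>B - T \<Longrightarrow> h w \<in> V \<and> q (h w) = w \<and> h w \<notin> \<sigma>" by metis
  define \<tau> where "\<tau> = V - h ` (\<Union>B - T)"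
  have out: "v \<in> V - \<tau> \<longleftrightarrow> (\<exists>w\<in>\<Union>B - T. v = h w)" for v
    using h by (auto simp: \<tau>_def)
  have "full_fibres V q B \<tau> = T"
  proof (intro equalityI subsetI)
    fix w assume w: "w \<in> full_fibres V q B \<tau>"
    show "w \<in> T"
    proof (rule ccontr)
      assume "w \<notin> T"
      then have "w \<in> \<Union>B - T" using w by simp
      from h[OF this] have "h w \<in> \<tau>" using w by blast
      then show False using \<open>w \<in> \<Union>B - T\<close> by (simp add: \<tau>_def)
    qed
  next
    fix w assume w: "w \<in> T"
    have "v \<in> \<tau>" if "v \<in> V" "q v = w" for v
    proof -
      have "v \<noteq> h w'" if "w' \<in> \<Union>B - T" for w'
        using h[OF that] w \<open>q v = w\<close> that by auto
      then show ?thesis using that by (auto simp: \<tau>_def)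
    qed
    then show "w \<in> full_fibres V q B \<tau>" using TB w by auto
  qed
  then have \<tau>: "\<tau> \<in> pullback V q B" using T by (auto simp: pullback_def \<tau>_def)
  have "\<sigma> \<subseteq> \<tau>" using sV h by (auto simp: \<tau>_def)
  moreover have "unimodular n lam \<tau>"
  proof (rule unimodular_exchange[OF un0 _ finV car])
    show "\<tau> \<subseteq> V" by (auto simp: \<tau>_def)
  next
    fix u assume "u \<in> V - \<tau>"
    then obtain w where w: "w \<in> \<Union>B - T" "u = h w" using out by blast
    obtain x :: "'b \<Rightarrow> int" where x: "(\<lambda>v. real_of_int (x v)) \<in> relations (cdim B) (\<Union>B) mu0"
      "x w = 1" "\<And>v. v \<in> \<Union>B - T \<Longrightarrow> v \<noteq> w \<Longrightarrow> x v = 0"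
      using unimodular_relation[OF unT TB finB w(1)] by blast
    have "(\<lambda>v. real_of_int (x (q v))) \<in> relations n V lam"
      unfolding rel by (rule pull_relationsI[OF x(1)])
    moreover have "x (q u) = 1" using w h x(2) by auto
    moreover have "x (q v) = 0" if v: "v \<in> V - \<tau>" "v \<noteq> u" for v
    proof -
      obtain w' where w': "w' \<in> \<Union>B - T" "v = h w'" using v(1) out by blast
      have "q v = w'" using h[OF w'(1)] w'(2) by simp
      moreover have "w' \<noteq> w" using v(2) w'(2) w(2) by blast
      ultimately show ?thesis using x(3)[OF w'(1)] by simp
    qed
    ultimately show "\<exists>x :: 'a \<Rightarrow> int. (\<lambda>v. real_of_int (x v)) \<in> relations n V lam \<and>
        x u = 1 \<and> (\<forall>v\<in>V - \<tau>. v \<noteq> u \<longrightarrow> x v = 0)" by (intro exI[of _ "\<lambda>v. x (q v)"]) auto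
  next
    fix c v assume c: "c \<in> relations n V lam" "\<And>v. v \<in> V - \<tau> \<Longrightarrow> c v = 0" and v: "v \<in> V"
    obtain y where y: "y \<in> relations (cdim B) (\<Union>B) mu0" "\<forall>v\<in>V. c v = y (q v)"
      using c(1) unfolding rel pull_relations_def by blast
    have "y w = 0" if "w \<in> \<Union>B - T" for w
      using c(2)[of "h w"] y(2) h[OF that] out[of "h w"] that by auto
    then have "y (q v) = 0"
      using unimodular_relation_zero[OF unT TB finB y(1)] surj v by blast
    then show "c v = 0" using y v by auto
  qed
  ultimately show ?thesis using \<tau> by blast
qed

lemma cdim_pullback: "cdim (pullback V q B) = n"
  by (rule cdim_eqI[OF absK]) (use extend_face unimodular_card in metis)

lemma unimodular_pullback: "unimodular_complex (pullback V q B) lam"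
  unfolding unimodular_complex_def cdim_pullback vertK
  using absK extend_face car by blast

text \<open>For \<open>c \<ge> 0\<close>, the support of \<open>c\<close> is a face if and only if the support of the fibrewise minimum \<open>m c\<close> is a face of \<open>B\<close>, and
  adding a pulled back relation to \<open>c\<close> adds this relation to \<open>m c\<close>. So coordinates over the pullback
  correspond to coordinates over \<open>B\<close>.\<close>

lemma unique_coordinates_pullback:
  assumes coords: "unique_coordinates B mu0"
  shows "unique_coordinates (pullback V q B) lam"
proof -
  define m where "m c w = (if w \<in> \<Union>B then Min (c ` {v \<in> V. q v = w}) else 0)" for c :: "'a \<Rightarrow> real" and w
  have fib: "finite {v \<in> V. q v = w}" "w \<in> \<Union>B \<Longrightarrow> {v \<in> V. q v = w} \<noteq> {}" for w
    unfolding surj[symmetric] using finV by auto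
  have m_le: "m c (q v) \<le> c v" if "v \<in> V" for c v
    using that fib(1)[of "q v"] surj by (auto simp: m_def intro!: Min_le)
  have m_att: "\<exists>v\<in>V. q v = w \<and> c v = m c w" if "w \<in> \<Union>B" for c w
  proof -
    have "Min (c ` {v \<in> V. q v = w}) \<in> c ` {v \<in> V. q v = w}"
      by (rule Min_in) (use fib that in auto)
    then show ?thesis using that by (auto simp: m_def)
  qed
  have mcc: "cone_coordinates B (m c)" if c: "cone_coordinates (pullback V q B) c" for c
  proof -
    have nn: "0 \<le> c v" for v using c by (simp add: cone_coordinates_def)
    have mn: "0 \<le> m c w" for w
    proof (cases "w \<in> \<Union>B")
      case True then show ?thesis using m_att[OF True, of c] nn by metis
    qed (simp add: m_def)
    have "{w. m c w \<noteq> 0} = full_fibres V q B {v. c v \<noteq> 0}"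
    proof (intro equalityI subsetI)
      fix w assume "w \<in> {w. m c w \<noteq> 0}"
      then have w: "w \<in> \<Union>B" "0 < m c w" using mn[of w] by (auto simp: m_def split: if_splits)
      have "c v \<noteq> 0" if "v \<in> V" "q v = w" for v using m_le[OF that(1), of c] that w(2) by auto
      then show "w \<in> full_fibres V q B {v. c v \<noteq> 0}" using w by simp
    next
      fix w assume w: "w \<in> full_fibres V q B {v. c v \<noteq> 0}"
      then obtain v where "v \<in> V" "q v = w" "c v = m c w" using m_att by blast
      then show "w \<in> {w. m c w \<noteq> 0}" using w by auto
    qed
    then show ?thesis using c mn by (simp add: cone_coordinates_def pullback_def)
  qed
  have ex: "\<exists>c. cone_coordinates (pullback V q B) c \<and> (\<forall>j<n. comb V lam c j = x j)" for x
  proof -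
    obtain d where d: "\<And>j. j < n \<Longrightarrow> comb V lam d j = x j"
      using unimodular_surj[OF un0 finV] by blast
    obtain c0 where c0: "cone_coordinates B c0"
      "\<forall>j<cdim B. comb (\<Union>B) mu0 c0 j = comb (\<Union>B) mu0 (m d) j"
      using unique_coordinates_ex[OF coords, of "comb (\<Union>B) mu0 (m d)"] by blast
    have c0n: "0 \<le> c0 w" for w using c0(1) by (simp add: cone_coordinates_def)
    have c0B: "w \<in> \<Union>B" if "c0 w \<noteq> 0" for w
    proof -
      have "{w. c0 w \<noteq> 0} \<in> B" using c0(1) by (simp add: cone_coordinates_def)
      then show ?thesis using that by blast
    qed
    define y where "y w = c0 w - m d w" for w
    have y: "y \<in> relations (cdim B) (\<Union>B) mu0"
      using c0(2) by (simp add: relations_def y_def left_diff_distrib sum_subtractf)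
    define c where "c v = (if v \<in> V then d v + y (q v) else 0)" for v
    have ge: "c0 (q v) \<le> c v" if "v \<in> V" for v
      using m_le[OF that, of d] that by (simp add: c_def y_def)
    have nn: "0 \<le> c v" for v
      using ge[of v] c0n[of "q v"] by (cases "v \<in> V") (auto simp: c_def)
    have "full_fibres V q B {v. c v \<noteq> 0} = {w. c0 w \<noteq> 0}"
    proof (intro equalityI subsetI)
      fix w assume w: "w \<in> {w. c0 w \<noteq> 0}"
      then have "0 < c0 w" using c0n[of w] by simp
      then have "c v \<noteq> 0" if "v \<in> V" "q v = w" for v using ge[OF that(1)] that by auto
      then show "w \<in> full_fibres V q B {v. c v \<noteq> 0}" using c0B w by auto
    next
      fix w assume w: "w \<in> full_fibres V q B {v. c v \<noteq> 0}"
      then obtain v where v: "v \<in> V" "q v = w" "d v = m d w" using m_att by blast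
      then have "c v = c0 w" by (simp add: c_def y_def)
      then show "w \<in> {w. c0 w \<noteq> 0}" using w v by auto
    qed
    then have "{v. c v \<noteq> 0} \<in> pullback V q B"
      using c0(1) by (auto simp: pullback_def cone_coordinates_def c_def)
    then have "cone_coordinates (pullback V q B) c" using nn by (simp add: cone_coordinates_def)
    moreover have "comb V lam c j = x j" if j: "j < n" for j
    proof -
      have "(\<lambda>v. y (q v)) \<in> relations n V lam" unfolding rel pull_relations_def using y by blast
      then have "(\<Sum>v\<in>V. y (q v) * real_of_int (lam v $ j)) = 0" using j by (rule relationsD)
      moreover have "comb V lam c j
          = (\<Sum>v\<in>V. d v * real_of_int (lam v $ j) + y (q v) * real_of_int (lam v $ j))"
        by (rule sum.cong) (auto simp: c_def distrib_right)
      ultimately show ?thesis using d[OF j] by (simp add: sum.distrib)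
    qed
    ultimately show ?thesis by blast
  qed
  have uniq: "c = d"
    if c: "cone_coordinates (pullback V q B) c" and d: "cone_coordinates (pullback V q B) d"
      and cd: "(\<lambda>v. c v - d v) \<in> relations n V lam" for c d
  proof -
    obtain y where y: "y \<in> relations (cdim B) (\<Union>B) mu0" "\<forall>v\<in>V. c v - d v = y (q v)"
      using cd unfolding rel pull_relations_def by blast
    have md: "m c w - m d w = y w" if w: "w \<in> \<Union>B" for w
    proof -
      obtain u v where u: "u \<in> V" "q u = w" "c u = m c w" and v: "v \<in> V" "q v = w" "d v = m d w"
        using m_att[OF w] by metis
      have "c u - d u = y w" "c v - d v = y w" using y(2) u v by auto
      moreover have "m c w \<le> c v" "m d w \<le> d u" using m_le[OF v(1), of c] m_le[OF u(1), of d] u v by auto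
      ultimately show ?thesis using u(3) v(3) by linarith
    qed
    have "(\<lambda>w. m c w - m d w) \<in> relations (cdim B) (\<Union>B) mu0"
      using relations_cong[of "\<Union>B" "\<lambda>w. m c w - m d w" y] md y(1) by blast
    then have eq: "m c = m d"
      by (rule unique_coordinates_unique[OF coords mcc[OF c] mcc[OF d]])
    have on: "c v = d v" if "v \<in> V" for v
    proof -
      have "q v \<in> \<Union>B" using that unfolding surj[symmetric] by blast
      from md[OF this] have "y (q v) = 0" using eq by simp
      then show ?thesis using bspec[OF y(2) that] by simp
    qed
    have off: "c v = d v" if "v \<notin> V" for v
    proof -
      have "{v. c v \<noteq> 0} \<subseteq> V" "{v. d v \<noteq> 0} \<subseteq> V"
        using c d by (auto simp: cone_coordinates_def pullback_def)
      then have "v \<notin> {v. c v \<noteq> 0}" "v \<notin> {v. d v \<noteq> 0}" using that by blast+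
      then show ?thesis by simp
    qed
    show ?thesis using on off by blast
  qed
  show ?thesis
    unfolding unique_coordinates_def cdim_pullback vertK using ex uniq by blast
qed

lemma optimal_partition_pullback:
  assumes P: "optimal_partition B mu0 P"
  shows "optimal_partition (pullback V q B) lam ((\<lambda>N. {v \<in> V. q v \<in> N}) ` P)"
proof -
  have part: "partition_on (\<Union>B) P" using P by (simp add: optimal_partition_def)
  have PB: "N \<subseteq> \<Union>B" if "N \<in> P" for N using part that by (auto simp: partition_on_def)
  have "partition_on V ((\<lambda>N. {v \<in> V. q v \<in> N}) ` P)"
  proof (rule partition_onI)
    show "\<Union>((\<lambda>N. {v \<in> V. q v \<in> N}) ` P) = V"
    proof -
      have "q v \<in> \<Union>P" if "v \<in> V" for v
        using part surj that unfolding partition_on_def by (metis imageI)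
      then show ?thesis by blast
    qed
  next
    fix M M' assume "M \<in> (\<lambda>N. {v \<in> V. q v \<in> N}) ` P" "M' \<in> (\<lambda>N. {v \<in> V. q v \<in> N}) ` P" "M \<noteq> M'"
    then obtain N N' where N: "N \<in> P" "N' \<in> P" "N \<noteq> N'" "M = {v \<in> V. q v \<in> N}" "M' = {v \<in> V. q v \<in> N'}"
      by blast
    then have "N \<inter> N' = {}" using part by (auto simp: partition_on_def disjoint_def)
    then show "disjnt M M'" using N by (auto simp: disjnt_def)
  next
    have "M \<noteq> {}" if "M \<in> (\<lambda>N. {v \<in> V. q v \<in> N}) ` P" for M
    proof -
      from that obtain N where N: "N \<in> P" "M = {v \<in> V. q v \<in> N}" by blast
      have "N \<noteq> {}" using part N(1) by (auto simp: partition_on_def)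
      then obtain w where w: "w \<in> N" by blast
      then have "w \<in> q ` V" using PB[OF N(1)] unfolding surj by blast
      then show ?thesis using N(2) w by blast
    qed
    then show "{} \<notin> (\<lambda>N. {v \<in> V. q v \<in> N}) ` P" by blast
  qed
  moreover have "minimal_nonface (pullback V q B) {v \<in> V. q v \<in> N}" if N: "N \<in> P" for N
  proof -
    have mn: "N \<notin> B" "\<And>\<sigma>. \<sigma> \<subset> N \<Longrightarrow> \<sigma> \<in> B"
      using P N by (auto simp: optimal_partition_def minimal_nonface_def)
    have "full_fibres V q B {v \<in> V. q v \<in> N} = N"
      using PB[OF N] unfolding surj[symmetric] by auto
    then have "{v \<in> V. q v \<in> N} \<notin> pullback V q B" using mn(1) by (auto simp: pullback_def)
    moreover have "\<sigma> \<in> pullback V q B" if \<sigma>: "\<sigma> \<subset> {v \<in> V. q v \<in> N}" for \<sigma>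
    proof -
      obtain u where u: "u \<in> V" "q u \<in> N" "u \<notin> \<sigma>" using \<sigma> by blast
      have "full_fibres V q B \<sigma> \<subseteq> N"
        unfolding surj[symmetric] using \<sigma> by blast
      moreover have "q u \<notin> full_fibres V q B \<sigma>" using u by blast
      ultimately have "full_fibres V q B \<sigma> \<subset> N" using u(2) by blast
      then show ?thesis using mn(2) \<sigma> by (auto simp: pullback_def)
    qed
    ultimately show ?thesis unfolding minimal_nonface_def vertK by blast
  qed
  moreover have "vec n (\<lambda>j. \<Sum>v\<in>{v \<in> V. q v \<in> N}. lam v $ j) = 0\<^sub>v n" if N: "N \<in> P" for N
  proof -
    have "(\<lambda>v. of_bool (v \<in> N)) \<in> relations (cdim B) (\<Union>B) mu0"
      using sum_zero_indicator[OF PB[OF N] finB] P N by (simp add: optimal_partition_def)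
    then have "(\<lambda>v. of_bool (v \<in> {v \<in> V. q v \<in> N})) \<in> relations n V lam"
      unfolding rel pull_relations_def by (auto intro!: bexI[of _ "\<lambda>v. of_bool (v \<in> N)"])
    then show ?thesis using sum_zero_indicator[of "{v \<in> V. q v \<in> N}" V n lam] finV by auto
  qed
  ultimately show ?thesis
    unfolding optimal_partition_def vertK cdim_pullback by blast
qed

end

section \<open>D-J equivalence\<close>

lemma GL_intI:
  assumes "A \<in> carrier_mat n n" "C \<in> carrier_mat n n" "A * C = 1\<^sub>m n" "C * A = 1\<^sub>m n"
  shows "A \<in> GL_int n"
  using assms by (auto simp: GL_int_def invertible_mat_def inverts_mat_def intro!: exI[of _ C])

lemma mat_mult_index:
  "i < n \<Longrightarrow> k < n \<Longrightarrow> (mat n n f * mat n n g) $$ (i, k) = (\<Sum>j<n. f (i, j) * g (j, k))"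
  for f g :: "nat \<times> nat \<Rightarrow> int"
  by (simp add: scalar_prod_def atLeast0LessThan)

lemma mat_vec_index:
  "i < n \<Longrightarrow> x \<in> carrier_vec n \<Longrightarrow> (mat n n f *\<^sub>v x) $ i = (\<Sum>j<n. f (i, j) * x $ j)"
  for f :: "nat \<times> nat \<Rightarrow> int"
  by (auto simp: scalar_prod_def atLeast0LessThan)

text \<open>The equivalence is the matrix that takes one map to the other on a common facet. The values at
  other vertices are expressed by those on the facet through relations, which are the same.\<close>

lemma dj_equivI:
  assumes K: "abstract_complex K" and lam: "char_map K lam" and mu: "char_map K mu"
    and rel: "relations (cdim K) (\<Union>K) lam = relations (cdim K) (\<Union>K) mu"
  shows "dj_equiv K lam mu"
proof -
  define n where "n = cdim K"
  define V where "V = \<Union>K"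
  have finV: "finite V" using K by (simp add: V_def abstract_complex_def)
  have "finite K" using finV finite_UnionD V_def by blast
  then have "Max (card ` K) \<in> card ` K"
    using abstract_complexD(2)[OF K] by (intro Max_in) auto
  then obtain \<tau> where \<tau>: "\<tau> \<in> K" "card \<tau> = n" by (auto simp: n_def cdim_def)
  have \<tau>V: "\<tau> \<subseteq> V" using \<tau> by (auto simp: V_def)
  have ul: "unimodular n lam \<tau>" and um: "unimodular n mu \<tau>"
    using char_map_unimodular lam mu \<tau> by (auto simp: n_def)
  have carl: "lam v \<in> carrier_vec n" and carm: "mu v \<in> carrier_vec n" if "v \<in> V" for v
    using lam mu that by (auto simp: char_map_def n_def V_def)
  have fin: "finite \<tau>" by (rule unimodular_finite[OF ul])
  obtain g where "dual_coordinates n lam \<tau> g"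
    by (rule unimodular_dual[OF ul])
  note g = dual_coordinatesD[OF this]
  obtain h where "dual_coordinates n mu \<tau> h"
    by (rule unimodular_dual[OF um])
  note h = dual_coordinatesD[OF this]
  \<comment> \<open>The product of the matrix with columns \<open>x v\<close> and the one with rows \<open>g v\<close>, so that no enumeration of \<open>\<tau>\<close>
    is needed.\<close>
  define T where "T x g = mat n n (\<lambda>(i, j). \<Sum>v\<in>\<tau>. x v $ i * g v j)"
    for x :: "'a \<Rightarrow> int vec" and g :: "'a \<Rightarrow> nat \<Rightarrow> int"
  have inv: "T x g * T y h = 1\<^sub>m n"
    if gy: "\<And>u v. u \<in> \<tau> \<Longrightarrow> v \<in> \<tau> \<Longrightarrow> (\<Sum>j<n. g u j * y v $ j) = (if u = v then 1 else 0)"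
      and xh: "\<And>i j. i < n \<Longrightarrow> j < n \<Longrightarrow> (\<Sum>v\<in>\<tau>. x v $ i * h v j) = (if i = j then 1 else 0)"
    for x y :: "'a \<Rightarrow> int vec" and g h :: "'a \<Rightarrow> nat \<Rightarrow> int"
  proof (rule eq_matI)
    fix i k assume "i < dim_row (1\<^sub>m n :: int mat)" "k < dim_col (1\<^sub>m n :: int mat)"
    then have ik: "i < n" "k < n" by auto
    have "(T x g * T y h) $$ (i, k) = (\<Sum>j<n. (\<Sum>v\<in>\<tau>. x v $ i * g v j) * (\<Sum>u\<in>\<tau>. y u $ j * h u k))"
      unfolding T_def using ik by (subst mat_mult_index) auto
    also have "\<dots> = (\<Sum>j<n. \<Sum>v\<in>\<tau>. \<Sum>u\<in>\<tau>. x v $ i * h u k * (g v j * y u $ j))"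
      by (simp add: sum_product mult_ac)
    also have "\<dots> = (\<Sum>v\<in>\<tau>. \<Sum>j<n. \<Sum>u\<in>\<tau>. x v $ i * h u k * (g v j * y u $ j))"
      by (rule sum.swap)
    also have "\<dots> = (\<Sum>v\<in>\<tau>. \<Sum>u\<in>\<tau>. \<Sum>j<n. x v $ i * h u k * (g v j * y u $ j))"
      by (intro sum.cong sum.swap HOL.refl)
    also have "\<dots> = (\<Sum>v\<in>\<tau>. \<Sum>u\<in>\<tau>. x v $ i * h u k * (if v = u then 1 else 0))"
      by (intro sum.cong) (simp_all add: gy flip: sum_distrib_left)
    also have "\<dots> = (\<Sum>v\<in>\<tau>. x v $ i * h v k)"
      using fin by (simp add: if_distrib[of "\<lambda>z. _ * z"] cong: if_cong)
    finally show "(T x g * T y h) $$ (i, k) = 1\<^sub>m n $$ (i, k)" using xh ik by simp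
  qed (auto simp: T_def)
  have G: "T mu g \<in> GL_int n"
    by (rule GL_intI[of _ _ "T lam h"]) (use inv g h in \<open>auto simp: T_def\<close>)
  have Gi: "(T mu g *\<^sub>v lam u) $ i = (\<Sum>v\<in>\<tau>. mu v $ i * (\<Sum>j<n. g v j * lam u $ j))"
    if u: "u \<in> V" and i: "i < n" for u i
  proof -
    have "(T mu g *\<^sub>v lam u) $ i = (\<Sum>j<n. \<Sum>v\<in>\<tau>. mu v $ i * (g v j * lam u $ j))"
      unfolding T_def mat_vec_index[OF i carl[OF u]]
      by (simp add: sum_distrib_left sum_distrib_right mult_ac)
    also have "\<dots> = (\<Sum>v\<in>\<tau>. mu v $ i * (\<Sum>j<n. g v j * lam u $ j))"
      by (subst sum.swap) (simp add: sum_distrib_left)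
    finally show ?thesis .
  qed
  have in\<tau>: "(T mu g *\<^sub>v lam u) $ i = mu u $ i" if u: "u \<in> \<tau>" and i: "i < n" for u i
    using Gi[of u i] u i \<tau>V fin g(2) by (auto simp: if_distrib[of "\<lambda>z. _ * z"] cong: if_cong)
  have "mu u = T mu g *\<^sub>v lam u" if u: "u \<in> V" for u
  proof (rule eq_vecI)
    fix i assume "i < dim_vec (T mu g *\<^sub>v lam u)"
    then have i: "i < n" by (simp add: T_def)
    show "mu u $ i = (T mu g *\<^sub>v lam u) $ i"
    proof (cases "u \<in> \<tau>")
      case False
      obtain x :: "'a \<Rightarrow> int" where x: "(\<lambda>v. real_of_int (x v)) \<in> relations n V lam"
        "x u = 1" "\<And>v. v \<in> V - \<tau> \<Longrightarrow> v \<noteq> u \<Longrightarrow> x v = 0"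
        using unimodular_relation[OF ul \<tau>V finV, of u] u False by blast
      have ex: "y u $ j = - (\<Sum>v\<in>\<tau>. x v * y v $ j)"
        if y: "(\<lambda>v. real_of_int (x v)) \<in> relations n V y" and j: "j < n" for y :: "'a \<Rightarrow> int vec" and j
      proof -
        have "real_of_int (\<Sum>v\<in>V. x v * y v $ j) = 0" using relationsD[OF y j] by simp
        then have "(\<Sum>v\<in>V. x v * y v $ j) = 0" by linarith
        moreover have "(\<Sum>v\<in>V. x v * y v $ j) = (\<Sum>v\<in>insert u \<tau>. x v * y v $ j)"
          by (rule sum.mono_neutral_right) (use \<tau>V finV u x in auto)
        ultimately show ?thesis using False fin x(2) by simp
      qed
      have xmu: "(\<lambda>v. real_of_int (x v)) \<in> relations n V mu"
        using x(1) rel by (simp add: n_def V_def)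
      have "(T mu g *\<^sub>v lam u) $ i = (\<Sum>v\<in>\<tau>. mu v $ i * (\<Sum>j<n. g v j * lam u $ j))"
        by (rule Gi[OF u i])
      also have "\<dots> = (\<Sum>v\<in>\<tau>. mu v $ i * - (\<Sum>w\<in>\<tau>. x w * (\<Sum>j<n. g v j * lam w $ j)))"
      proof (intro sum.cong HOL.refl arg_cong2[of _ _ _ _ "(*)"])
        fix v
        have "(\<Sum>j<n. g v j * lam u $ j) = (\<Sum>j<n. - (\<Sum>w\<in>\<tau>. x w * (g v j * lam w $ j)))"
          by (rule sum.cong) (simp_all add: ex[OF x(1)] sum_distrib_left mult_ac)
        also have "\<dots> = - (\<Sum>w\<in>\<tau>. x w * (\<Sum>j<n. g v j * lam w $ j))"
          unfolding sum_negf by (subst sum.swap) (simp add: sum_distrib_left)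
        finally show "(\<Sum>j<n. g v j * lam u $ j) = - (\<Sum>w\<in>\<tau>. x w * (\<Sum>j<n. g v j * lam w $ j))" .
      qed
      also have "\<dots> = (\<Sum>v\<in>\<tau>. mu v $ i * - x v)"
      proof (intro sum.cong HOL.refl arg_cong2[of _ _ _ _ "(*)"] arg_cong[of _ _ uminus])
        fix v assume v: "v \<in> \<tau>"
        have "(\<Sum>w\<in>\<tau>. x w * (\<Sum>j<n. g v j * lam w $ j)) = (\<Sum>w\<in>\<tau>. if v = w then x w else 0)"
          by (rule sum.cong) (use v g(2) in auto)
        then show "(\<Sum>w\<in>\<tau>. x w * (\<Sum>j<n. g v j * lam w $ j)) = x v" using fin v by simp
      qed
      also have "\<dots> = mu u $ i" using ex[OF xmu i] by (simp add: sum_negf mult.commute)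
      finally show ?thesis by simp
    qed (use in\<tau> i in simp)
  qed (use carm[OF u] in \<open>auto simp: T_def\<close>)
  then show ?thesis unfolding dj_equiv_def using G by (auto simp: n_def V_def)
qed

section \<open>Canonical extensions\<close>

lemma unimodular_unit_vecs:
  assumes e: "bij_betw e {..<n} \<tau>" and unit: "\<And>k. k < n \<Longrightarrow> lam (e k) = unit_vec n k"
  shows "unimodular n lam \<tau>"
proof (rule unimodularI[where g = "\<lambda>v j. lam v $ j"])
  show "finite \<tau>" using e bij_betw_finite by blast
  have im: "\<tau> = e ` {..<n}" and inj: "inj_on e {..<n}" using e by (auto simp: bij_betw_def)
  show "lam v \<in> carrier_vec n" if "v \<in> \<tau>" for v using that unit by (auto simp: im)
  show "(\<Sum>v\<in>\<tau>. lam v $ i * lam v $ j) = (if i = j then 1 else 0)" if ij: "i < n" "j < n" for i j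
  proof -
    have "(\<Sum>v\<in>\<tau>. lam v $ i * lam v $ j) = (\<Sum>k<n. lam (e k) $ i * lam (e k) $ j)"
      by (rule sum.reindex_bij_betw[OF e, symmetric])
    also have "\<dots> = (\<Sum>k<n. if k = i then (if i = j then 1 else 0) else 0)"
      by (rule sum.cong) (use unit ij in auto)
    finally show ?thesis using ij by simp
  qed
  show "(\<Sum>j<n. lam u $ j * lam v $ j) = (if u = v then 1 else 0)" if uv: "u \<in> \<tau>" "v \<in> \<tau>" for u v
  proof -
    obtain k l where kl: "k < n" "l < n" "u = e k" "v = e l" using uv by (auto simp: im)
    have "(\<Sum>j<n. lam u $ j * lam v $ j) = (\<Sum>j<n. if j = k then (if k = l then 1 else 0) else 0)"
      by (rule sum.cong) (use unit kl in auto)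
    then show ?thesis using kl inj by (auto simp: inj_on_eq_iff)
  qed
qed

text \<open>The first two rows of the extended matrix differ only in the columns of \<open>a\<close> and \<open>b\<close>. So a relation takes
  the same value on \<open>a\<close> and \<open>b\<close>, and the remaining rows say that it descends to a relation over \<open>K\<close>.\<close>

lemma canonical_ext_exists:
  fixes K :: "'a set set"
  assumes reg: "unimodular_complex K lam" and v: "v \<in> \<Union>K" and ab: "a \<notin> \<Union>K" "b \<notin> \<Union>K" "a \<noteq> b"
  defines "V \<equiv> \<Union>K - {v} \<union> {a, b}"
  obtains mu \<tau> where "canonical_ext K lam v a b mu"
    "relations (Suc (cdim K)) V mu =
      pull_relations V (\<lambda>u. if u = a \<or> u = b then v else u) (relations (cdim K) (\<Union>K) lam)"
    "\<And>u. u \<in> V \<Longrightarrow> mu u \<in> carrier_vec (Suc (cdim K))"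
    "unimodular (Suc (cdim K)) mu \<tau>" "\<tau> \<subseteq> V"
proof -
  define n where "n = cdim K"
  define W where "W = \<Union>K - {v}"
  have K: "abstract_complex K" using reg by (simp add: unimodular_complex_def)
  have finK: "finite (\<Union>K)" using abstract_complexD[OF K] by blast
  have finW: "finite W" using finK by (simp add: W_def)
  have "{v} \<in> K" by (rule abstract_complex_vertex[OF K v])
  then obtain \<tau> where \<tau>: "\<tau> \<in> K" "v \<in> \<tau>" and un: "unimodular n lam \<tau>"
    using reg by (auto simp: unimodular_complex_def n_def)
  have fin: "finite \<tau>" and card: "card \<tau> = n"
    using unimodular_finite[OF un] unimodular_card[OF un] by auto
  have n0: "0 < n" using \<tau> fin card card_gt_0_iff by blast
  have "card (\<tau> - {v}) = card {1..<n}" using \<tau> card by simp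
  then obtain e' where e': "bij_betw e' {1..<n} (\<tau> - {v})"
    using finite_same_card_bij[of "{1..<n}" "\<tau> - {v}"] fin by auto
  define w where "w = e'(0 := v)"
  have w0: "w 0 = v" by (simp add: w_def)
  have w1: "bij_betw w {1..<n} (\<tau> - {v})"
    using e' by (rule bij_betw_cong[THEN iffD1, rotated]) (simp add: w_def)
  have w: "bij_betw w {..<n} \<tau>"
  proof -
    have "bij_betw w ({1..<n} \<union> {0}) ((\<tau> - {v}) \<union> {v})"
      using notIn_Un_bij_betw[of 0 "{1..<n}" w "\<tau> - {v}"] w1 w0 by simp
    moreover have "{1..<n} \<union> {0} = {..<n}" "(\<tau> - {v}) \<union> {v} = \<tau>" using n0 \<tau> by auto
    ultimately show ?thesis by simp
  qed
  have w\<tau>: "w i \<in> \<tau>" if "i < n" for i using w that by (auto simp: bij_betw_def)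
  have winj: "w i = w j \<longleftrightarrow> i = j" if "i < n" "j < n" for i j
    using w that by (auto simp: bij_betw_def inj_on_eq_iff)
  obtain g where "dual_coordinates n lam \<tau> g"
    by (rule unimodular_dual[OF un])
  note g = dual_coordinatesD[OF this]
  have car: "lam u \<in> carrier_vec n" if "u \<in> \<Union>K" for u
    using reg that by (auto simp: unimodular_complex_def n_def)
  have \<tau>K: "u \<in> \<Union>K" if "u \<in> \<tau>" for u using that \<tau> by blast
  define G where "G = mat n n (\<lambda>(i, j). g (w i) j)"
  define M where "M = mat n n (\<lambda>(i, j). lam (w j) $ i)"
  have lg: "(\<Sum>k<n. lam (w k) $ i * g (w k) j) = (if i = j then 1 else 0)" if "i < n" "j < n" for i j
    using sum.reindex_bij_betw[OF w, of "\<lambda>u. lam u $ i * g u j"] g(1)[OF that] by simp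
  have G: "G \<in> GL_int n"
  proof (rule GL_intI[of _ _ M])
    show "G * M = 1\<^sub>m n"
    proof (rule eq_matI)
      fix i j assume "i < dim_row (1\<^sub>m n :: int mat)" "j < dim_col (1\<^sub>m n :: int mat)"
      then have ij: "i < n" "j < n" by auto
      show "(G * M) $$ (i, j) = 1\<^sub>m n $$ (i, j)"
        unfolding G_def M_def mat_mult_index[OF ij] using ij g(2)[of "w i" "w j"] w\<tau> winj by simp
    qed (auto simp: G_def M_def)
    show "M * G = 1\<^sub>m n"
    proof (rule eq_matI)
      fix i j assume "i < dim_row (1\<^sub>m n :: int mat)" "j < dim_col (1\<^sub>m n :: int mat)"
      then have ij: "i < n" "j < n" by auto
      show "(M * G) $$ (i, j) = 1\<^sub>m n $$ (i, j)"
        unfolding G_def M_def mat_mult_index[OF ij] using ij lg by simp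
    qed (auto simp: G_def M_def)
  qed (auto simp: G_def M_def)
  \<comment> \<open>The rows of the normalized matrix \<open>G * lam\<close>.\<close>
  define h where "h i u = (\<Sum>j<n. g (w i) j * lam u $ j)" for i u
  have Gh: "(G *\<^sub>v lam u) $ i = h i u" if "i < n" "u \<in> \<Union>K" for i u
    unfolding G_def mat_vec_index[OF that(1) car[OF that(2)]] h_def by simp
  have hw: "h i (w k) = (if i = k then 1 else 0)" if "i < n" "k < n" for i k
    using g(2)[of "w i" "w k"] w\<tau> winj that by (simp add: h_def)
  have unitG: "G *\<^sub>v lam (w i) = unit_vec n i" if i: "i < n" for i
  proof (rule eq_vecI)
    fix k assume "k < dim_vec (unit_vec n i :: int vec)"
    then have k: "k < n" by simp
    show "(G *\<^sub>v lam (w i)) $ k = unit_vec n i $ k"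
      using Gh[OF k \<tau>K[OF w\<tau>[OF i]]] hw[OF k i] k i by simp
  qed (simp add: G_def)
  define mu where "mu u = (if u = a then unit_vec (Suc n) 0 else if u = b then unit_vec (Suc n) 1
      else vec (Suc n) (\<lambda>j. if j = 0 then (G *\<^sub>v lam u) $ 0 else (G *\<^sub>v lam u) $ (j - 1)))" for u
  have abW: "a \<notin> W" "b \<notin> W" using ab by (auto simp: W_def)
  have muW: "mu u $ j = h (j - 1) u" if "u \<in> W" "j < Suc n" for u j
  proof -
    have "u \<noteq> a" "u \<noteq> b" using that abW by auto
    moreover have "j - 1 < n" using that n0 by auto
    ultimately show ?thesis using Gh[of "j - 1" u] Gh[of 0 u] that n0
      by (cases "j = 0") (auto simp: mu_def W_def)
  qed
  have ext: "canonical_ext K lam v a b mu"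
    unfolding canonical_ext_def Let_def n_def[symmetric]
  proof (intro exI[of _ w] bexI[OF _ G] conjI allI impI ballI)
    show "inj_on w {..<n}" "w ` {..<n} \<in> K" using w \<tau> by (auto simp: bij_betw_def)
    fix u assume "u \<in> \<Union>K - {v}"
    then have "u \<noteq> a" "u \<noteq> b" using ab by auto
    then show "mu u = vec (Suc n) (\<lambda>j. if j = 0 then (G *\<^sub>v lam u) $ 0 else (G *\<^sub>v lam u) $ (j - 1))"
      by (simp add: mu_def)
  qed (use n0 w0 unitG ab(3) in \<open>auto simp: mu_def\<close>)
  define S where "S i c = (\<Sum>u\<in>W. c u * real_of_int (h i u))" for i and c :: "'a \<Rightarrow> real"
  have lamh: "lam u $ j = (\<Sum>i<n. lam (w i) $ j * h i u)" if j: "j < n" for j u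
  proof -
    have "(\<Sum>i<n. lam (w i) $ j * h i u) = (\<Sum>i<n. \<Sum>k<n. lam u $ k * (lam (w i) $ j * g (w i) k))"
      by (simp add: h_def sum_distrib_left mult_ac)
    also have "\<dots> = (\<Sum>k<n. lam u $ k * (\<Sum>i<n. lam (w i) $ j * g (w i) k))"
      by (subst sum.swap) (simp add: sum_distrib_left)
    also have "\<dots> = (\<Sum>k<n. if j = k then lam u $ k else 0)"
      by (rule sum.cong) (use lg j in auto)
    finally show ?thesis using j by simp
  qed
  have relK: "y \<in> relations n (\<Union>K) lam \<longleftrightarrow> (\<forall>i<n. y v * (if i = 0 then 1 else 0) + S i y = 0)" for y
  proof -
    have split: "(\<Sum>u\<in>\<Union>K. y u * real_of_int (h i u)) = y v * (if i = 0 then 1 else 0) + S i y" if "i < n" for i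
      using sum.remove[OF finK v, of "\<lambda>u. y u * real_of_int (h i u)"] hw[OF that n0] w0
      by (simp add: S_def W_def)
    have "y \<in> relations n (\<Union>K) lam \<longleftrightarrow> (\<forall>i<n. (\<Sum>u\<in>\<Union>K. y u * real_of_int (h i u)) = 0)"
    proof
      assume y: "y \<in> relations n (\<Union>K) lam"
      show "\<forall>i<n. (\<Sum>u\<in>\<Union>K. y u * real_of_int (h i u)) = 0"
      proof (intro allI impI)
        fix i
        have "(\<Sum>u\<in>\<Union>K. y u * real_of_int (h i u))
            = (\<Sum>u\<in>\<Union>K. \<Sum>j<n. real_of_int (g (w i) j) * (y u * real_of_int (lam u $ j)))"
          by (simp add: h_def sum_distrib_left mult_ac)
        also have "\<dots> = (\<Sum>j<n. real_of_int (g (w i) j) * comb (\<Union>K) lam y j)"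
          by (subst sum.swap) (simp add: sum_distrib_left)
        also have "\<dots> = 0" by (rule sum.neutral) (use relationsD[OF y] in auto)
        finally show "(\<Sum>u\<in>\<Union>K. y u * real_of_int (h i u)) = 0" .
      qed
    next
      assume y: "\<forall>i<n. (\<Sum>u\<in>\<Union>K. y u * real_of_int (h i u)) = 0"
      have "comb (\<Union>K) lam y j = 0" if j: "j < n" for j
      proof -
        have "comb (\<Union>K) lam y j
            = (\<Sum>u\<in>\<Union>K. y u * real_of_int (\<Sum>i<n. lam (w i) $ j * h i u))"
          by (intro sum.cong arg_cong2[of _ _ _ _ "(*)"] arg_cong[of _ _ real_of_int] lamh[OF j] HOL.refl)
        also have "\<dots> = (\<Sum>u\<in>\<Union>K. \<Sum>i<n. real_of_int (lam (w i) $ j) * (y u * real_of_int (h i u)))"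
          by (simp add: sum_distrib_left mult_ac)
        also have "\<dots> = (\<Sum>i<n. real_of_int (lam (w i) $ j) * (\<Sum>u\<in>\<Union>K. y u * real_of_int (h i u)))"
          by (subst sum.swap) (simp add: sum_distrib_left)
        also have "\<dots> = 0" by (rule sum.neutral) (use y in auto)
        finally show ?thesis .
      qed
      then show "y \<in> relations n (\<Union>K) lam" by (simp add: relations_def)
    qed
    then show ?thesis using split by simp
  qed
  have VW: "V = insert a (insert b W)" by (auto simp: V_def W_def)
  have sumV: "comb V mu c j
      = c a * (if j = 0 then 1 else 0) + c b * (if j = 1 then 1 else 0) + S (j - 1) c" if j: "j < Suc n" for c j
  proof -
    have "comb W mu c j = S (j - 1) c"
      unfolding S_def by (rule sum.cong) (use muW j in auto)
    then show ?thesis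
      unfolding VW using abW ab(3) finW j n0 by (auto simp: mu_def)
  qed
  let ?q = "\<lambda>u. if u = a \<or> u = b then v else u"
  have rel: "relations (Suc n) V mu = pull_relations V ?q (relations n (\<Union>K) lam)"
  proof (intro equalityI subsetI)
    fix c assume c: "c \<in> relations (Suc n) V mu"
    have s: "c a * (if j = 0 then 1 else 0) + c b * (if j = 1 then 1 else 0) + S (j - 1) c = 0" if "j < Suc n" for j
      using relationsD[OF c that] sumV[OF that] by simp
    have ca: "c a + S 0 c = 0" using s[of 0] by simp
    have cb: "c b + S 0 c = 0" using s[of 1] n0 by simp
    define y where "y = c(v := c a)"
    have Sy: "S i y = S i c" for i unfolding S_def by (rule sum.cong) (auto simp: y_def W_def)
    have "y \<in> relations n (\<Union>K) lam"
      unfolding relK Sy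
    proof (intro allI impI)
      fix i assume i: "i < n"
      show "y v * (if i = 0 then 1 else 0) + S i c = 0"
      proof (cases "i = 0")
        case False
        then show ?thesis using s[of "Suc i"] i by simp
      qed (use ca in \<open>simp add: y_def\<close>)
    qed
    moreover have "\<forall>u\<in>V. c u = y (?q u)" using ca cb by (auto simp: V_def y_def)
    ultimately show "c \<in> pull_relations V ?q (relations n (\<Union>K) lam)"
      unfolding pull_relations_def by blast
  next
    fix c assume "c \<in> pull_relations V ?q (relations n (\<Union>K) lam)"
    then obtain y where y: "y \<in> relations n (\<Union>K) lam" "\<And>u. u \<in> V \<Longrightarrow> c u = y (?q u)"
      unfolding pull_relations_def by blast
    have cab: "c a = y v" "c b = y v" using y(2)[of a] y(2)[of b] by (auto simp: VW)
    have Sy: "S i c = S i y" for i unfolding S_def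
      by (rule sum.cong) (use y(2) abW in \<open>auto simp: VW\<close>)
    have s: "y v * (if i = 0 then 1 else 0) + S i y = 0" if "i < n" for i
      using y(1) that unfolding relK by blast
    have "comb V mu c j = 0" if j: "j < Suc n" for j
      unfolding sumV[OF j] cab Sy using s[of "j - 1"] j n0
      by (cases "j = 0"; cases "j = 1") auto
    then show "c \<in> relations (Suc n) V mu" by (simp add: relations_def)
  qed
  have carmu: "mu u \<in> carrier_vec (Suc n)" if "u \<in> V" for u
    by (simp add: mu_def)
  \<comment> \<open>The vertices on which the extended map takes the unit vectors as values.\<close>
  define e where "e = (\<lambda>k. if k = 0 then a else if k = Suc 0 then b else w (k - 1))"
  define \<tau>' where "\<tau>' = e ` {..<Suc n}"
  have wW: "w i \<in> W" if "i < n" "i \<noteq> 0" for i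
    using w\<tau>[OF that(1)] \<tau>K winj[OF that(1) n0] w0 that by (auto simp: W_def)
  have eW: "e k \<in> W" if "k < Suc n" "k \<noteq> 0" "k \<noteq> Suc 0" for k
    using wW[of "k - 1"] that by (auto simp: e_def)
  have "inj_on e {..<Suc n}"
  proof (rule inj_onI)
    fix k l assume kl: "k \<in> {..<Suc n}" "l \<in> {..<Suc n}" "e k = e l"
    show "k = l"
    proof (cases "k \<in> {0, Suc 0} \<or> l \<in> {0, Suc 0}")
      case True
      then show ?thesis using kl eW[of k] eW[of l] abW ab(3) by (auto simp: e_def split: if_splits)
    next
      case False
      then have "k - 1 < n" "l - 1 < n" "w (k - 1) = w (l - 1)" using kl by (auto simp: e_def)
      then have "k - 1 = l - 1" using winj by blast
      then show ?thesis using False by auto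
    qed
  qed
  then have bij: "bij_betw e {..<Suc n} \<tau>'" by (simp add: bij_betw_def \<tau>'_def)
  have unit: "mu (e k) = unit_vec (Suc n) k" if k: "k < Suc n" for k
  proof (cases "k = 0 \<or> k = Suc 0")
    case True
    then show ?thesis using ab(3) by (auto simp: e_def mu_def)
  next
    case False
    show ?thesis
    proof (rule eq_vecI)
      fix j assume "j < dim_vec (unit_vec (Suc n) k :: int vec)"
      then have j: "j < Suc n" by simp
      then have "j - 1 < n" using n0 by auto
      have "mu (e k) $ j = h (j - 1) (w (k - 1))"
        using muW[OF eW j] k False by (simp add: e_def)
      also have "\<dots> = (if j - 1 = k - 1 then 1 else 0)"
        using hw[OF \<open>j - 1 < n\<close>, of "k - 1"] k False by auto
      finally show "mu (e k) $ j = unit_vec (Suc n) k $ j" using False j k by auto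
    qed (simp add: mu_def)
  qed
  have "unimodular (Suc n) mu \<tau>'" by (rule unimodular_unit_vecs[OF bij unit])
  moreover have "\<tau>' \<subseteq> V"
  proof
    fix u assume "u \<in> \<tau>'"
    then obtain k where k: "k < Suc n" "u = e k" by (auto simp: \<tau>'_def)
    show "u \<in> V"
    proof (cases "k = 0 \<or> k = Suc 0")
      case True
      then show ?thesis using k by (auto simp: VW e_def)
    next
      case False
      then show ?thesis using eW[of k] k by (simp add: VW)
    qed
  qed
  ultimately show thesis
    using that[of mu \<tau>'] ext rel carmu unfolding n_def by blast
qed

lemma pull_relations_comp:
  assumes "q1 ` V = V2"
  shows "pull_relations V q1 (pull_relations V2 q2 R) = pull_relations V (\<lambda>v. q2 (q1 v)) R"
proof (intro equalityI subsetI)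
  fix c assume "c \<in> pull_relations V q1 (pull_relations V2 q2 R)"
  then obtain y z where "z \<in> R" "\<forall>v\<in>V2. y v = z (q2 v)" "\<forall>v\<in>V. c v = y (q1 v)"
    unfolding pull_relations_def by blast
  then show "c \<in> pull_relations V (\<lambda>v. q2 (q1 v)) R"
    using assms unfolding pull_relations_def by auto
next
  fix c assume "c \<in> pull_relations V (\<lambda>v. q2 (q1 v)) R"
  then obtain z where "z \<in> R" "\<forall>v\<in>V. c v = z (q2 (q1 v))" unfolding pull_relations_def by blast
  then show "c \<in> pull_relations V q1 (pull_relations V2 q2 R)"
    unfolding pull_relations_def by (auto intro!: exI[of _ "\<lambda>v. z (q2 v)"])
qed

text \<open>As long as \<open>q\<close> identifies two points \<open>a\<close> and \<open>b\<close>, remove \<open>b\<close>, realize the pullback to the rest, and take the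
  canonical extension at the vertex of \<open>a\<close>, with \<open>a\<close> and \<open>b\<close> placed on the two new vertices.\<close>

lemma canonical_realization:
  fixes B :: "nat set set" and V :: "'a set"
  assumes reg: "unimodular_complex B mu0" and "finite V" and "q ` V = \<Union>B"
  shows "\<exists>L mu f q'. canonical_seq B mu0 L mu \<and> bij_betw f V (\<Union>L) \<and> (\<forall>v\<in>V. q' (f v) = q v) \<and>
    L = pullback (\<Union>L) q' B \<and> unimodular_complex L mu \<and>
    cdim L = cdim B + (card V - card (\<Union>B)) \<and>
    relations (cdim L) (\<Union>L) mu = pull_relations (\<Union>L) q' (relations (cdim B) (\<Union>B) mu0)"
  using assms(2,3)
proof (induction "card V" arbitrary: V rule: less_induct)
  case less
  have B: "abstract_complex B" using reg by (simp add: unimodular_complex_def)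
  note finB = abstract_complexD(1)[OF B]
  show ?case
  proof (cases "inj_on q V")
    case True
    then have bij: "bij_betw q V (\<Union>B)" using less.prems by (simp add: bij_betw_def)
    then have "card V = card (\<Union>B)" by (rule bij_betw_same_card)
    moreover have "relations (cdim B) (\<Union>B) mu0 =
        pull_relations (\<Union>B) (\<lambda>w. w) (relations (cdim B) (\<Union>B) mu0)"
      unfolding pull_relations_def using relations_cong[of "\<Union>B"] by blast
    ultimately show ?thesis
      using canonical_seq.refl bij pullback_id[of B, symmetric] reg
      by (intro exI[of _ B] exI[of _ mu0] exI[of _ q] exI[of _ "\<lambda>w. w"]) auto
  next
    case False
    then obtain a b where ab: "a \<in> V" "b \<in> V" "a \<noteq> b" "q a = q b" by (auto simp: inj_on_def)
    have cV: "card V = Suc (card (V - {b}))" using card.remove[OF less.prems(1) ab(2)] by simp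
    then have lt: "card (V - {b}) < card V" by simp
    have fin': "finite (V - {b})" using less.prems by simp
    have "q b \<in> q ` (V - {b})" using ab by (intro image_eqI[of _ _ a]) auto
    then have "q ` (V - {b}) = q ` V" by (auto simp: image_iff)
    then have surj': "q ` (V - {b}) = \<Union>B" using less.prems by simp
    obtain L mu f q' where IH: "canonical_seq B mu0 L mu" "bij_betw f (V - {b}) (\<Union>L)"
      "\<And>v. v \<in> V - {b} \<Longrightarrow> q' (f v) = q v" "L = pullback (\<Union>L) q' B" "unimodular_complex L mu"
      "cdim L = cdim B + (card (V - {b}) - card (\<Union>B))"
      "relations (cdim L) (\<Union>L) mu = pull_relations (\<Union>L) q' (relations (cdim B) (\<Union>B) mu0)"
      using less.hyps[OF lt fin' surj'] by blast
    have L: "abstract_complex L" using IH(5) by (simp add: unimodular_complex_def)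
    have finL: "finite (\<Union>L)" by (rule abstract_complexD[OF L])
    have fL: "f ` (V - {b}) = \<Union>L" using IH(2) by (simp add: bij_betw_def)
    have q'L: "q' ` \<Union>L = \<Union>B"
    proof -
      have "q' ` \<Union>L = q ` (V - {b})"
        unfolding fL[symmetric] image_image by (rule image_cong) (use IH(3) in auto)
      then show ?thesis using surj' by simp
    qed
    have faL: "f a \<in> \<Union>L" using fL ab by blast
    obtain a' where a': "a' \<notin> \<Union>L" using ex_new_if_finite[OF infinite_UNIV_nat finL] by blast
    obtain b' where b': "b' \<notin> insert a' (\<Union>L)"
      using ex_new_if_finite[OF infinite_UNIV_nat finite.insertI[OF finL]] by blast
    have b'': "b' \<notin> \<Union>L" "a' \<noteq> b'" using b' by auto
    define V' where "V' = \<Union>L - {f a} \<union> {a', b'}"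
    define k where "k = (\<lambda>u. if u = a' \<or> u = b' then f a else u)"
    obtain mu' \<tau> where mu': "canonical_ext L mu (f a) a' b' mu'"
      "relations (Suc (cdim L)) V' mu' = pull_relations V' k (relations (cdim L) (\<Union>L) mu)"
      "\<And>u. u \<in> V' \<Longrightarrow> mu' u \<in> carrier_vec (Suc (cdim L))"
      "unimodular (Suc (cdim L)) mu' \<tau>" "\<tau> \<subseteq> V'"
      using canonical_ext_exists[OF IH(5) faL a' b''] unfolding V'_def k_def by blast
    have kV: "k ` V' = \<Union>L" using faL a' b'' by (auto simp: V'_def k_def image_iff)
    have finV': "finite V'" using finL by (simp add: V'_def)
    have W1: "wed L (f a) a' b' = pullback V' k L"
      unfolding V'_def k_def by (rule wed_pullback[OF L faL a' b''])
    also have "\<dots> = pullback V' (\<lambda>u. q' (k u)) B"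
      using pullback_comp[OF B finL q'L kV] IH(4) by simp
    finally have W: "wed L (f a) a' b' = pullback V' (\<lambda>u. q' (k u)) B" .
    have surjV': "(\<lambda>u. q' (k u)) ` V' = \<Union>B" using kV q'L by (metis image_image)
    have bij: "bij_betw (f(a := a', b := b')) V V'"
    proof -
      have "inj_on f (V - {b})" using IH(2) by (simp add: bij_betw_def)
      have f1: "bij_betw f (V - {a, b}) (\<Union>L - {f a})"
      proof -
        have "bij_betw f (V - {b} - {a}) (\<Union>L - {f a})"
          by (rule bij_betw_DiffI[OF IH(2)]) (use ab faL in \<open>auto simp: bij_betw_def\<close>)
        moreover have "V - {b} - {a} = V - {a, b}" by auto
        ultimately show ?thesis by simp
      qed
      have "bij_betw (f(a := a', b := b')) (V - {a, b}) (\<Union>L - {f a})"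
        using f1 by (rule bij_betw_cong[THEN iffD1, rotated]) simp
      moreover have "bij_betw (f(a := a', b := b')) {a, b} {a', b'}"
        using ab(3) b''(2) by (auto simp: bij_betw_def)
      ultimately have "bij_betw (f(a := a', b := b')) (V - {a, b} \<union> {a, b}) V'"
        unfolding V'_def by (rule bij_betw_combine) (use a' b'' in auto)
      moreover have "V - {a, b} \<union> {a, b} = V" using ab by auto
      ultimately show ?thesis by simp
    qed
    have cards: "card V' = card V" using bij_betw_same_card[OF bij] by simp
    have "card (\<Union>B) \<le> card (V - {b})" using surj' card_image_le[of "V - {b}" q] less.prems by simp
    then have dim: "Suc (cdim L) = cdim B + (card V - card (\<Union>B))"
      unfolding IH(6) cV by simp
    have rel: "relations (Suc (cdim L)) V' mu' =
        pull_relations V' (\<lambda>u. q' (k u)) (relations (cdim B) (\<Union>B) mu0)"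
      unfolding mu'(2) IH(7) pull_relations_comp[OF kV] ..
    interpret pulled_back B mu0 V' "\<lambda>u. q' (k u)" "Suc (cdim L)" mu' \<tau>
      by unfold_locales (use reg finV' surjV' dim cards mu' rel in auto)
    have VL: "\<Union>(wed L (f a) a' b') = V'" unfolding W by (rule vertK)
    have "canonical_seq B mu0 (wed L (f a) a' b') mu'"
      by (rule canonical_seq.step[OF IH(1) faL a' b'' mu'(1)])
    moreover have "\<forall>v\<in>V. q' (k ((f(a := a', b := b')) v)) = q v"
    proof
      fix v assume v: "v \<in> V"
      show "q' (k ((f(a := a', b := b')) v)) = q v"
      proof (cases "v = a \<or> v = b")
        case True
        then show ?thesis using IH(3)[of a] ab by (auto simp: k_def)
      next
        case False
        then have "f v \<in> \<Union>L" using fL v by blast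
        then show ?thesis using False IH(3)[of v] v a' b'' by (auto simp: k_def)
      qed
    qed
    moreover have "unimodular_complex (wed L (f a) a' b') mu'"
      unfolding W by (rule unimodular_pullback)
    moreover have "cdim (wed L (f a) a' b') = Suc (cdim L)"
      unfolding W by (rule cdim_pullback)
    ultimately show ?thesis
      using bij W rel dim VL
      by (intro exI[of _ "wed L (f a) a' b'"] exI[of _ mu'] exI[of _ "f(a := a', b := b')"]
          exI[of _ "\<lambda>u. q' (k u)"]) simp
  qed
qed

lemma canonical_seq_wedge_seq: "canonical_seq B mu0 L mu \<Longrightarrow> wedge_seq B L"
  by (induction rule: canonical_seq.induct) (auto intro: wedge_seq.intros)

lemma relations_reindex:
  assumes "bij_betw f V V2"
  shows "relations n V (\<lambda>v. mu (f v)) = pull_relations V f (relations n V2 mu)"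
proof (intro equalityI subsetI)
  fix c assume c: "c \<in> relations n V (\<lambda>v. mu (f v))"
  define y where "y = (\<lambda>w. c (the_inv_into V f w))"
  have y: "y (f v) = c v" if "v \<in> V" for v
    using that assms by (simp add: y_def the_inv_into_f_f bij_betw_def)
  have "comb V2 mu y j = (\<Sum>v\<in>V. c v * real_of_int (mu (f v) $ j))" for j
    using sum.reindex_bij_betw[OF assms, of "\<lambda>w. y w * real_of_int (mu w $ j)"] y by (simp cong: sum.cong)
  then have "y \<in> relations n V2 mu" using c by (simp add: relations_def)
  then show "c \<in> pull_relations V f (relations n V2 mu)"
    using y by (auto simp: pull_relations_def intro!: bexI[of _ y])
next
  fix c assume "c \<in> pull_relations V f (relations n V2 mu)"
  then obtain y where y: "y \<in> relations n V2 mu" "\<And>v. v \<in> V \<Longrightarrow> c v = y (f v)"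
    unfolding pull_relations_def by blast
  have "(\<Sum>v\<in>V. c v * real_of_int (mu (f v) $ j)) = comb V2 mu y j" for j
    using sum.reindex_bij_betw[OF assms, of "\<lambda>w. y w * real_of_int (mu w $ j)"] y(2) by (simp cong: sum.cong)
  then show "c \<in> relations n V (\<lambda>v. mu (f v))" using y(1) by (simp add: relations_def)
qed

lemma unimodular_reindex:
  assumes un: "unimodular n mu \<tau>" and f: "inj_on f \<tau>'" "f ` \<tau>' = \<tau>"
  shows "unimodular n (\<lambda>v. mu (f v)) \<tau>'"
proof -
  have "(\<lambda>v. mu (f v)) ` \<tau>' = mu ` \<tau>" using f(2) by auto
  moreover have "inj_on (\<lambda>v. mu (f v)) \<tau>'"
    using comp_inj_on[OF f(1), of mu] f(2) un by (simp add: unimodular_def comp_def)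
  ultimately show ?thesis using un by (simp add: unimodular_def)
qed

lemma pullback_realization:
  fixes B :: "nat set set" and V :: "'a set"
  assumes reg: "unimodular_complex B mu0" and fin: "finite V" and surj: "q ` V = \<Union>B"
  obtains L mu f \<tau> where "canonical_seq B mu0 L mu" "complex_iso f (pullback V q B) L"
    "pulled_back B mu0 V q (cdim B + (card V - card (\<Union>B))) (mu \<circ> f) \<tau>"
proof -
  obtain L mu f q' where R: "canonical_seq B mu0 L mu" "bij_betw f V (\<Union>L)"
      "\<And>v. v \<in> V \<Longrightarrow> q' (f v) = q v" "L = pullback (\<Union>L) q' B" "unimodular_complex L mu"
      "cdim L = cdim B + (card V - card (\<Union>B))"
      "relations (cdim L) (\<Union>L) mu = pull_relations (\<Union>L) q' (relations (cdim B) (\<Union>B) mu0)"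
    using canonical_realization[OF assms] by blast
  have B: "abstract_complex B" and L: "abstract_complex L"
    using reg R(5) by (auto simp: unimodular_complex_def)
  have iso: "complex_iso f (pullback V q B) L"
    using pullback_iso[OF R(2) B fin surj R(3)] R(4) by simp
  obtain \<rho> where \<rho>: "\<rho> \<in> L" "unimodular (cdim L) mu \<rho>"
    using R(5) abstract_complexD(2)[OF L] by (auto simp: unimodular_complex_def)
  have "\<rho> \<subseteq> f ` V" using \<rho>(1) R(2) by (auto simp: bij_betw_def)
  then obtain \<tau> where \<tau>: "\<tau> \<subseteq> V" "f ` \<tau> = \<rho>" by (metis subset_imageE)
  have inj: "inj_on f \<tau>" using R(2) \<tau>(1) by (auto simp: bij_betw_def intro: inj_on_subset)
  have fV: "f ` V = \<Union>L" using R(2) by (simp add: bij_betw_def)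
  have "pulled_back B mu0 V q (cdim L) (mu \<circ> f) \<tau>"
  proof
    show "unimodular (cdim L) (mu \<circ> f) \<tau>"
      using unimodular_reindex[OF \<rho>(2) inj \<tau>(2)] by (simp add: comp_def)
    show "(mu \<circ> f) v \<in> carrier_vec (cdim L)" if "v \<in> V" for v
      using R(5) fV that by (auto simp: unimodular_complex_def)
    have "relations (cdim L) V (mu \<circ> f) = pull_relations V f (relations (cdim L) (\<Union>L) mu)"
      using relations_reindex[OF R(2)] by (simp add: comp_def)
    also have "\<dots> = pull_relations V (\<lambda>v. q' (f v)) (relations (cdim B) (\<Union>B) mu0)"
      unfolding R(7) by (rule pull_relations_comp[OF fV])
    also have "\<dots> = pull_relations V q (relations (cdim B) (\<Union>B) mu0)"
      using R(3) by (simp add: pull_relations_def)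
    finally show "relations (cdim L) V (mu \<circ> f) = pull_relations V q (relations (cdim B) (\<Union>B) mu0)" .
  qed (use reg fin surj R(6) \<tau> in auto)
  then show thesis using that R(1,6) iso by metis
qed

section \<open>Complexes given by non-faces, and bisected partitions\<close>

definition avoiding :: "'a set \<Rightarrow> 'a set set \<Rightarrow> 'a set set" where
  "avoiding V F = {\<sigma>. \<sigma> \<subseteq> V \<and> (\<forall>X\<in>F. \<not> X \<subseteq> \<sigma>)}"

definition bisects :: "'a set \<Rightarrow> 'a set set \<Rightarrow> bool" where
  "bisects E P \<longleftrightarrow> (\<forall>N\<in>P. N \<inter> E \<noteq> {} \<and> N - E \<noteq> {})"

text \<open>If the blocks of \<open>P\<close> are the three pairs of antipodal vertices of a hexagon and \<open>E\<close> is one of its two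
  inscribed triangles, these are its non-edges: the three diagonals, and the sides of both triangles.\<close>

definition crossing_nonfaces :: "'a set set \<Rightarrow> 'a set \<Rightarrow> 'a set set" where
  "crossing_nonfaces P E = P \<union> {(N \<union> M) \<inter> E |N M. N \<in> P \<and> M \<in> P \<and> N \<noteq> M}
     \<union> {(N \<union> M) - E |N M. N \<in> P \<and> M \<in> P \<and> N \<noteq> M}"

text \<open>For \<open>S = {0}\<close> these are the functions that are constant on the blocks. For \<open>S = UNIV\<close> there is one further
  relation, the indicator function of \<open>E\<close>.\<close>

definition split_relations :: "real set \<Rightarrow> 'a set set \<Rightarrow> 'a set \<Rightarrow> ('a \<Rightarrow> real) set" where
  "split_relations S P E =
     {c. \<exists>s\<in>S. \<forall>N\<in>P. \<forall>u\<in>N. \<forall>v\<in>N. c u - s * of_bool (u \<in> E) = c v - s * of_bool (v \<in> E)}"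

lemma split_relationsI:
  "s \<in> S \<Longrightarrow> (\<And>N u v. N \<in> P \<Longrightarrow> u \<in> N \<Longrightarrow> v \<in> N \<Longrightarrow> c u - s * of_bool (u \<in> E) = c v - s * of_bool (v \<in> E))
    \<Longrightarrow> c \<in> split_relations S P E"
  unfolding split_relations_def by blast

lemma split_relationsE:
  assumes "c \<in> split_relations S P E"
  obtains s where "s \<in> S"
    "\<And>N u v. N \<in> P \<Longrightarrow> u \<in> N \<Longrightarrow> v \<in> N \<Longrightarrow> c u - s * of_bool (u \<in> E) = c v - s * of_bool (v \<in> E)"
proof -
  obtain s where "s \<in> S"
    and s: "\<forall>N\<in>P. \<forall>u\<in>N. \<forall>v\<in>N. c u - s * of_bool (u \<in> E) = c v - s * of_bool (v \<in> E)"
    using assms unfolding split_relations_def by blast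
  show thesis by (rule that[OF \<open>s \<in> S\<close>]) (use s in blast)
qed

lemma split_relations_zero: "split_relations {0} P E = split_relations {0} P E'"
  by (simp add: split_relations_def)

lemma avoiding_crossing_iff:
  "\<sigma> \<in> avoiding V (crossing_nonfaces P E) \<longleftrightarrow> \<sigma> \<subseteq> V \<and> (\<forall>N\<in>P. \<not> N \<subseteq> \<sigma>) \<and>
    (\<forall>N\<in>P. \<forall>M\<in>P. N \<noteq> M \<longrightarrow> \<not> (N \<union> M) \<inter> E \<subseteq> \<sigma> \<and> \<not> (N \<union> M) - E \<subseteq> \<sigma>)"
  unfolding avoiding_def crossing_nonfaces_def by blast

lemma partition_block_eq:
  "partition_on V P \<Longrightarrow> N \<in> P \<Longrightarrow> M \<in> P \<Longrightarrow> v \<in> N \<Longrightarrow> v \<in> M \<Longrightarrow> N = M"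
  by (auto simp: partition_on_def disjoint_def)

lemma partition_block_subset: "partition_on V P \<Longrightarrow> N \<in> P \<Longrightarrow> N \<subseteq> V"
  by (auto simp: partition_on_def)

lemma partition_blockE:
  assumes "partition_on V P" "v \<in> V"
  obtains N where "N \<in> P" "v \<in> N"
  using assms by (auto simp: partition_on_def)

lemma partition_subset_eq:
  assumes P: "partition_on V P" and Q: "partition_on V Q" and sub: "P \<subseteq> Q"
  shows "P = Q"
proof
  show "Q \<subseteq> P"
  proof
    fix N assume N: "N \<in> Q"
    then have "N \<noteq> {}" using Q by (auto simp: partition_on_def)
    then obtain v where v: "v \<in> N" by blast
    then have "v \<in> V" using partition_block_subset[OF Q N] by blast
    then obtain M where M: "M \<in> P" "v \<in> M" by (rule partition_blockE[OF P])
    then have "M = N" using partition_block_eq[OF Q _ N M(2) v] sub by blast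
    then show "N \<in> P" using M by simp
  qed
qed (rule sub)

lemma avoiding_pullback:
  assumes V0: "\<Union>(avoiding V0 F0) = V0" and surj: "q ` V = V0" and F0: "\<And>X. X \<in> F0 \<Longrightarrow> X \<subseteq> V0"
  shows "pullback V q (avoiding V0 F0) = avoiding V ((\<lambda>X. {v \<in> V. q v \<in> X}) ` F0)"
proof -
  have "{w \<in> V0. \<forall>v\<in>V. q v = w \<longrightarrow> v \<in> \<sigma>} \<in> avoiding V0 F0 \<longleftrightarrow> (\<forall>X\<in>F0. \<not> {v \<in> V. q v \<in> X} \<subseteq> \<sigma>)" for \<sigma>
  proof -
    define S where "S = {w \<in> V0. \<forall>v\<in>V. q v = w \<longrightarrow> v \<in> \<sigma>}"
    have "X \<subseteq> S \<longleftrightarrow> {v \<in> V. q v \<in> X} \<subseteq> \<sigma>" if "X \<in> F0" for X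
      unfolding S_def using F0[OF that] surj by blast
    moreover have "S \<subseteq> V0" unfolding S_def by blast
    ultimately have "S \<in> avoiding V0 F0 \<longleftrightarrow> (\<forall>X\<in>F0. \<not> {v \<in> V. q v \<in> X} \<subseteq> \<sigma>)"
      by (simp add: avoiding_def)
    then show ?thesis unfolding S_def .
  qed
  then show ?thesis
    unfolding pullback_def V0 by (auto simp: avoiding_def)
qed

text \<open>The half of a block inside \<open>E\<close> is sent to the element inside \<open>E0\<close> of the corresponding pair, the other
  half to the other element.\<close>

lemma bisected_map:
  assumes P: "partition_on V P" "bisects E P" and P0: "partition_on V0 P0" "bisects E0 P0"
    and pairs: "\<And>N. N \<in> P0 \<Longrightarrow> card N = 2" and bij: "bij_betw \<beta> P P0"
  obtains q where "q ` V = V0"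
    "\<And>N v. N \<in> P \<Longrightarrow> v \<in> V \<Longrightarrow> q v \<in> \<beta> N \<longleftrightarrow> v \<in> N"
    "\<And>v. v \<in> V \<Longrightarrow> q v \<in> E0 \<longleftrightarrow> v \<in> E"
    "\<And>u v N. N \<in> P \<Longrightarrow> u \<in> N \<Longrightarrow> v \<in> N \<Longrightarrow> (u \<in> E \<longleftrightarrow> v \<in> E) \<Longrightarrow> q u = q v"
proof -
  have "\<forall>M\<in>P0. \<exists>x y. M = {x, y} \<and> x \<in> E0 \<and> y \<notin> E0"
  proof
    fix M assume M: "M \<in> P0"
    then obtain x y where xy: "x \<in> M" "x \<in> E0" "y \<in> M" "y \<notin> E0"
      using P0(2) unfolding bisects_def by blast
    then have "x \<noteq> y" by blast
    then have "{x, y} = M"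
      using xy pairs[OF M] by (intro card_subset_eq) (auto intro: card_ge_0_finite)
    then show "\<exists>x y. M = {x, y} \<and> x \<in> E0 \<and> y \<notin> E0" using xy by blast
  qed
  then obtain x y where xy: "\<And>M. M \<in> P0 \<Longrightarrow> M = {x M, y M} \<and> x M \<in> E0 \<and> y M \<notin> E0" by metis
  define blk where "blk v = (THE N. N \<in> P \<and> v \<in> N)" for v
  have blk: "blk v = N" if "N \<in> P" "v \<in> N" for N v
    unfolding blk_def by (rule the_equality) (use that partition_block_eq[OF P(1)] in blast)+
  define q where "q v = (if v \<in> E then x (\<beta> (blk v)) else y (\<beta> (blk v)))" for v
  have \<beta>P: "\<beta> N \<in> P0" if "N \<in> P" for N using bij that by (auto simp: bij_betw_def)
  have q_in: "q v \<in> \<beta> N" and q_E: "q v \<in> E0 \<longleftrightarrow> v \<in> E" if N: "N \<in> P" "v \<in> N" for v N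
    using xy[OF \<beta>P[OF N(1)]] blk[OF N] by (auto simp: q_def)
  have mem: "q v \<in> \<beta> N \<longleftrightarrow> v \<in> N" if N: "N \<in> P" and v: "v \<in> V" for N v
  proof
    assume qv: "q v \<in> \<beta> N"
    obtain M where M: "M \<in> P" "v \<in> M" using partition_blockE[OF P(1) v] by blast
    have "\<beta> N = \<beta> M" by (rule partition_block_eq[OF P0(1) \<beta>P[OF N] \<beta>P[OF M(1)] qv q_in[OF M]])
    then have "N = M" using bij N M(1) by (auto simp: bij_betw_def inj_on_eq_iff)
    then show "v \<in> N" using M by simp
  qed (rule q_in[OF N])
  have "q ` V = V0"
  proof (intro equalityI subsetI)
    fix w assume "w \<in> q ` V"
    then obtain v where v: "v \<in> V" "w = q v" by blast
    then obtain N where N: "N \<in> P" "v \<in> N" using partition_blockE[OF P(1)] by blast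
    then show "w \<in> V0" using q_in[OF N] partition_block_subset[OF P0(1) \<beta>P[OF N(1)]] v by blast
  next
    fix w assume w: "w \<in> V0"
    then obtain M where M: "M \<in> P0" "w \<in> M" using partition_blockE[OF P0(1)] by blast
    then obtain N where N: "N \<in> P" "M = \<beta> N" using bij by (auto simp: bij_betw_def)
    obtain u v where uv: "u \<in> N" "u \<in> E" "v \<in> N" "v \<notin> E"
      using P(2) N(1) unfolding bisects_def by blast
    have "w = q u \<or> w = q v"
      using xy[OF M(1)] M(2) blk[OF N(1)] uv N(2) by (auto simp: q_def)
    then show "w \<in> q ` V" using uv partition_block_subset[OF P(1) N(1)] by blast
  qed
  moreover have "q v \<in> E0 \<longleftrightarrow> v \<in> E" if "v \<in> V" for v
    using q_E partition_blockE[OF P(1) that] by metis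
  moreover have "q u = q v" if "N \<in> P" "u \<in> N" "v \<in> N" "u \<in> E \<longleftrightarrow> v \<in> E" for u v N
    using blk[OF that(1)] that by (simp add: q_def)
  ultimately show thesis using mem that by blast
qed

context
  fixes V :: "'a set" and V0 :: "'b set" and P E P0 E0 \<beta> q
  assumes P: "partition_on V P" and P0: "partition_on V0 P0" and bij: "bij_betw \<beta> P P0"
    and surj: "q ` V = V0"
    and mem: "\<And>N v. N \<in> P \<Longrightarrow> v \<in> V \<Longrightarrow> q v \<in> \<beta> N \<longleftrightarrow> v \<in> N"
    and side: "\<And>v. v \<in> V \<Longrightarrow> q v \<in> E0 \<longleftrightarrow> v \<in> E"
    and same: "\<And>u v N. N \<in> P \<Longrightarrow> u \<in> N \<Longrightarrow> v \<in> N \<Longrightarrow> (u \<in> E \<longleftrightarrow> v \<in> E) \<Longrightarrow> q u = q v"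
begin

lemma \<beta>_in: "N \<in> P \<Longrightarrow> \<beta> N \<in> P0"
  using bij by (auto simp: bij_betw_def)

lemma preimage_block: "N \<in> P \<Longrightarrow> {v \<in> V. q v \<in> \<beta> N} = N"
  using mem partition_block_subset[OF P] by blast

lemma preimage_partition: "(\<lambda>X. {v \<in> V. q v \<in> X}) ` P0 = P"
proof -
  have "(\<lambda>X. {v \<in> V. q v \<in> X}) ` \<beta> ` P = P"
    unfolding image_image using preimage_block by auto
  then show ?thesis using bij by (simp add: bij_betw_def)
qed

lemma preimage_crossing:
  "(\<lambda>X. {v \<in> V. q v \<in> X}) ` crossing_nonfaces P0 E0 = crossing_nonfaces P E" (is "?f ` _ = _")
proof -
  have P0_eq: "P0 = \<beta> ` P" and inj: "inj_on \<beta> P" using bij by (auto simp: bij_betw_def)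
  have unions: "?f ` {h0 (N \<union> M) |N M. N \<in> P0 \<and> M \<in> P0 \<and> N \<noteq> M} = {h (N \<union> M) |N M. N \<in> P \<and> M \<in> P \<and> N \<noteq> M}"
    if h: "\<And>N M. N \<in> P \<Longrightarrow> M \<in> P \<Longrightarrow> ?f (h0 (\<beta> N \<union> \<beta> M)) = h (N \<union> M)" for h0 h
  proof (intro equalityI subsetI)
    fix X assume "X \<in> ?f ` {h0 (N \<union> M) |N M. N \<in> P0 \<and> M \<in> P0 \<and> N \<noteq> M}"
    then obtain N M where NM: "N \<in> P" "M \<in> P" "\<beta> N \<noteq> \<beta> M" "X = ?f (h0 (\<beta> N \<union> \<beta> M))"
      unfolding P0_eq by blast
    then have "X = h (N \<union> M)" "N \<noteq> M" using h[OF NM(1,2)] by auto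
    then show "X \<in> {h (N \<union> M) |N M. N \<in> P \<and> M \<in> P \<and> N \<noteq> M}" using NM(1,2) by blast
  next
    fix X assume "X \<in> {h (N \<union> M) |N M. N \<in> P \<and> M \<in> P \<and> N \<noteq> M}"
    then obtain N M where NM: "N \<in> P" "M \<in> P" "N \<noteq> M" "X = h (N \<union> M)" by blast
    then have "\<beta> N \<noteq> \<beta> M" using inj by (simp add: inj_on_eq_iff)
    then have "h0 (\<beta> N \<union> \<beta> M) \<in> {h0 (N \<union> M) |N M. N \<in> P0 \<and> M \<in> P0 \<and> N \<noteq> M}"
      using \<beta>_in NM by blast
    then show "X \<in> ?f ` {h0 (N \<union> M) |N M. N \<in> P0 \<and> M \<in> P0 \<and> N \<noteq> M}"
      using h[OF NM(1,2)] NM(4) by (intro image_eqI) auto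
  qed
  have "?f ` {(N \<union> M) \<inter> E0 |N M. N \<in> P0 \<and> M \<in> P0 \<and> N \<noteq> M} = {(N \<union> M) \<inter> E |N M. N \<in> P \<and> M \<in> P \<and> N \<noteq> M}"
    by (rule unions[of "\<lambda>X. X \<inter> E0" "\<lambda>X. X \<inter> E"]) (use mem side partition_block_subset[OF P] in blast)
  moreover have "?f ` {(N \<union> M) - E0 |N M. N \<in> P0 \<and> M \<in> P0 \<and> N \<noteq> M} = {(N \<union> M) - E |N M. N \<in> P \<and> M \<in> P \<and> N \<noteq> M}"
    by (rule unions[of "\<lambda>X. X - E0" "\<lambda>X. X - E"]) (use mem side partition_block_subset[OF P] in blast)
  ultimately show ?thesis
    unfolding crossing_nonfaces_def image_Un preimage_partition by simp
qed

lemma pull_split_relations: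
  "pull_relations V q (split_relations S P0 E0) = split_relations S P E"
proof (intro equalityI subsetI)
  fix c assume "c \<in> pull_relations V q (split_relations S P0 E0)"
  then obtain y where y0: "y \<in> split_relations S P0 E0" and y: "\<And>v. v \<in> V \<Longrightarrow> c v = y (q v)"
    unfolding pull_relations_def by blast
  obtain s where s: "s \<in> S"
    "\<And>N u v. N \<in> P0 \<Longrightarrow> u \<in> N \<Longrightarrow> v \<in> N \<Longrightarrow> y u - s * of_bool (u \<in> E0) = y v - s * of_bool (v \<in> E0)"
    using split_relationsE[OF y0] by blast
  show "c \<in> split_relations S P E"
  proof (rule split_relationsI[OF s(1)])
    fix N u v assume N: "N \<in> P" "u \<in> N" "v \<in> N"
    then have V: "u \<in> V" "v \<in> V" using partition_block_subset[OF P] by auto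
    show "c u - s * of_bool (u \<in> E) = c v - s * of_bool (v \<in> E)"
      using s(2)[OF \<beta>_in[OF N(1)], of "q u" "q v"] mem[OF N(1)] V N y side by simp
  qed
next
  fix c assume c: "c \<in> split_relations S P E"
  obtain s where s: "s \<in> S"
    "\<And>N u v. N \<in> P \<Longrightarrow> u \<in> N \<Longrightarrow> v \<in> N \<Longrightarrow> c u - s * of_bool (u \<in> E) = c v - s * of_bool (v \<in> E)"
    using split_relationsE[OF c] by blast
  define y where "y w = c (inv_into V q w)" for w
  have inv: "inv_into V q w \<in> V" "q (inv_into V q w) = w" if "w \<in> V0" for w
    using that surj by (auto simp: inv_into_into f_inv_into_f)
  have yq: "c v = y (q v)" if v: "v \<in> V" for v
  proof -
    let ?u = "inv_into V q (q v)"
    have u: "?u \<in> V" "q ?u = q v" using inv[of "q v"] v surj by auto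
    obtain N where N: "N \<in> P" "v \<in> N" using partition_blockE[OF P v] by blast
    have "?u \<in> N" using mem[OF N(1) u(1)] mem[OF N(1) v] N(2) u(2) by simp
    moreover have "?u \<in> E \<longleftrightarrow> v \<in> E" using side[OF u(1)] side[OF v] u(2) by simp
    ultimately show ?thesis using s(2)[OF N(1) N(2), of ?u] by (simp add: y_def)
  qed
  have "y \<in> split_relations S P0 E0"
  proof (rule split_relationsI[OF s(1)])
    fix M u v assume M: "M \<in> P0" "u \<in> M" "v \<in> M"
    then obtain N where N: "N \<in> P" "M = \<beta> N" using bij by (auto simp: bij_betw_def)
    have V0: "u \<in> V0" "v \<in> V0" using partition_block_subset[OF P0 M(1)] M by auto
    show "y u - s * of_bool (u \<in> E0) = y v - s * of_bool (v \<in> E0)"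
      using s(2)[OF N(1), of "inv_into V q u" "inv_into V q v"] mem[OF N(1) inv(1)[OF V0(1)]]
        mem[OF N(1) inv(1)[OF V0(2)]] side[OF inv(1)[OF V0(1)]] side[OF inv(1)[OF V0(2)]]
        inv(2)[OF V0(1)] inv(2)[OF V0(2)] M N
      by (simp add: y_def)
  qed
  then show "c \<in> pull_relations V q (split_relations S P0 E0)"
    using yq unfolding pull_relations_def by blast
qed

end

section \<open>Fans with an optimal partition\<close>

locale optimal_fan =
  fixes K :: "'a set set" and lam :: "'a \<Rightarrow> int vec" and P :: "'a set set"
  assumes absK: "abstract_complex K" and fan: "fan_giving K lam" and opt: "optimal_partition K lam P"
begin

abbreviation "V \<equiv> \<Union>K"
abbreviation "n \<equiv> cdim K"
abbreviation "R \<equiv> relations n V lam"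

lemmas finV = abstract_complexD(1)[OF absK]
lemmas down = abstract_complexD(3)[OF absK]
lemmas coords = fan_giving_unique_coordinates[OF absK fan]
lemmas same_coordinates = unique_coordinates_unique[OF coords]

lemma char: "char_map K lam"
  using fan by (simp add: fan_giving_def)

lemma part: "partition_on V P"
  using opt by (simp add: optimal_partition_def)

lemmas block_eq = partition_block_eq[OF part]
lemmas block_sub = partition_block_subset[OF part]

lemma blockE:
  assumes "v \<in> V"
  obtains N where "N \<in> P" "v \<in> N"
  using partition_blockE[OF part assms] by blast

lemma finP: "finite P"
  using finite_elements[OF finV part] .

lemma block_nonface: "N \<in> P \<Longrightarrow> N \<notin> K" and block_proper: "N \<in> P \<Longrightarrow> \<sigma> \<subset> N \<Longrightarrow> \<sigma> \<in> K"
  using opt by (auto simp: optimal_partition_def minimal_nonface_def)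

lemma block_nonempty: "N \<in> P \<Longrightarrow> N \<noteq> {}"
  using block_nonface abstract_complexD(2)[OF absK] by blast

lemma fin_block: "N \<in> P \<Longrightarrow> finite N"
  using block_sub finV finite_subset by blast

lemma face_sub: "\<sigma> \<in> K \<Longrightarrow> \<sigma> \<subseteq> V"
  by blast

lemma block_not_in_face: "N \<in> P \<Longrightarrow> \<sigma> \<in> K \<Longrightarrow> \<exists>v\<in>N. v \<notin> \<sigma>"
  using block_nonface down by blast

lemma block_relation: "N \<in> P \<Longrightarrow> (\<lambda>v. of_bool (v \<in> N)) \<in> R"
  using sum_zero_indicator[OF block_sub finV] opt by (auto simp: optimal_partition_def)

lemma blockwise_relation:
  assumes "\<And>N v. N \<in> P \<Longrightarrow> v \<in> N \<Longrightarrow> c v = k N"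
  shows "c \<in> R"
proof -
  have "(\<lambda>v. \<Sum>N\<in>P. k N * of_bool (v \<in> N)) \<in> R"
    by (intro relations_sum relations_scale block_relation)
  moreover have "c v = (\<Sum>N\<in>P. k N * of_bool (v \<in> N))" if v: "v \<in> V" for v
  proof -
    obtain N where N: "N \<in> P" "v \<in> N" using v by (rule blockE)
    have "(\<Sum>M\<in>P. k M * of_bool (v \<in> M)) = (\<Sum>M\<in>P. if M = N then k M else 0)"
      by (rule sum.cong) (use N block_eq in \<open>auto simp: of_bool_def\<close>)
    then show ?thesis using assms[OF N] finP N by simp
  qed
  ultimately show ?thesis by (rule relations_cong[THEN iffD2, rotated])
qed

lemma coordinates_exist:
  obtains c where "cone_coordinates K c" "(\<lambda>v. c v - f v) \<in> R"
proof -
  obtain c where c: "cone_coordinates K c"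
    "\<forall>j<n. comb V lam c j = comb V lam f j"
    using unique_coordinates_ex[OF coords, of "\<lambda>j. comb V lam f j"] by blast
  then have "(\<lambda>v. c v - f v) \<in> R" by (simp add: relations_def left_diff_distrib sum_subtractf)
  then show thesis by (rule that[OF c(1)])
qed

text \<open>Every block contains a zero of \<open>c\<close>, since it is not a face, and a point outside \<open>\<rho>\<close>. Two non-negative
  functions that differ by a constant on a block and both have a zero there agree on it.\<close>

lemma face_of_blockwise_shift:
  assumes c: "cone_coordinates K c" and \<rho>: "\<rho> \<subseteq> V" "\<And>N. N \<in> P \<Longrightarrow> \<exists>y\<in>N. y \<notin> \<rho>"
    and shift: "\<And>N u v. N \<in> P \<Longrightarrow> u \<in> N \<Longrightarrow> v \<in> N \<Longrightarrow> c u - of_bool (u \<in> \<rho>) = c v - of_bool (v \<in> \<rho>)"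
  shows "\<rho> \<in> K"
proof -
  have nn: "0 \<le> c v" for v using c by (simp add: cone_coordinates_def)
  have cK: "{v. c v \<noteq> 0} \<in> K" using c by (simp add: cone_coordinates_def)
  have cf: "c v = of_bool (v \<in> \<rho>)" if N: "N \<in> P" "v \<in> N" for N v
  proof -
    obtain z where z: "z \<in> N" "c z = 0" using block_not_in_face[OF N(1) cK] by auto
    obtain y where y: "y \<in> N" "y \<notin> \<rho>" using \<rho>(2)[OF N(1)] by blast
    have "c z - of_bool (z \<in> \<rho>) = c y" "c v - of_bool (v \<in> \<rho>) = c y"
      using shift[OF N(1) z(1) y(1)] shift[OF N y(1)] y(2) by auto
    moreover have "0 \<le> (of_bool (z \<in> \<rho>) :: real)" by simp
    ultimately show ?thesis using z(2) nn[of y] by linarith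
  qed
  have on: "v \<in> {v. c v \<noteq> 0} \<longleftrightarrow> v \<in> \<rho>" if v: "v \<in> V" for v
  proof -
    obtain N where "N \<in> P" "v \<in> N" using v by (rule blockE)
    from cf[OF this] show ?thesis by simp
  qed
  have "{v. c v \<noteq> 0} = \<rho>" using on \<rho>(1) face_sub[OF cK] by blast
  then show ?thesis using cK by simp
qed

text \<open>The spans of two blocks meet only in \<open>0\<close>. For if a relation is constant on each block other than \<open>A\<close>
  and \<open>B\<close>, its part on \<open>A\<close> defines a vector that has non-negative coordinates on a proper part of \<open>A\<close>, after
  subtraction of the minimum, and others on a proper part of \<open>B\<close>, by subtraction from the maximum.
  Proper parts of blocks are faces, so by uniqueness both coordinate functions vanish.\<close>

lemma constant_on_block:
  assumes c: "c \<in> R" and A: "A \<in> P" and B: "B \<in> insert {} P" "A \<noteq> B"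
    and const: "\<And>N u v. N \<in> P \<Longrightarrow> N \<noteq> A \<Longrightarrow> N \<noteq> B \<Longrightarrow> u \<in> N \<Longrightarrow> v \<in> N \<Longrightarrow> c u = c v"
    and uv: "u \<in> A" "v \<in> A"
  shows "c u = c v"
proof -
  define f where "f v = (if v \<in> A then c v - Min (c ` A) else 0)" for v
  define g where "g v = (if v \<in> B then Max (c ` B) - c v else 0)" for v
  have finA: "finite (c ` A)" "c ` A \<noteq> {}" using A fin_block block_nonempty by auto
  have finB: "finite (c ` B)" using B fin_block by auto
  have disj: "A \<inter> B = {}" using A B block_eq by blast
  obtain a where a: "a \<in> A" "c a = Min (c ` A)" using Min_in[OF finA] by auto
  have f: "cone_coordinates K f"
    unfolding cone_coordinates_def
  proof
    show "\<forall>v. 0 \<le> f v" using finA by (auto simp: f_def)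
    have "{v. f v \<noteq> 0} \<subset> A" using a by (auto simp: f_def)
    then show "{v. f v \<noteq> 0} \<in> K" by (rule block_proper[OF A])
  qed
  have g: "cone_coordinates K g"
    unfolding cone_coordinates_def
  proof
    show "\<forall>v. 0 \<le> g v" using finB by (auto simp: g_def)
    show "{v. g v \<noteq> 0} \<in> K"
    proof (cases "B = {}")
      case True
      then have "{v. g v \<noteq> 0} = {}" by (auto simp: g_def)
      then show ?thesis using abstract_complexD(2)[OF absK] by simp
    next
      case False
      then have "B \<in> P" using B by blast
      have "Max (c ` B) \<in> c ` B" by (rule Max_in) (use finB False in auto)
      then obtain b where "b \<in> B" "c b = Max (c ` B)" by (metis imageE)
      then have "{v. g v \<noteq> 0} \<subseteq> B - {b}" "b \<in> B" by (auto simp: g_def)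
      then have "{v. g v \<noteq> 0} \<subset> B" by blast
      then show ?thesis by (rule block_proper[OF \<open>B \<in> P\<close>])
    qed
  qed
  \<comment> \<open>The constants to be split off; on the remaining blocks \<open>c\<close> is constant, and any element gives its value.\<close>
  define k where "k N = (if N = A then Min (c ` A) else if N = B then Max (c ` B) else c (SOME v. v \<in> N))" for N
  have "(\<lambda>v. c v - (f v - g v)) \<in> R"
  proof (rule blockwise_relation[where k = k])
    fix N v assume N: "N \<in> P" "v \<in> N"
    have some: "(SOME v. v \<in> N) \<in> N" using N by (rule_tac someI)
    consider "N = A" | "N = B" "N \<noteq> A" | "N \<noteq> A" "N \<noteq> B" by blast
    then show "c v - (f v - g v) = k N"
    proof cases
      case 3
      then have "v \<notin> A" "v \<notin> B" using N A B block_eq by blast+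
      then show ?thesis using 3 const[OF N(1) 3 N(2) some] by (simp add: f_def g_def k_def)
    qed (use N disj in \<open>auto simp: f_def g_def k_def\<close>)
  qed
  from relations_diff[OF c this] have "(\<lambda>v. f v - g v) \<in> R" by simp
  then have "f = g" by (rule same_coordinates[OF f g])
  then have "f u = 0" "f v = 0" using uv disj by (auto simp: g_def)
  then show ?thesis using uv by (simp add: f_def)
qed

lemma facet_exists:
  obtains \<tau> where "\<tau> \<in> K" "card \<tau> = n" "unimodular n lam \<tau>"
proof -
  have "finite K" using finV finite_UnionD by blast
  then have "Max (card ` K) \<in> card ` K"
    using abstract_complexD(2)[OF absK] by (intro Max_in) auto
  then obtain \<tau> where "\<tau> \<in> K" "card \<tau> = n" by (auto simp: cdim_def)
  then show thesis using that char_map_unimodular[OF char] by blast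
qed

lemma picard_card: "\<tau> \<in> K \<Longrightarrow> card \<tau> = n \<Longrightarrow> picard K = int (card (V - \<tau>))"
  using card_Diff_subset[of \<tau> V] card_mono[of V \<tau>] finV face_sub[of \<tau>] finite_subset[of \<tau> V]
  by (simp add: picard_def of_nat_diff)

lemma card_facet: "\<sigma> \<subseteq> V \<Longrightarrow> card (V - \<sigma>) = nat (picard K) \<Longrightarrow> card \<sigma> = n"
proof -
  assume \<sigma>: "\<sigma> \<subseteq> V" and c: "card (V - \<sigma>) = nat (picard K)"
  obtain \<tau> where \<tau>: "\<tau> \<in> K" "card \<tau> = n" using facet_exists by blast
  have "card (V - \<sigma>) = card (V - \<tau>)" using c picard_card[OF \<tau>] by simp
  moreover have "card (V - \<sigma>) + card \<sigma> = card V" if "\<sigma> \<subseteq> V" for \<sigma>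
    using card_Diff_subset[of \<sigma> V] card_mono[of V \<sigma>] that finV finite_subset[of \<sigma> V] by simp
  ultimately show "card \<sigma> = n" using \<tau> \<sigma> face_sub[OF \<tau>(1)] by (metis add_left_cancel)
qed

lemma unimodular_complexI:
  assumes "\<And>\<sigma>. \<sigma> \<in> K \<Longrightarrow> \<exists>\<tau>\<in>K. \<sigma> \<subseteq> \<tau> \<and> card \<tau> = n"
  shows "unimodular_complex K lam"
  unfolding unimodular_complex_def
proof (intro conjI ballI absK)
  show "lam v \<in> carrier_vec n" if "v \<in> V" for v
    using char that by (auto simp: char_map_def)
  show "\<exists>\<tau>\<in>K. \<sigma> \<subseteq> \<tau> \<and> unimodular n lam \<tau>" if "\<sigma> \<in> K" for \<sigma>
    using assms[OF that] char_map_unimodular[OF char] by blast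
qed

text \<open>A facet misses a vertex of each block, and the number of vertices that it misses is the Picard number.\<close>

lemma card_blocks_le: "int (card P) \<le> picard K"
proof -
  obtain \<tau> where \<tau>: "\<tau> \<in> K" "card \<tau> = n" using facet_exists by blast
  have "\<forall>N\<in>P. \<exists>v\<in>N. v \<notin> \<tau>" using block_not_in_face \<tau> by blast
  then obtain t where t: "\<And>N. N \<in> P \<Longrightarrow> t N \<in> N \<and> t N \<notin> \<tau>" by metis
  have "inj_on t P" using t block_eq by (metis inj_onI)
  moreover have "t ` P \<subseteq> V - \<tau>" using t block_sub by blast
  ultimately have "card P \<le> card (V - \<tau>)" using card_inj_on_le finV by blast
  then show ?thesis using picard_card[OF \<tau>] by simp
qed

text \<open>If a facet misses exactly one vertex of each block, a relation is determined by one value per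
  block, so it is constant on the blocks. Then the fan is that of a product of projective spaces.\<close>

lemma product_case:
  assumes l: "int (card P) = picard K"
  shows "K = avoiding V P" "R = split_relations {0} P E" "unimodular_complex K lam"
proof -
  obtain \<tau> where \<tau>: "\<tau> \<in> K" "card \<tau> = n" and un: "unimodular n lam \<tau>" using facet_exists by blast
  have "\<forall>N\<in>P. \<exists>v\<in>N. v \<notin> \<tau>" using block_not_in_face \<tau> by blast
  then obtain t where t: "\<And>N. N \<in> P \<Longrightarrow> t N \<in> N \<and> t N \<notin> \<tau>" by metis
  have "inj_on t P" using t block_eq by (metis inj_onI)
  then have "card (t ` P) = card (V - \<tau>)" using l picard_card[OF \<tau>] by (simp add: card_image)
  moreover have "t ` P \<subseteq> V - \<tau>" using t block_sub by blast
  ultimately have T: "t ` P = V - \<tau>" using finV by (intro card_subset_eq) auto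
  have rel: "c v = c (t N)" if c: "c \<in> R" and N: "N \<in> P" "v \<in> N" for c N v
  proof -
    define k where "k v = (\<Sum>M\<in>P. c (t M) * of_bool (v \<in> M))" for v
    have k: "k v = c (t N)" if "N \<in> P" "v \<in> N" for N v
    proof -
      have "k v = (\<Sum>M\<in>P. if M = N then c (t M) else 0)"
        unfolding k_def by (rule sum.cong) (use that block_eq in \<open>auto simp: of_bool_def\<close>)
      then show ?thesis using finP that by simp
    qed
    have kR: "k \<in> R" by (rule blockwise_relation[where k = "\<lambda>N. c (t N)"]) (rule k)
    have "c v - k v = 0"
    proof (rule unimodular_relation_zero[OF un face_sub[OF \<tau>(1)] finV relations_diff[OF c kR]])
      show "c u - k u = 0" if "u \<in> V - \<tau>" for u
        using that k t unfolding T[symmetric] by auto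
      show "v \<in> V" using N block_sub by blast
    qed
    then show ?thesis using k[OF N] by simp
  qed
  show R: "R = split_relations {0} P E"
  proof (intro equalityI subsetI)
    fix c assume c: "c \<in> R"
    show "c \<in> split_relations {0} P E"
      by (rule split_relationsI[of 0]) (use rel[OF c] in auto)
  next
    fix c assume c: "c \<in> split_relations {0} P E"
    obtain s where s: "s \<in> {0 :: real}" "\<And>N u v. N \<in> P \<Longrightarrow> u \<in> N \<Longrightarrow> v \<in> N \<Longrightarrow>
        c u - s * of_bool (u \<in> E) = c v - s * of_bool (v \<in> E)"
      using split_relationsE[OF c] by blast
    show "c \<in> R"
    proof (rule blockwise_relation[where k = "\<lambda>N. c (t N)"])
      show "c v = c (t N)" if "N \<in> P" "v \<in> N" for N v
        using s(2)[OF that(1,2), of "t N"] s(1) t[OF that(1)] by simp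
    qed
  qed
  have sub: "\<exists>\<rho>\<in>K. \<sigma> \<subseteq> \<rho> \<and> card \<rho> = n" if \<sigma>: "\<sigma> \<in> avoiding V P" for \<sigma>
  proof -
    have "\<forall>N\<in>P. \<exists>v\<in>N. v \<notin> \<sigma>" using \<sigma> by (auto simp: avoiding_def)
    then obtain m where m: "\<And>N. N \<in> P \<Longrightarrow> m N \<in> N \<and> m N \<notin> \<sigma>" by metis
    define \<rho> where "\<rho> = V - m ` P"
    obtain c where c: "cone_coordinates K c" "(\<lambda>v. c v - of_bool (v \<in> \<rho>)) \<in> R"
      by (rule coordinates_exist)
    have "\<rho> \<in> K"
    proof (rule face_of_blockwise_shift[OF c(1)])
      show "\<exists>y\<in>N. y \<notin> \<rho>" if "N \<in> P" for N using m[OF that] that by (auto simp: \<rho>_def)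
      show "c u - of_bool (u \<in> \<rho>) = c v - of_bool (v \<in> \<rho>)" if "N \<in> P" "u \<in> N" "v \<in> N" for N u v
        using rel[OF c(2) that(1,2)] rel[OF c(2) that(1,3)] by simp
    qed (simp add: \<rho>_def)
    moreover have "\<sigma> \<subseteq> \<rho>" using \<sigma> m by (auto simp: \<rho>_def avoiding_def)
    moreover have "card \<rho> = n"
    proof (rule card_facet)
      have "inj_on m P" using m block_eq by (metis inj_onI)
      moreover have "V - \<rho> = m ` P" using m block_sub by (auto simp: \<rho>_def)
      ultimately show "card (V - \<rho>) = nat (picard K)" using l by (metis card_image nat_int)
    qed (simp add: \<rho>_def)
    ultimately show ?thesis by blast
  qed
  show av: "K = avoiding V P"
  proof (intro equalityI subsetI)
    fix \<sigma> assume "\<sigma> \<in> K"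
    then show "\<sigma> \<in> avoiding V P" using block_nonface down by (auto simp: avoiding_def)
  next
    fix \<sigma> assume "\<sigma> \<in> avoiding V P"
    then show "\<sigma> \<in> K" using sub down by blast
  qed
  show "unimodular_complex K lam"
    by (rule unimodular_complexI) (use sub av in blast)
qed

text \<open>Up to constants, \<open>r\<close> equates a vector with coordinates on \<open>B \<union> C\<close>, namely \<open>r\<close> minus lower bounds, and one with
  coordinates on a proper part of \<open>A\<close>. The latter is a face, so the former cannot be one.\<close>

lemma lower_nonface:
  assumes r: "r \<in> R" and P: "P = {A, B, C}" and dist: "A \<noteq> B" "A \<noteq> C" "B \<noteq> C"
    and nc: "\<exists>u\<in>A. \<exists>v\<in>A. r u \<noteq> r v"
    and lb: "\<And>v. v \<in> B \<Longrightarrow> \<beta> \<le> r v" "\<And>v. v \<in> C \<Longrightarrow> \<gamma> \<le> r v"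
  shows "{v \<in> B. r v \<noteq> \<beta>} \<union> {v \<in> C. r v \<noteq> \<gamma>} \<notin> K"
proof
  assume face: "{v \<in> B. r v \<noteq> \<beta>} \<union> {v \<in> C. r v \<noteq> \<gamma>} \<in> K"
  have AP: "A \<in> P" "B \<in> P" "C \<in> P" using P by auto
  have disj: "A \<inter> B = {}" "A \<inter> C = {}" "B \<inter> C = {}" using AP dist block_eq by blast+
  define f where "f v = (if v \<in> B then r v - \<beta> else if v \<in> C then r v - \<gamma> else 0)" for v
  define g where "g v = (if v \<in> A then Max (r ` A) - r v else 0)" for v
  have finA: "finite (r ` A)" "r ` A \<noteq> {}" using AP fin_block block_nonempty by auto
  obtain a where a: "a \<in> A" "r a = Max (r ` A)" using Max_in[OF finA] by auto
  have f: "cone_coordinates K f"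
  proof -
    have "{v. f v \<noteq> 0} = {v \<in> B. r v \<noteq> \<beta>} \<union> {v \<in> C. r v \<noteq> \<gamma>}" using disj by (auto simp: f_def)
    then show ?thesis using face lb by (auto simp: cone_coordinates_def f_def)
  qed
  have g: "cone_coordinates K g"
  proof -
    have "{v. g v \<noteq> 0} \<subseteq> A - {a}" using a by (auto simp: g_def)
    then have "{v. g v \<noteq> 0} \<subset> A" using a(1) by blast
    then have "{v. g v \<noteq> 0} \<in> K" by (rule block_proper[OF AP(1)])
    then show ?thesis using finA by (auto simp: cone_coordinates_def g_def)
  qed
  have "(\<lambda>v. r v - (f v - g v)) \<in> R"
  proof (rule blockwise_relation)
    fix N v assume N: "N \<in> P" "v \<in> N"
    then consider "N = A" "v \<in> A" "v \<notin> B" "v \<notin> C" | "N = B" "v \<in> B" "v \<notin> A"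
      | "N = C" "v \<in> C" "v \<notin> A" "v \<notin> B"
      using P disj by blast
    then show "r v - (f v - g v) = (if N = A then Max (r ` A) else if N = B then \<beta> else \<gamma>)"
      by cases (use dist in \<open>simp_all add: f_def g_def\<close>)
  qed
  from relations_diff[OF r this] have "(\<lambda>v. f v - g v) \<in> R" by simp
  then have "f = g" by (rule same_coordinates[OF f g])
  have "g v = 0" if v: "v \<in> A" for v
  proof -
    have "v \<notin> B" "v \<notin> C" using v disj by blast+
    then have "f v = 0" by (simp add: f_def)
    then show ?thesis using \<open>f = g\<close> by simp
  qed
  then have "r v = Max (r ` A)" if "v \<in> A" for v using that by (auto simp: g_def)
  then show False using nc by auto
qed

lemma upper_nonface:
  assumes r: "r \<in> R" and P: "P = {A, B, C}" and dist: "A \<noteq> B" "A \<noteq> C" "B \<noteq> C"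
    and nc: "\<exists>u\<in>A. \<exists>v\<in>A. r u \<noteq> r v"
    and ub: "\<And>v. v \<in> B \<Longrightarrow> r v \<le> \<beta>" "\<And>v. v \<in> C \<Longrightarrow> r v \<le> \<gamma>"
  shows "{v \<in> B. r v \<noteq> \<beta>} \<union> {v \<in> C. r v \<noteq> \<gamma>} \<notin> K"
proof -
  have "(\<lambda>v. - r v) \<in> R" using relations_scale[OF r, of "- 1"] by simp
  from lower_nonface[OF this P dist, of "- \<beta>" "- \<gamma>"] show ?thesis using nc ub by auto
qed

text \<open>Write the sum of the vectors of \<open>\<rho>\<close>, the set in question, in coordinates \<open>c\<close> supported on a face. Then \<open>c\<close> is
  the indicator of \<open>\<rho>\<close> plus \<open>s * r\<close>, up to constants. For \<open>s > 0\<close> the function \<open>s * r\<close> is smallest on \<open>A\<close> and \<open>B\<close> at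
  points outside \<open>\<rho>\<close>, so the support of \<open>c\<close> contains all points of \<open>A \<union> B\<close> with a non-minimal value of \<open>r\<close>; for
  \<open>s < 0\<close> it contains all points of \<open>B \<union> C\<close> with a non-maximal value. Neither set is a face. So \<open>s = 0\<close>.\<close>

lemma crossing_facet:
  assumes r: "r \<in> R" and P: "P = {A, B, C}" and dist: "A \<noteq> B" "A \<noteq> C" "B \<noteq> C"
    and span: "\<And>c. c \<in> R \<Longrightarrow> \<exists>s. \<forall>N\<in>P. \<forall>u\<in>N. \<forall>v\<in>N. c u - s * r u = c v - s * r v"
    and nc: "\<And>N. N \<in> P \<Longrightarrow> \<exists>u\<in>N. \<exists>v\<in>N. r u \<noteq> r v"
    and a: "a \<in> A" "\<And>v. v \<in> A \<Longrightarrow> r a \<le> r v"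
    and b0: "b0 \<in> B" "\<And>v. v \<in> B \<Longrightarrow> r b0 \<le> r v"
    and b1: "b1 \<in> B" "\<And>v. v \<in> B \<Longrightarrow> r v \<le> r b1"
    and c1: "c1 \<in> C" "\<And>v. v \<in> C \<Longrightarrow> r v \<le> r c1"
  shows "V - {a, b0, b1, c1} \<in> K"
proof -
  have AP: "A \<in> P" "B \<in> P" "C \<in> P" using P by auto
  define \<rho> where "\<rho> = V - {a, b0, b1, c1}"
  define f where "f v = (of_bool (v \<in> \<rho>) :: real)" for v
  have fnn: "0 \<le> f v" for v by (simp add: f_def)
  have f0: "f a = 0" "f b0 = 0" "f b1 = 0" "f c1 = 0" by (auto simp: f_def \<rho>_def)
  obtain c where c: "cone_coordinates K c" and "(\<lambda>v. c v - f v) \<in> R"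
    by (rule coordinates_exist)
  have nn: "0 \<le> c v" for v using c by (simp add: cone_coordinates_def)
  have cK: "{v. c v \<noteq> 0} \<in> K" using c by (simp add: cone_coordinates_def)
  from span[OF \<open>(\<lambda>v. c v - f v) \<in> R\<close>] obtain s where
    "\<forall>N\<in>P. \<forall>u\<in>N. \<forall>v\<in>N. c u - f u - s * r u = c v - f v - s * r v" by blast
  then have s: "c u - f u - s * r u = c v - f v - s * r v" if "N \<in> P" "u \<in> N" "v \<in> N" for N u v
    using that by blast
  have pos: "c v \<noteq> 0" if "N \<in> P" "z \<in> N" "v \<in> N" "f z = 0" "s * r z < s * r v" for N z v
  proof -
    have "c v = f v + s * (r v - r z) + c z" using s[OF that(1,3,2)] that(4) by (simp add: algebra_simps)
    then show ?thesis using fnn[of v] nn[of z] that(5) by (simp add: right_diff_distrib)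
  qed
  have "\<not> 0 < s"
  proof
    assume s0: "0 < s"
    have "c v \<noteq> 0" if "v \<in> A" "r v \<noteq> r a" for v
      by (rule pos[OF AP(1) a(1) that(1) f0(1)]) (use s0 a(2)[OF that(1)] that(2) in simp)
    moreover have "c v \<noteq> 0" if "v \<in> B" "r v \<noteq> r b0" for v
      by (rule pos[OF AP(2) b0(1) that(1) f0(2)]) (use s0 b0(2)[OF that(1)] that(2) in simp)
    ultimately have "{v \<in> A. r v \<noteq> r a} \<union> {v \<in> B. r v \<noteq> r b0} \<subseteq> {v. c v \<noteq> 0}" by blast
    then have "{v \<in> A. r v \<noteq> r a} \<union> {v \<in> B. r v \<noteq> r b0} \<in> K" by (rule down[OF cK])
    moreover have "{v \<in> A. r v \<noteq> r a} \<union> {v \<in> B. r v \<noteq> r b0} \<notin> K"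
      by (rule lower_nonface[OF r, of C]) (use P dist nc[OF AP(3)] a b0 in auto)
    ultimately show False by blast
  qed
  moreover have "\<not> s < 0"
  proof
    assume s0: "s < 0"
    have "c v \<noteq> 0" if "v \<in> B" "r v \<noteq> r b1" for v
      by (rule pos[OF AP(2) b1(1) that(1) f0(3)]) (use s0 b1(2)[OF that(1)] that(2) in simp)
    moreover have "c v \<noteq> 0" if "v \<in> C" "r v \<noteq> r c1" for v
      by (rule pos[OF AP(3) c1(1) that(1) f0(4)]) (use s0 c1(2)[OF that(1)] that(2) in simp)
    ultimately have "{v \<in> B. r v \<noteq> r b1} \<union> {v \<in> C. r v \<noteq> r c1} \<subseteq> {v. c v \<noteq> 0}" by blast
    then have "{v \<in> B. r v \<noteq> r b1} \<union> {v \<in> C. r v \<noteq> r c1} \<in> K" by (rule down[OF cK])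
    moreover have "{v \<in> B. r v \<noteq> r b1} \<union> {v \<in> C. r v \<noteq> r c1} \<notin> K"
      by (rule upper_nonface[OF r, of A]) (use P dist nc[OF AP(1)] b1 c1 in auto)
    ultimately show False by blast
  qed
  ultimately have s0: "s = 0" by simp
  have "\<rho> \<in> K"
  proof (rule face_of_blockwise_shift[OF c])
    show "\<exists>y\<in>N. y \<notin> \<rho>" if "N \<in> P" for N
      using that P a(1) b0(1) c1(1) by (auto simp: \<rho>_def)
    show "c u - of_bool (u \<in> \<rho>) = c v - of_bool (v \<in> \<rho>)" if "N \<in> P" "u \<in> N" "v \<in> N" for N u v
      using s[OF that] s0 by (simp add: f_def)
  qed (simp add: \<rho>_def)
  then show ?thesis by (simp add: \<rho>_def)
qed

section \<open>Three blocks and Picard number four\<close>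

lemma third_block:
  assumes "card P = 3" "N \<in> P" "M \<in> P" "N \<noteq> M"
  obtains L where "L \<in> P" "L \<noteq> N" "L \<noteq> M" "P = {L, N, M}"
proof -
  have "card (P - {N, M}) = 1" using assms finP by (subst card_Diff_subset) auto
  then obtain L where "P - {N, M} = {L}" by (auto simp: card_1_singleton_iff)
  then show thesis using that[of L] assms by blast
qed

lemma block_card: "\<forall>N\<in>P. 2 \<le> card N"
proof
  fix N assume N: "N \<in> P"
  show "2 \<le> card N"
  proof (rule ccontr)
    assume "\<not> 2 \<le> card N"
    then have "card N = 1" using block_nonempty[OF N] fin_block[OF N] by (cases "card N") auto
    then obtain v where "N = {v}" by (auto simp: card_1_singleton_iff)
    moreover then have "v \<in> V" using block_sub[OF N] by blast
    ultimately show False using abstract_complex_vertex[OF absK] block_nonface[OF N] by blast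
  qed
qed

lemma card_vertices: "card V = (\<Sum>N\<in>P. card N)"
proof -
  have "card (\<Union>P) = sum card P"
    by (rule card_Union_disjoint) (use part fin_block in \<open>auto simp: partition_on_def disjoint_def pairwise_def disjnt_def\<close>)
  then show ?thesis using part by (simp add: partition_on_def)
qed

text \<open>If there are fewer blocks than the Picard number, a facet misses two vertices \<open>x\<close> and \<open>x'\<close> of one block,
  and there is a relation \<open>\<rho>\<close> that separates them. By \<open>constant_on_block\<close> it is non-constant on at least three
  blocks; this leaves three blocks and Picard number four. By \<open>crossing_facet\<close> there is a facet that misses,
  in a given block, a minimum and a maximum of \<open>\<rho>\<close>, and unimodularity of this facet forces them to differ by
  one. So up to constants \<open>\<rho>\<close> is the indicator function of a set \<open>E\<close> that bisects the blocks.\<close>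

lemma hexagonal_case:
  assumes l: "int (card P) \<noteq> picard K" and p4: "picard K \<le> 4"
  obtains E where "picard K = 4" "card P = 3" "bisects E P" "K = avoiding V (crossing_nonfaces P E)"
    "R = split_relations UNIV P E" "unimodular_complex K lam"
proof -
  obtain \<tau> where \<tau>: "\<tau> \<in> K" "card \<tau> = n" and un: "unimodular n lam \<tau>" using facet_exists by blast
  have \<tau>V: "\<tau> \<subseteq> V" using \<tau> by blast
  have "\<forall>N\<in>P. \<exists>v\<in>N. v \<notin> \<tau>" using block_not_in_face \<tau> by blast
  then obtain t where t: "\<And>N. N \<in> P \<Longrightarrow> t N \<in> N \<and> t N \<notin> \<tau>" by metis
  have tV: "t ` P \<subseteq> V - \<tau>" using t block_sub by blast
  have injt: "inj_on t P" using t block_eq by (metis inj_onI)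
  have "t ` P \<noteq> V - \<tau>" using l picard_card[OF \<tau>] card_image[OF injt] by auto
  then obtain x where x: "x \<in> V - \<tau>" "x \<notin> t ` P" using tV by blast
  obtain A where A: "A \<in> P" "x \<in> A" using x(1) blockE by blast
  define x' where "x' = t A"
  have x': "x' \<in> A" "x' \<in> V - \<tau>" "x' \<noteq> x" using A t[OF A(1)] tV x(2) by (auto simp: x'_def)
  obtain \<rho> :: "'a \<Rightarrow> int" where \<rho>: "(\<lambda>v. real_of_int (\<rho> v)) \<in> R" "\<rho> x = 1"
    "\<And>v. v \<in> V - \<tau> \<Longrightarrow> v \<noteq> x \<Longrightarrow> \<rho> v = 0"
    using unimodular_relation[OF un \<tau>V finV x(1)] by blast
  have \<rho>x': "\<rho> x' = 0" using \<rho>(3) x' by blast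
  \<comment> \<open>Applied to \<open>B = {}\<close> this yields a second block, and then a third one.\<close>
  have other: "\<exists>N\<in>P. N \<noteq> A \<and> N \<noteq> B \<and> (\<exists>u\<in>N. \<exists>v\<in>N. \<rho> u \<noteq> \<rho> v)" if B: "B \<in> insert {} P" "A \<noteq> B" for B
  proof (rule ccontr)
    assume "\<not> ?thesis"
    then have "real_of_int (\<rho> u) = real_of_int (\<rho> v)" if "N \<in> P" "N \<noteq> A" "N \<noteq> B" "u \<in> N" "v \<in> N" for N u v
      using that by auto
    then have "real_of_int (\<rho> x) = real_of_int (\<rho> x')"
      by (rule constant_on_block[OF \<rho>(1) A(1) B]) (use A x' in auto)
    then show False using \<rho>(2) \<rho>x' by simp
  qed
  obtain B where B: "B \<in> P" "B \<noteq> A" "\<exists>u\<in>B. \<exists>v\<in>B. \<rho> u \<noteq> \<rho> v"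
    using other[of "{}"] block_nonempty[OF A(1)] by auto
  obtain C where C: "C \<in> P" "C \<noteq> A" "C \<noteq> B" "\<exists>u\<in>C. \<exists>v\<in>C. \<rho> u \<noteq> \<rho> v"
    using other[of B] B by auto
  have "card {A, B, C} \<le> card P" by (rule card_mono) (use finP A B C in auto)
  then have "3 \<le> card P" using B C by simp
  then have cards: "card P = 3" "picard K = 4" using card_blocks_le l p4 by auto
  have Peq: "P = {A, B, C}"
    by (rule card_subset_eq[symmetric]) (use finP A B C cards in auto)
  have nc: "\<exists>u\<in>N. \<exists>v\<in>N. \<rho> u \<noteq> \<rho> v" if "N \<in> P" for N
  proof -
    have "\<exists>u\<in>A. \<exists>v\<in>A. \<rho> u \<noteq> \<rho> v" using A x' \<rho>(2) \<rho>x' by force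
    then show ?thesis using that B C Peq by blast
  qed
  have tBC: "t B \<in> V - \<tau>" "t C \<in> V - \<tau>" using tV B C by blast+
  have d: "x \<noteq> t B" "x \<noteq> t C" "x' \<noteq> t B" "x' \<noteq> t C" "t B \<noteq> t C"
    using x(2) B C A injt by (auto simp: x'_def inj_on_eq_iff)
  have T: "{x, x', t B, t C} = V - \<tau>"
  proof (rule card_subset_eq)
    show "card {x, x', t B, t C} = card (V - \<tau>)"
      using d x'(3) picard_card[OF \<tau>] cards by simp
  qed (use finV x x' tBC in auto)
  \<comment> \<open>A relation is determined by its values outside \<open>\<tau>\<close>; subtracting the multiple of \<open>\<rho>\<close> with the same difference
    between \<open>x\<close> and \<open>x'\<close> leaves one free value for each block. The factor is an integer for integer relations.\<close>
  have span: "c u - (c x - c x') * \<rho> u = c v - (c x - c x') * \<rho> v"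
    if c: "c \<in> R" and N: "N \<in> P" "u \<in> N" "v \<in> N" for c N u v
  proof -
    define k where "k N = (if N = A then c x' else c (t N))" for N
    define e where "e v = (\<Sum>N\<in>P. k N * of_bool (v \<in> N))" for v
    have e: "e v = k N" if "N \<in> P" "v \<in> N" for N v
    proof -
      have "e v = (\<Sum>M\<in>P. if M = N then k M else 0)"
        unfolding e_def by (rule sum.cong) (use that block_eq in \<open>auto simp: of_bool_def\<close>)
      then show ?thesis using finP that by simp
    qed
    have eR: "e \<in> R" by (rule blockwise_relation[where k = k]) (rule e)
    define s where "s = c x - c x'"
    have D: "(\<lambda>v. (c v - s * \<rho> v) - e v) \<in> R"
      by (intro relations_diff relations_scale c \<rho>(1) eR)
    have "e x = c x'" "e x' = c x'" "e (t B) = c (t B)" "e (t C) = c (t C)"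
      using e[OF A] e[OF A(1) x'(1)] e[OF B(1)] e[OF C(1)] t B C by (auto simp: k_def)
    then have "(c w - s * \<rho> w) - e w = 0" if "w \<in> V - \<tau>" for w
      using that \<rho>(2) \<rho>x' \<rho>(3)[OF tBC(1)] \<rho>(3)[OF tBC(2)] d unfolding T[symmetric] by (auto simp: s_def)
    then have zero: "(c w - s * \<rho> w) - e w = 0" if "w \<in> V" for w
      using unimodular_relation_zero[OF un \<tau>V finV D _ that] by blast
    have "u \<in> V" "v \<in> V" using N block_sub by auto
    then show ?thesis using zero[of u] zero[of v] e[OF N(1,2)] e[OF N(1,3)] by (simp add: s_def)
  qed
  have span': "\<exists>s. \<forall>N\<in>P. \<forall>u\<in>N. \<forall>v\<in>N. c u - s * real_of_int (\<rho> u) = c v - s * real_of_int (\<rho> v)"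
    if "c \<in> R" for c
    using span[OF that] by blast
  have nc': "\<exists>u\<in>N. \<exists>v\<in>N. real_of_int (\<rho> u) \<noteq> real_of_int (\<rho> v)" if "N \<in> P" for N
    using nc[OF that] by auto
  define lo where "lo N = Min (\<rho> ` N)" for N
  define hi where "hi N = Max (\<rho> ` N)" for N
  have le: "lo N \<le> \<rho> v" "\<rho> v \<le> hi N" if "N \<in> P" "v \<in> N" for N v
    using that fin_block by (auto simp: lo_def hi_def)
  have att: "\<exists>v\<in>N. \<rho> v = lo N" "\<exists>v\<in>N. \<rho> v = hi N" if "N \<in> P" for N
  proof -
    have "finite (\<rho> ` N)" "\<rho> ` N \<noteq> {}" using that fin_block block_nonempty by auto
    from Min_in[OF this] Max_in[OF this] show "\<exists>v\<in>N. \<rho> v = lo N" "\<exists>v\<in>N. \<rho> v = hi N"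
      unfolding lo_def hi_def by auto
  qed
  have facet: "V - {a, b0, b1, c1} \<in> K"
    if M: "L \<in> P" "N \<in> P" "M \<in> P" "L \<noteq> N" "L \<noteq> M" "N \<noteq> M"
      and m: "a \<in> L" "\<rho> a = lo L" "b0 \<in> N" "\<rho> b0 = lo N" "b1 \<in> N" "\<rho> b1 = hi N" "c1 \<in> M" "\<rho> c1 = hi M"
    for L N M a b0 b1 c1
  proof -
    have "P = {L, N, M}"
      by (rule card_subset_eq[symmetric]) (use finP M cards in auto)
    then show ?thesis
      by (rule crossing_facet[OF \<rho>(1) _ M(4-6) span' nc'])
        (use m M le in auto)
  qed
  have four: "card {a, b0, b1, c1} = 4" "{a, b0, b1, c1} \<subseteq> V"
    if M: "L \<in> P" "N \<in> P" "M \<in> P" "L \<noteq> N" "L \<noteq> M" "N \<noteq> M"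
      and m: "a \<in> L" "b0 \<in> N" "b1 \<in> N" "c1 \<in> M" "b0 \<noteq> b1" for L N M a b0 b1 c1
  proof -
    have "a \<noteq> b0" "a \<noteq> b1" "a \<noteq> c1" "b0 \<noteq> c1" "b1 \<noteq> c1"
      using m block_eq[OF M(1) M(2)] block_eq[OF M(1) M(3)] block_eq[OF M(2) M(3)] M(4-6) by blast+
    then show "card {a, b0, b1, c1} = 4" using m(5) by simp
    show "{a, b0, b1, c1} \<subseteq> V" using m M block_sub by blast
  qed
  have cardn: "card (V - {a, b0, b1, c1}) = n"
    if "card {a, b0, b1, c1} = 4" "{a, b0, b1, c1} \<subseteq> V" for a b0 b1 c1
  proof (rule card_facet)
    have "V - (V - {a, b0, b1, c1}) = {a, b0, b1, c1}" using that(2) by blast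
    then show "card (V - (V - {a, b0, b1, c1})) = nat (picard K)" using that(1) cards by simp
  qed blast
  have spread: "hi N = lo N + 1" if N: "N \<in> P" for N
  proof -
    obtain M where M: "M \<in> P" "M \<noteq> N" using A B N by metis
    obtain L where L: "L \<in> P" "L \<noteq> N" "L \<noteq> M" using third_block[OF cards(1) N M(1)] M(2) by metis
    obtain a b0 b1 c1 where m: "a \<in> L" "\<rho> a = lo L" "b0 \<in> N" "\<rho> b0 = lo N" "b1 \<in> N" "\<rho> b1 = hi N"
      "c1 \<in> M" "\<rho> c1 = hi M"
      using att[OF L(1)] att[OF N] att[OF M(1)] by blast
    have "lo N < hi N"
    proof -
      obtain u v where "u \<in> N" "v \<in> N" "\<rho> u \<noteq> \<rho> v" using nc[OF N] by blast
      then show ?thesis using le[OF N, of u] le[OF N, of v] by linarith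
    qed
    then have b01: "b0 \<noteq> b1" using m by auto
    have F: "V - {a, b0, b1, c1} \<in> K"
      by (rule facet[OF L(1) N M(1)]) (use L M m in auto)
    have f: "card {a, b0, b1, c1} = 4" "{a, b0, b1, c1} \<subseteq> V"
      using four[OF L(1) N M(1) L(2,3) M(2)[symmetric] m(1,3,5,7) b01] by auto
    have unF: "unimodular n lam (V - {a, b0, b1, c1})"
      by (rule char_map_unimodular[OF char F cardn[OF f]])
    have b0: "b0 \<in> V - (V - {a, b0, b1, c1})" using f(2) by blast
    obtain y :: "'a \<Rightarrow> int" where y: "(\<lambda>v. real_of_int (y v)) \<in> R" "y b0 = 1"
      "\<And>v. v \<in> V - (V - {a, b0, b1, c1}) \<Longrightarrow> v \<noteq> b0 \<Longrightarrow> y v = 0"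
      using unimodular_relation[OF unF Diff_subset finV b0] by blast
    \<comment> \<open>An integer multiple of \<open>\<rho>\<close> has difference \<open>1\<close> between \<open>b0\<close> and \<open>b1\<close>.\<close>
    have "y b1 = 0" using y(3)[of b1] f(2) b01 by blast
    then have "real_of_int 1 - (real_of_int (y x) - real_of_int (y x')) * real_of_int (lo N)
        = 0 - (real_of_int (y x) - real_of_int (y x')) * real_of_int (hi N)"
      using span[OF y(1) N m(3,5)] y(2) m(4,6) by simp
    then have "real_of_int ((y x' - y x) * (hi N - lo N)) = real_of_int 1"
      by (simp add: algebra_simps)
    then have "(y x' - y x) * (hi N - lo N) = 1" by (simp only: of_int_eq_iff)
    then have "hi N - lo N = 1" using \<open>lo N < hi N\<close> by (auto simp: zmult_eq_1_iff)
    then show ?thesis by simp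
  qed
  define E where "E = {v. \<exists>N\<in>P. v \<in> N \<and> \<rho> v = hi N}"
  have E: "v \<in> E \<longleftrightarrow> \<rho> v = hi N" if "N \<in> P" "v \<in> N" for N v
    using that block_eq by (auto simp: E_def)
  have E0: "v \<notin> E \<longleftrightarrow> \<rho> v = lo N" if "N \<in> P" "v \<in> N" for N v
    using E[OF that] le[OF that] spread[OF that(1)] by auto
  have rE: "real_of_int (\<rho> v) = real_of_int (lo N) + of_bool (v \<in> E)" if "N \<in> P" "v \<in> N" for N v
    using E[OF that] E0[OF that] spread[OF that(1)] by (cases "v \<in> E") auto
  have bis: "bisects E P"
    unfolding bisects_def
  proof
    fix N assume N: "N \<in> P"
    show "N \<inter> E \<noteq> {} \<and> N - E \<noteq> {}" using att[OF N] E[OF N] E0[OF N] by blast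
  qed
  have Rsplit: "R = split_relations UNIV P E"
  proof (intro equalityI subsetI)
    fix c assume c: "c \<in> R"
    show "c \<in> split_relations UNIV P E"
    proof (rule split_relationsI[of "c x - c x'"])
      fix N u v assume N: "N \<in> P" "u \<in> N" "v \<in> N"
      show "c u - (c x - c x') * of_bool (u \<in> E) = c v - (c x - c x') * of_bool (v \<in> E)"
        using span[OF c N] unfolding rE[OF N(1,2)] rE[OF N(1,3)] by (simp add: algebra_simps)
    qed simp
  next
    fix c assume c: "c \<in> split_relations UNIV P E"
    obtain s where s: "\<forall>N\<in>P. \<forall>u\<in>N. \<forall>v\<in>N. c u - s * of_bool (u \<in> E) = c v - s * of_bool (v \<in> E)"
      using c unfolding split_relations_def by blast
    have "(\<lambda>v. c v - s * real_of_int (\<rho> v)) \<in> R"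
    proof (rule blockwise_relation[where k = "\<lambda>N. c (t N) - s * real_of_int (\<rho> (t N))"])
      fix N v assume N: "N \<in> P" "v \<in> N"
      have tN: "t N \<in> N" using t N by blast
      show "c v - s * real_of_int (\<rho> v) = c (t N) - s * real_of_int (\<rho> (t N))"
        using s[rule_format, OF N tN] unfolding rE[OF N] rE[OF N(1) tN] by (simp add: algebra_simps)
    qed
    from relations_add[OF this relations_scale[OF \<rho>(1), of s]] show "c \<in> R" by simp
  qed
  have non: "(N \<union> M) \<inter> E \<notin> K" "(N \<union> M) - E \<notin> K" if NM: "N \<in> P" "M \<in> P" "N \<noteq> M" for N M
  proof -
    obtain L where L: "L \<in> P" "L \<noteq> N" "L \<noteq> M" "P = {L, N, M}"
      using third_block[OF cards(1) NM] by blast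
    have "{v \<in> N. real_of_int (\<rho> v) \<noteq> real_of_int (lo N)} \<union> {v \<in> M. real_of_int (\<rho> v) \<noteq> real_of_int (lo M)} \<notin> K"
      by (rule lower_nonface[OF \<rho>(1) L(4) L(2,3) NM(3) nc'[OF L(1)]]) (use le NM in auto)
    moreover have "{v \<in> N. real_of_int (\<rho> v) \<noteq> real_of_int (lo N)} \<union> {v \<in> M. real_of_int (\<rho> v) \<noteq> real_of_int (lo M)}
        = (N \<union> M) \<inter> E"
      using E0 NM by auto
    ultimately show "(N \<union> M) \<inter> E \<notin> K" by simp
    have "{v \<in> N. real_of_int (\<rho> v) \<noteq> real_of_int (hi N)} \<union> {v \<in> M. real_of_int (\<rho> v) \<noteq> real_of_int (hi M)} \<notin> K"
      by (rule upper_nonface[OF \<rho>(1) L(4) L(2,3) NM(3) nc'[OF L(1)]]) (use le NM in auto)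
    moreover have "{v \<in> N. real_of_int (\<rho> v) \<noteq> real_of_int (hi N)} \<union> {v \<in> M. real_of_int (\<rho> v) \<noteq> real_of_int (hi M)}
        = (N \<union> M) - E"
      using E NM by auto
    ultimately show "(N \<union> M) - E \<notin> K" by simp
  qed
  have sub: "\<exists>\<phi>\<in>K. \<sigma> \<subseteq> \<phi> \<and> card \<phi> = n" if \<sigma>: "\<sigma> \<in> avoiding V (crossing_nonfaces P E)" for \<sigma>
  proof -
    \<comment> \<open>There is a block with neither side inside \<open>\<sigma>\<close>, and the other two blocks have opposite sides that are not
    inside \<open>\<sigma>\<close>.\<close>
    define z where "z N \<longleftrightarrow> N - E \<subseteq> \<sigma>" for N
    define w where "w N \<longleftrightarrow> N \<inter> E \<subseteq> \<sigma>" for N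
    have 1: "\<not> (z N \<and> w N)" if "N \<in> P" for N
      using \<sigma> that unfolding avoiding_crossing_iff z_def w_def by blast
    have 2: "\<not> (z N \<and> z M)" "\<not> (w N \<and> w M)" if "N \<in> P" "M \<in> P" "N \<noteq> M" for N M
      using \<sigma> that unfolding avoiding_crossing_iff z_def w_def by blast+
    have "\<exists>L N M. L \<in> P \<and> N \<in> P \<and> M \<in> P \<and> L \<noteq> N \<and> L \<noteq> M \<and> N \<noteq> M \<and> \<not> z L \<and> \<not> z N \<and> \<not> w N \<and> \<not> w M"
      using 1[OF A(1)] 1[OF B(1)] 1[OF C(1)] 2[OF A(1) B(1)] 2[OF A(1) C(1)] 2[OF B(1) C(1)] A(1) B C
      by metis
    then obtain L N M where M: "L \<in> P" "N \<in> P" "M \<in> P" "L \<noteq> N" "L \<noteq> M" "N \<noteq> M"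
      and zw: "\<not> z L" "\<not> z N" "\<not> w N" "\<not> w M" by blast
    obtain a b0 b1 c1 where m: "a \<in> L - E" "a \<notin> \<sigma>" "b0 \<in> N - E" "b0 \<notin> \<sigma>" "b1 \<in> N \<inter> E" "b1 \<notin> \<sigma>"
      "c1 \<in> M \<inter> E" "c1 \<notin> \<sigma>"
      using zw unfolding z_def w_def by blast
    then have "V - {a, b0, b1, c1} \<in> K"
      by (intro facet[OF M]) (use E0[OF M(1)] E0[OF M(2)] E[OF M(2)] E[OF M(3)] in auto)
    moreover have "\<sigma> \<subseteq> V - {a, b0, b1, c1}" using m \<sigma> by (auto simp: avoiding_def)
    moreover have "card (V - {a, b0, b1, c1}) = n"
      by (rule cardn; rule four[OF M]) (use m in auto)
    ultimately show ?thesis by blast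
  qed
  have av: "K = avoiding V (crossing_nonfaces P E)"
  proof (intro equalityI subsetI)
    fix \<sigma> assume "\<sigma> \<in> K"
    then show "\<sigma> \<in> avoiding V (crossing_nonfaces P E)"
      unfolding avoiding_crossing_iff using block_nonface non down by blast
  next
    fix \<sigma> assume "\<sigma> \<in> avoiding V (crossing_nonfaces P E)"
    then show "\<sigma> \<in> K" using sub down by blast
  qed
  have "unimodular_complex K lam"
    by (rule unimodular_complexI) (use sub av in blast)
  then show thesis using that[of E] cards bis av Rsplit by blast
qed

end

section \<open>Products of projective spaces\<close>

lemma partition_complex:
  assumes fin: "finite V" and P: "partition_on V P" and two: "\<forall>N\<in>P. 2 \<le> card N"
  shows "abstract_complex (avoiding V P)" "\<Union>(avoiding V P) = V"
    "\<And>\<sigma>. \<sigma> \<in> avoiding V P \<Longrightarrow> \<exists>\<tau>\<in>avoiding V P. \<sigma> \<subseteq> \<tau> \<and> card \<tau> = card V - card P"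
    "cdim (avoiding V P) = card V - card P" "picard (avoiding V P) = int (card P)"
    "\<And>N. N \<in> P \<Longrightarrow> minimal_nonface (avoiding V P) N"
proof -
  have small: "\<not> N \<subseteq> \<sigma>" if "N \<in> P" "finite \<sigma>" "card \<sigma> \<le> 1" for N \<sigma>
  proof
    assume "N \<subseteq> \<sigma>"
    then have "card N \<le> card \<sigma>" using that(2) by (simp add: card_mono)
    then show False using two that(1,3) by fastforce
  qed
  have vert: "{v} \<in> avoiding V P" if "v \<in> V" for v
    using small[of _ "{v}"] that by (auto simp: avoiding_def)
  show U: "\<Union>(avoiding V P) = V" using vert by (auto simp: avoiding_def)
  have "{} \<in> avoiding V P" using small[of _ "{}"] by (auto simp: avoiding_def)
  then show abs: "abstract_complex (avoiding V P)"
    unfolding abstract_complex_def U using fin by (fastforce simp: avoiding_def)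
  have m_facts: "inj_on m P" "m ` P \<subseteq> V" if m: "\<And>N. N \<in> P \<Longrightarrow> m N \<in> N" for m
  proof -
    show "inj_on m P" by (rule inj_onI) (metis m partition_block_eq[OF P])
    show "m ` P \<subseteq> V" using m partition_block_subset[OF P] by blast
  qed
  show pure: "\<exists>\<tau>\<in>avoiding V P. \<sigma> \<subseteq> \<tau> \<and> card \<tau> = card V - card P" if \<sigma>: "\<sigma> \<in> avoiding V P" for \<sigma>
  proof -
    have "\<forall>N\<in>P. \<exists>v\<in>N. v \<notin> \<sigma>" using \<sigma> by (auto simp: avoiding_def)
    then obtain m where m: "\<And>N. N \<in> P \<Longrightarrow> m N \<in> N \<and> m N \<notin> \<sigma>" by metis
    have "\<not> N \<subseteq> V - m ` P" if "N \<in> P" for N using m[OF that] that by blast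
    then have "V - m ` P \<in> avoiding V P" by (auto simp: avoiding_def)
    moreover have "\<sigma> \<subseteq> V - m ` P" using \<sigma> m by (auto simp: avoiding_def)
    moreover have "card (V - m ` P) = card V - card P"
      using card_Diff_subset[of "m ` P" V] m_facts[of m] m fin card_image[of m P] finite_subset[of "m ` P" V] by simp
    ultimately show ?thesis by blast
  qed
  show dim: "cdim (avoiding V P) = card V - card P"
    by (rule cdim_eqI[OF abs pure])
  have "\<forall>N\<in>P. \<exists>v. v \<in> N" using P unfolding partition_on_def by (metis ex_in_conv)
  then obtain m where m: "\<And>N. N \<in> P \<Longrightarrow> m N \<in> N" by metis
  have "card P \<le> card V"
    using card_inj_on_le[OF m_facts(1) m_facts(2) fin] m by blast
  then show "picard (avoiding V P) = int (card P)" by (simp add: picard_def U dim)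
  show "minimal_nonface (avoiding V P) N" if N: "N \<in> P" for N
    unfolding minimal_nonface_def U
  proof (intro conjI allI impI)
    show "N \<subseteq> V" by (rule partition_block_subset[OF P N])
    show "N \<notin> avoiding V P" using N by (auto simp: avoiding_def)
    fix \<sigma> assume \<sigma>: "\<sigma> \<subset> N"
    have "\<not> M \<subseteq> \<sigma>" if M: "M \<in> P" for M
    proof
      assume MS: "M \<subseteq> \<sigma>"
      have "M \<noteq> {}" using P M by (auto simp: partition_on_def)
      then obtain v where "v \<in> M" by blast
      then have "M = N" using partition_block_eq[OF P M N] MS \<sigma> by blast
      then show False using MS \<sigma> by blast
    qed
    then show "\<sigma> \<in> avoiding V P" using \<sigma> partition_block_subset[OF P N] by (auto simp: avoiding_def)
  qed
qed

text \<open>A minimal non-face of a complex given by the disjoint non-faces \<open>P\<close> is an element of \<open>P\<close>. So there is only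
  one possible optimal partition, which determines the relations.\<close>

lemma product_fan_relations:
  assumes fin: "finite W" and P: "partition_on W P" and two: "\<forall>N\<in>P. 2 \<le> card N"
    and opt: "optimal_fan (avoiding W P) mu P'"
  shows "unimodular_complex (avoiding W P) mu"
    "relations (cdim (avoiding W P)) W mu = split_relations {0} P E"
proof -
  note pc = partition_complex[OF fin P two]
  interpret optimal_fan "avoiding W P" mu P' by (rule opt)
  have part': "partition_on W P'" using part pc(2) by simp
  have "P' \<subseteq> P"
  proof
    fix N assume N: "N \<in> P'"
    have "N \<subseteq> W" by (rule partition_block_subset[OF part' N])
    then obtain X where X: "X \<in> P" "X \<subseteq> N" using block_nonface[OF N] by (auto simp: avoiding_def)
    have "X \<notin> avoiding W P" using X(1) by (auto simp: avoiding_def)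
    then have "\<not> X \<subset> N" using block_proper[OF N] by blast
    then show "N \<in> P" using X by auto
  qed
  then have "P' = P" by (rule partition_subset_eq[OF part' P])
  then have "int (card P') = picard (avoiding W P)" using pc(5) by simp
  from product_case[OF this] show "unimodular_complex (avoiding W P) mu"
    "relations (cdim (avoiding W P)) W mu = split_relations {0} P E"
    unfolding pc(2) \<open>P' = P\<close> by auto
qed

section \<open>Cross polytopes\<close>

definition antipodal_pairs :: "nat \<Rightarrow> nat set set" where
  "antipodal_pairs d = (\<lambda>i. {2 * i, 2 * i + 1}) ` {..<d}"

definition cross_vec :: "nat \<Rightarrow> nat \<Rightarrow> int vec" where
  "cross_vec d v = (if even v then unit_vec d (v div 2) else - unit_vec d (v div 2))"

lemma bd_cross_polytope_avoiding: "bd_cross_polytope d = avoiding {..<2 * d} (antipodal_pairs d)"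
  by (auto simp: bd_cross_polytope_def avoiding_def antipodal_pairs_def)

lemma antipodal_pairs_partition: "partition_on {..<2 * d} (antipodal_pairs d)"
proof (rule partition_onI)
  show "\<Union>(antipodal_pairs d) = {..<2 * d}"
  proof (intro equalityI subsetI)
    fix v assume v: "v \<in> {..<2 * d}"
    then have "v \<in> {2 * (v div 2), 2 * (v div 2) + 1}" "v div 2 < d" by auto
    then show "v \<in> \<Union>(antipodal_pairs d)" unfolding antipodal_pairs_def by blast
  qed (auto simp: antipodal_pairs_def)
  show "disjnt N M" if NM: "N \<in> antipodal_pairs d" "M \<in> antipodal_pairs d" "N \<noteq> M" for N M
  proof -
    obtain i j where ij: "N = {2 * i, 2 * i + 1}" "M = {2 * j, 2 * j + 1}"
      using NM unfolding antipodal_pairs_def by blast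
    then have "i \<noteq> j" using NM(3) by blast
    then have "2 * i \<noteq> 2 * j + 1" "2 * i + 1 \<noteq> 2 * j" by presburger+
    then show ?thesis using \<open>i \<noteq> j\<close> ij by (auto simp: disjnt_def)
  qed
qed (auto simp: antipodal_pairs_def)

lemma antipodal_pairs_card: "\<forall>N\<in>antipodal_pairs d. card N = 2" "card (antipodal_pairs d) = d"
proof -
  have "inj_on (\<lambda>i :: nat. {2 * i, 2 * i + 1}) {..<d}"
    by (rule inj_onI) (auto simp: doubleton_eq_iff)
  then show "card (antipodal_pairs d) = d" by (simp add: antipodal_pairs_def card_image)
qed (auto simp: antipodal_pairs_def)

lemma cross_vec_sum:
  assumes j: "j < d"
  shows "(\<Sum>v<2 * d. c v * real_of_int (cross_vec d v $ j)) = c (2 * j) - c (2 * j + 1)"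
proof -
  have "(\<Sum>v<2 * d. c v * real_of_int (cross_vec d v $ j))
      = (\<Sum>v\<in>{2 * j, 2 * j + 1}. c v * real_of_int (cross_vec d v $ j))"
  proof (rule sum.mono_neutral_right)
    show "\<forall>v\<in>{..<2 * d} - {2 * j, 2 * j + 1}. c v * real_of_int (cross_vec d v $ j) = 0"
    proof
      fix v assume v: "v \<in> {..<2 * d} - {2 * j, 2 * j + 1}"
      have "v div 2 < d" "v div 2 \<noteq> j" using v by auto
      then show "c v * real_of_int (cross_vec d v $ j) = 0"
        using j by (simp add: cross_vec_def)
    qed
  qed (use j in auto)
  then show ?thesis using j by (simp add: cross_vec_def)
qed

text \<open>The fan of a product of projective lines.\<close>

lemma cross_polytope_fan:
  shows "fan_giving (bd_cross_polytope d) (cross_vec d)"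
    "optimal_partition (bd_cross_polytope d) (cross_vec d) (antipodal_pairs d)"
proof -
  have two: "\<forall>N\<in>antipodal_pairs d. 2 \<le> card N" using antipodal_pairs_card(1)[of d] by simp
  note pc = partition_complex[OF finite_lessThan antipodal_pairs_partition two, folded bd_cross_polytope_avoiding]
  have dim: "cdim (bd_cross_polytope d) = d" using pc(4) by (simp add: antipodal_pairs_card)
  have rel: "c \<in> relations d {..<2 * d} (cross_vec d) \<longleftrightarrow> (\<forall>j<d. c (2 * j) = c (2 * j + 1))" for c
    by (auto simp: relations_def cross_vec_sum)
  have car: "cross_vec d v \<in> carrier_vec d" for v by (simp add: cross_vec_def)
  have notboth: "\<not> (2 * i \<in> \<sigma> \<and> 2 * i + 1 \<in> \<sigma>)" if "\<sigma> \<in> bd_cross_polytope d" "i < d" for i \<sigma>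
    using that by (auto simp: bd_cross_polytope_def)
  have un: "unimodular d (cross_vec d) \<tau>" if \<tau>: "\<tau> \<in> bd_cross_polytope d" "card \<tau> = d" for \<tau>
  proof -
    \<comment> \<open>A facet contains exactly one vertex \<open>e i\<close> of each pair, with vector \<open>\<epsilon> i\<close> times a unit vector.\<close>
    define e where "e i = (if 2 * i \<in> \<tau> then 2 * i else 2 * i + 1)" for i
    define \<epsilon> where "\<epsilon> i = (if 2 * i \<in> \<tau> then 1 else - 1 :: int)" for i
    have sub: "\<tau> \<subseteq> e ` {..<d}"
    proof
      fix w assume w: "w \<in> \<tau>"
      then have "w < 2 * d" using \<tau> by (auto simp: bd_cross_polytope_def)
      then have i: "w div 2 < d" by simp
      have "w = e (w div 2)"
      proof (cases "even w")
        case True then show ?thesis using w by (simp add: e_def)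
      next
        case False
        then have "2 * (w div 2) + 1 = w" by simp
        then show ?thesis using notboth[OF \<tau>(1) i] w by (auto simp: e_def)
      qed
      then show "w \<in> e ` {..<d}" using i by blast
    qed
    have "card (e ` {..<d}) \<le> card \<tau>" using card_image_le[of "{..<d}" e] \<tau> by simp
    then have im: "\<tau> = e ` {..<d}" by (intro card_seteq sub) auto
    then have "inj_on e {..<d}" using \<tau>(2) by (intro eq_card_imp_inj_on) auto
    then have e: "bij_betw e {..<d} \<tau>" using im by (simp add: bij_betw_def)
    have vec: "cross_vec d (e i) $ j = (if i = j then \<epsilon> i else 0)" if "i < d" "j < d" for i j
      using that by (simp add: cross_vec_def e_def \<epsilon>_def)
    have sq: "\<epsilon> i * \<epsilon> i = 1" for i by (simp add: \<epsilon>_def)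
    show ?thesis
    proof (rule unimodularI[where g = "\<lambda>v j. cross_vec d v $ j"])
      show "finite \<tau>" using e bij_betw_finite by blast
      show "(\<Sum>v\<in>\<tau>. cross_vec d v $ i * cross_vec d v $ j) = (if i = j then 1 else 0)"
        if ij: "i < d" "j < d" for i j
      proof -
        have "(\<Sum>v\<in>\<tau>. cross_vec d v $ i * cross_vec d v $ j) = (\<Sum>k<d. cross_vec d (e k) $ i * cross_vec d (e k) $ j)"
          by (rule sum.reindex_bij_betw[OF e, symmetric])
        also have "\<dots> = (\<Sum>k<d. if k = i then (if i = j then 1 else 0) else 0)"
          by (rule sum.cong) (use vec ij sq in auto)
        finally show ?thesis using ij by simp
      qed
      show "(\<Sum>j<d. cross_vec d u $ j * cross_vec d v $ j) = (if u = v then 1 else 0)"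
        if uv: "u \<in> \<tau>" "v \<in> \<tau>" for u v
      proof -
        obtain k l where kl: "k < d" "l < d" "u = e k" "v = e l" using uv by (auto simp: im)
        have "(\<Sum>j<d. cross_vec d u $ j * cross_vec d v $ j) = (\<Sum>j<d. if j = k then (if k = l then 1 else 0) else 0)"
          by (rule sum.cong) (use vec kl sq in auto)
        then show ?thesis using kl \<open>inj_on e {..<d}\<close> by (auto simp: inj_on_eq_iff)
      qed
    qed (rule car)
  qed
  have unc: "unimodular_complex (bd_cross_polytope d) (cross_vec d)"
    unfolding unimodular_complex_def dim
  proof (intro conjI ballI pc(1) car)
    fix \<sigma> assume "\<sigma> \<in> bd_cross_polytope d"
    then obtain \<tau> where "\<tau> \<in> bd_cross_polytope d" "\<sigma> \<subseteq> \<tau>" "card \<tau> = d"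
      using pc(3) by (auto simp: antipodal_pairs_card)
    then show "\<exists>\<tau>\<in>bd_cross_polytope d. \<sigma> \<subseteq> \<tau> \<and> unimodular d (cross_vec d) \<tau>"
      using un by blast
  qed
  have "unique_coordinates (bd_cross_polytope d) (cross_vec d)"
    unfolding unique_coordinates_def dim pc(2)
  proof (intro conjI allI impI)
    fix x :: "nat \<Rightarrow> real"
    define c where "c v = (if v < 2 * d then if even v then max 0 (x (v div 2)) else max 0 (- x (v div 2)) else 0)" for v
    have "{v. c v \<noteq> 0} \<in> bd_cross_polytope d"
      by (auto simp: bd_cross_polytope_def c_def split: if_splits)
    then have "cone_coordinates (bd_cross_polytope d) c" by (auto simp: cone_coordinates_def c_def)
    moreover have "(\<Sum>v<2 * d. c v * real_of_int (cross_vec d v $ j)) = x j" if "j < d" for j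
      unfolding cross_vec_sum[OF that] using that by (auto simp: c_def)
    ultimately show "\<exists>c. cone_coordinates (bd_cross_polytope d) c \<and>
        (\<forall>j<d. (\<Sum>v<2 * d. c v * real_of_int (cross_vec d v $ j)) = x j)" by blast
  next
    fix c e :: "nat \<Rightarrow> real"
    assume c: "cone_coordinates (bd_cross_polytope d) c" and e: "cone_coordinates (bd_cross_polytope d) e"
      and ce: "(\<lambda>v. c v - e v) \<in> relations d {..<2 * d} (cross_vec d)"
    have pair: "c (2 * j) = e (2 * j) \<and> c (2 * j + 1) = e (2 * j + 1)" if j: "j < d" for j
    proof -
      have "c (2 * j) - e (2 * j) = c (2 * j + 1) - e (2 * j + 1)" using ce j unfolding rel by blast
      moreover have "c (2 * j) = 0 \<or> c (2 * j + 1) = 0" "e (2 * j) = 0 \<or> e (2 * j + 1) = 0"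
        using notboth[of "{v. c v \<noteq> 0}" j] notboth[of "{v. e v \<noteq> 0}" j] c e j
        by (auto simp: cone_coordinates_def)
      moreover have "0 \<le> c (2 * j)" "0 \<le> e (2 * j)" "0 \<le> c (2 * j + 1)" "0 \<le> e (2 * j + 1)"
        using c e by (auto simp: cone_coordinates_def)
      ultimately show ?thesis by linarith
    qed
    show "c = e"
    proof
      fix v
      show "c v = e v"
      proof (cases "v < 2 * d")
        case True
        then have "v div 2 < d" by simp
        from pair[OF this] show ?thesis by (cases "even v") auto
      next
        case False
        have "{v. c v \<noteq> 0} \<subseteq> {..<2 * d}" "{v. e v \<noteq> 0} \<subseteq> {..<2 * d}"
          using c e by (auto simp: cone_coordinates_def bd_cross_polytope_def)
        then have "v \<notin> {v. c v \<noteq> 0}" "v \<notin> {v. e v \<noteq> 0}" using False by blast+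
        then show ?thesis by simp
      qed
    qed
  qed
  then show "fan_giving (bd_cross_polytope d) (cross_vec d)"
    by (rule fan_givingI[OF unc])
  show "optimal_partition (bd_cross_polytope d) (cross_vec d) (antipodal_pairs d)"
    unfolding optimal_partition_def pc(2) dim
  proof (intro conjI ballI antipodal_pairs_partition pc(6))
    fix N assume "N \<in> antipodal_pairs d"
    then obtain i where i: "i < d" "N = {2 * i, 2 * i + 1}" by (auto simp: antipodal_pairs_def)
    show "vec d (\<lambda>j. \<Sum>v\<in>N. cross_vec d v $ j) = 0\<^sub>v d"
      by (rule eq_vecI) (auto simp: i cross_vec_def)
  qed
qed

lemma pullback_fan:
  fixes B :: "nat set set" and V :: "'a set"
  assumes reg: "unimodular_complex B mu0" and fan: "fan_giving B mu0" and opt: "optimal_partition B mu0 P0"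
    and fin: "finite V" and surj: "q ` V = \<Union>B"
  obtains lam P where "fan_giving (pullback V q B) lam" "optimal_partition (pullback V q B) lam P"
proof -
  obtain mu :: "nat \<Rightarrow> int vec" and f :: "'a \<Rightarrow> nat" and \<tau>
    where "pulled_back B mu0 V q (cdim B + (card V - card (\<Union>B))) (mu \<circ> f) \<tau>"
    using pullback_realization[OF reg fin surj] by blast
  then interpret pulled_back B mu0 V q "cdim B + (card V - card (\<Union>B))" "mu \<circ> f" \<tau> .
  show thesis
    by (rule that[OF fan_givingI[OF unimodular_pullback
            unique_coordinates_pullback[OF fan_giving_unique_coordinates[OF absB fan]]]
          optimal_partition_pullback[OF opt]])
qed

lemma bisection_exists:
  assumes P: "partition_on V P" and two: "\<forall>N\<in>P. 2 \<le> card N"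
  obtains E where "bisects E P"
proof -
  have "\<exists>x y. x \<in> N \<and> y \<in> N \<and> x \<noteq> y" if N: "N \<in> P" for N
  proof -
    obtain S where "S \<subseteq> N" "card S = 2" using obtain_subset_with_card_n[OF bspec[OF two N]] by metis
    then show ?thesis by (auto simp: card_2_iff)
  qed
  then obtain x y where xy: "\<And>N. N \<in> P \<Longrightarrow> x N \<in> N \<and> y N \<in> N \<and> x N \<noteq> y N" by metis
  have "bisects (x ` P) P"
    unfolding bisects_def
  proof
    fix N assume N: "N \<in> P"
    have "y N \<notin> x ` P"
    proof
      assume "y N \<in> x ` P"
      then obtain M where M: "M \<in> P" "y N = x M" by blast
      then have "M = N" using partition_block_eq[OF P M(1) N, of "y N"] xy[OF N] xy[OF M(1)] by auto
      then show False using M xy[OF N] by auto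
    qed
    then show "N \<inter> x ` P \<noteq> {} \<and> N - x ` P \<noteq> {}" using xy[OF N] N by blast
  qed
  then show thesis by (rule that)
qed

lemma product_pullback:
  fixes V :: "'a set" and V0 :: "'b set"
  assumes fin: "finite V" and P: "partition_on V P" and two: "\<forall>N\<in>P. 2 \<le> card N"
    and fin0: "finite V0" and P0: "partition_on V0 P0" and pairs: "\<forall>N\<in>P0. card N = 2"
    and cards: "card P = card P0"
  shows "\<exists>q. q ` V = V0 \<and> pullback V q (avoiding V0 P0) = avoiding V P \<and>
    (\<forall>E E0. pull_relations V q (split_relations {0} P0 E0) = split_relations {0} P E)"
proof -
  have two0: "\<forall>N\<in>P0. 2 \<le> card N" using pairs by simp
  obtain E where E: "bisects E P" using bisection_exists[OF P two] by blast
  obtain E0 where E0: "bisects E0 P0" using bisection_exists[OF P0 two0] by blast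
  obtain \<beta> where \<beta>: "bij_betw \<beta> P P0"
    using finite_same_card_bij[OF finite_elements[OF fin P] finite_elements[OF fin0 P0] cards] by blast
  obtain q where q: "q ` V = V0"
    "\<And>N v. N \<in> P \<Longrightarrow> v \<in> V \<Longrightarrow> q v \<in> \<beta> N \<longleftrightarrow> v \<in> N"
    "\<And>v. v \<in> V \<Longrightarrow> q v \<in> E0 \<longleftrightarrow> v \<in> E"
    "\<And>u v N. N \<in> P \<Longrightarrow> u \<in> N \<Longrightarrow> v \<in> N \<Longrightarrow> (u \<in> E \<longleftrightarrow> v \<in> E) \<Longrightarrow> q u = q v"
    using bisected_map[OF P E P0 E0 bspec[OF pairs] \<beta>] by blast
  show ?thesis
  proof (intro exI[of _ q] conjI allI q(1))
    have "pullback V q (avoiding V0 P0) = avoiding V ((\<lambda>X. {v \<in> V. q v \<in> X}) ` P0)"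
      by (rule avoiding_pullback[OF partition_complex(2)[OF fin0 P0 two0] q(1) partition_block_subset[OF P0]])
    also have "(\<lambda>X. {v \<in> V. q v \<in> X}) ` P0 = P"
      by (rule preimage_partition[OF P P0 \<beta> q])
    finally show "pullback V q (avoiding V0 P0) = avoiding V P" .
    show "pull_relations V q (split_relations {0} P0 E0') = split_relations {0} P E'" for E' E0'
    proof -
      have "pull_relations V q (split_relations {0} P0 E0) = split_relations {0} P E"
        by (rule pull_split_relations[OF P P0 \<beta> q])
      then show ?thesis
        using split_relations_zero[of P0 E0' E0] split_relations_zero[of P E' E] by simp
    qed
  qed
qed

text \<open>By pullback from the cross polytope with as many pairs of antipodal vertices as there are blocks.\<close>

lemma product_fan_exists:
  assumes fin: "finite V" and P: "partition_on V P" and two: "\<forall>N\<in>P. 2 \<le> card N"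
  obtains lam P' where "fan_giving (avoiding V P) lam" "optimal_partition (avoiding V P) lam P'"
proof -
  define d where "d = card P"
  have two0: "\<forall>N\<in>antipodal_pairs d. 2 \<le> card N" using antipodal_pairs_card(1)[of d] by simp
  note pc = partition_complex[OF finite_lessThan antipodal_pairs_partition two0, folded bd_cross_polytope_avoiding]
  have c: "card P = card (antipodal_pairs d)" by (simp add: antipodal_pairs_card d_def)
  obtain q where q: "q ` V = {..<2 * d}" "pullback V q (avoiding {..<2 * d} (antipodal_pairs d)) = avoiding V P"
    using product_pullback[OF fin P two finite_lessThan antipodal_pairs_partition antipodal_pairs_card(1)[of d] c] by blast
  have "optimal_fan (bd_cross_polytope d) (cross_vec d) (antipodal_pairs d)"
    using pc(1) cross_polytope_fan by unfold_locales
  then have reg: "unimodular_complex (bd_cross_polytope d) (cross_vec d)"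
    unfolding bd_cross_polytope_avoiding
    by (rule product_fan_relations(1)[OF finite_lessThan antipodal_pairs_partition two0])
  have surj: "q ` V = \<Union>(bd_cross_polytope d)" using q(1) pc(2) by simp
  obtain lam P' where "fan_giving (pullback V q (bd_cross_polytope d)) lam"
    "optimal_partition (pullback V q (bd_cross_polytope d)) lam P'"
    by (rule pullback_fan[OF reg cross_polytope_fan fin surj])
  then show thesis using that q(2) unfolding bd_cross_polytope_avoiding by simp
qed

section \<open>The hexagon\<close>

definition hexagon_pairs :: "nat set set" where
  "hexagon_pairs = {{0, 3}, {2, 5}, {4, 1}}"

lemma less_6: "{..<6::nat} = {0, 1, 2, 3, 4, 5}"
  by auto

lemma polygon_6_iff:
  "\<sigma> \<in> polygon 6 \<longleftrightarrow> \<sigma> \<subseteq> {..<6} \<and> \<not> {0, 2} \<subseteq> \<sigma> \<and> \<not> {1, 3} \<subseteq> \<sigma> \<and> \<not> {2, 4} \<subseteq> \<sigma> \<and>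
    \<not> {3, 5} \<subseteq> \<sigma> \<and> \<not> {4, 0} \<subseteq> \<sigma> \<and> \<not> {5, 1} \<subseteq> \<sigma> \<and> \<not> {0, 3} \<subseteq> \<sigma> \<and> \<not> {1, 4} \<subseteq> \<sigma> \<and> \<not> {2, 5} \<subseteq> \<sigma>"
proof -
  have im: "polygon 6 = {{}} \<union> (\<lambda>i. {i}) ` {..<6} \<union> (\<lambda>i. {i, Suc i mod 6}) ` {..<6}"
    unfolding polygon_def by blast
  have poly: "polygon 6 = {{}, {0}, {1}, {2}, {3}, {4}, {5}, {0, 1}, {1, 2}, {2, 3}, {3, 4}, {4, 5}, {5, 0}}"
    unfolding im less_6 by (simp add: insert_commute flip: numeral_2_eq_2)
  show ?thesis
  proof (cases "\<sigma> \<subseteq> {0, 1, 2, 3, 4, 5}")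
    case True
    have eq: "\<sigma> = T \<longleftrightarrow> (\<forall>i\<in>{0, 1, 2, 3, 4, 5}. i \<in> \<sigma> \<longleftrightarrow> i \<in> T)" if "T \<subseteq> {0, 1, 2, 3, 4, 5}" for T
      using True that by blast
    show ?thesis
    proof -
      have "\<sigma> \<in> polygon 6 \<longleftrightarrow> \<not> (0 \<in> \<sigma> \<and> 2 \<in> \<sigma>) \<and> \<not> (1 \<in> \<sigma> \<and> 3 \<in> \<sigma>) \<and> \<not> (2 \<in> \<sigma> \<and> 4 \<in> \<sigma>) \<and>
          \<not> (3 \<in> \<sigma> \<and> 5 \<in> \<sigma>) \<and> \<not> (4 \<in> \<sigma> \<and> 0 \<in> \<sigma>) \<and> \<not> (5 \<in> \<sigma> \<and> 1 \<in> \<sigma>) \<and> \<not> (0 \<in> \<sigma> \<and> 3 \<in> \<sigma>) \<and>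
          \<not> (1 \<in> \<sigma> \<and> 4 \<in> \<sigma>) \<and> \<not> (2 \<in> \<sigma> \<and> 5 \<in> \<sigma>)"
        unfolding poly by (simp add: eq) argo
      then show ?thesis using True unfolding less_6 by simp
    qed
  next
    case False
    then show ?thesis unfolding poly less_6 by auto
  qed
qed

lemma polygon_6_avoiding: "polygon 6 = avoiding {..<6} (crossing_nonfaces hexagon_pairs {0, 2, 4})"
proof (rule Set.set_eqI)
  fix \<sigma>
  have ne: "{0, 3} \<noteq> {2, 5::nat}" "{0, 3} \<noteq> {4, 1::nat}" "{2, 5} \<noteq> {4, 1::nat}"
    by (auto simp: doubleton_eq_iff)
  have ex: "(\<forall>N\<in>{A, B, C}. \<forall>M\<in>{A, B, C}. N \<noteq> M \<longrightarrow> Q N M) \<longleftrightarrow>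
      Q A B \<and> Q B A \<and> Q A C \<and> Q C A \<and> Q B C \<and> Q C B"
    if "A \<noteq> B" "A \<noteq> C" "B \<noteq> C" for A B C :: "nat set" and Q
    using that by blast
  have int: "({0, 3} \<union> {2, 5}) \<inter> {0, 2, 4} = {0, 2 :: nat}" "({2, 5} \<union> {0, 3}) \<inter> {0, 2, 4} = {0, 2 :: nat}"
    "({0, 3} \<union> {4, 1}) \<inter> {0, 2, 4} = {4, 0 :: nat}" "({4, 1} \<union> {0, 3}) \<inter> {0, 2, 4} = {4, 0 :: nat}"
    "({2, 5} \<union> {4, 1}) \<inter> {0, 2, 4} = {2, 4 :: nat}" "({4, 1} \<union> {2, 5}) \<inter> {0, 2, 4} = {2, 4 :: nat}"
    "({0, 3} \<union> {2, 5}) - {0, 2, 4} = {3, 5 :: nat}" "({2, 5} \<union> {0, 3}) - {0, 2, 4} = {3, 5 :: nat}"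
    "({0, 3} \<union> {4, 1}) - {0, 2, 4} = {1, 3 :: nat}" "({4, 1} \<union> {0, 3}) - {0, 2, 4} = {1, 3 :: nat}"
    "({2, 5} \<union> {4, 1}) - {0, 2, 4} = {5, 1 :: nat}" "({4, 1} \<union> {2, 5}) - {0, 2, 4} = {5, 1 :: nat}"
    by auto
  show "\<sigma> \<in> polygon 6 \<longleftrightarrow> \<sigma> \<in> avoiding {..<6} (crossing_nonfaces hexagon_pairs {0, 2, 4})"
    unfolding polygon_6_iff avoiding_crossing_iff hexagon_pairs_def ex[OF ne] int
    by (simp, argo?)
qed

lemma hexagon_pairs_partition: "partition_on {..<6} hexagon_pairs"
  unfolding hexagon_pairs_def partition_on_def disjoint_def less_6 by auto

lemma hexagon_pairs_card: "\<forall>N\<in>hexagon_pairs. card N = 2" "card hexagon_pairs = 3"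
  unfolding hexagon_pairs_def by (auto simp: doubleton_eq_iff)

lemma hexagon_pairs_bisected: "bisects {0, 2, 4} hexagon_pairs"
  unfolding hexagon_pairs_def bisects_def by auto

lemma polygon_6_edge: "i < 6 \<Longrightarrow> {i, Suc i mod 6} \<in> polygon 6"
  unfolding polygon_def by blast

lemma polygon_6_vertices: "\<Union>(polygon 6) = {..<6}"
proof
  show "{..<6} \<subseteq> \<Union>(polygon 6)"
  proof
    fix i :: nat assume "i \<in> {..<6}"
    then have "{i, Suc i mod 6} \<in> polygon 6" by (simp add: polygon_6_edge)
    then show "i \<in> \<Union>(polygon 6)" by blast
  qed
  show "\<Union>(polygon 6) \<subseteq> {..<6}" by (auto simp: polygon_6_iff)
qed

lemma polygon_6_pure: "\<sigma> \<in> polygon 6 \<Longrightarrow> \<exists>i<6. \<sigma> \<subseteq> {i, Suc i mod 6}"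
  unfolding polygon_def by (auto intro: exI[of _ 0])

lemma polygon_6_complex: "abstract_complex (polygon 6)"
  unfolding abstract_complex_def polygon_6_vertices
proof (intro conjI ballI allI impI)
  show "{} \<in> polygon 6" by (simp add: polygon_6_iff)
  show "\<tau> \<in> polygon 6" if "\<sigma> \<in> polygon 6" "\<tau> \<subseteq> \<sigma>" for \<sigma> \<tau>
    using that unfolding polygon_6_avoiding avoiding_def by blast
qed simp

lemma polygon_6_dim: "cdim (polygon 6) = 2"
proof (rule cdim_eqI[OF polygon_6_complex])
  fix \<sigma> assume "\<sigma> \<in> polygon 6"
  then obtain i where i: "i < 6" "\<sigma> \<subseteq> {i, Suc i mod 6}" using polygon_6_pure by blast
  have "i \<noteq> Suc i mod 6" by presburger
  then have "card {i, Suc i mod 6} = 2" by simp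
  then show "\<exists>\<tau>\<in>polygon 6. \<sigma> \<subseteq> \<tau> \<and> card \<tau> = 2" using i polygon_6_edge by blast
qed

lemma split_relations_complement:
  assumes "\<And>N v. N \<in> P \<Longrightarrow> v \<in> N \<Longrightarrow> v \<in> E \<longleftrightarrow> v \<notin> E'"
  shows "split_relations UNIV P E \<subseteq> split_relations UNIV P E'"
proof
  fix c assume "c \<in> split_relations UNIV P E"
  then obtain s where s: "\<forall>N\<in>P. \<forall>u\<in>N. \<forall>v\<in>N. c u - s * of_bool (u \<in> E) = c v - s * of_bool (v \<in> E)"
    unfolding split_relations_def by blast
  show "c \<in> split_relations UNIV P E'"
  proof (rule split_relationsI[of "- s"])
    fix N u v assume N: "N \<in> P" "u \<in> N" "v \<in> N"
    show "c u - - s * of_bool (u \<in> E') = c v - - s * of_bool (v \<in> E')"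
      using s[rule_format, OF N] assms[OF N(1,2)] assms[OF N(1,3)]
      by (cases "u \<in> E'"; cases "v \<in> E'") auto
  qed simp
qed

lemma split_relations_cong:
  assumes "\<And>N v. N \<in> P \<Longrightarrow> v \<in> N \<Longrightarrow> v \<in> E \<longleftrightarrow> v \<in> E'"
  shows "split_relations S P E = split_relations S P E'"
  unfolding split_relations_def using assms by (auto cong: ball_cong)

lemma polygon_6_nonadjacent:
  assumes "x \<in> {0, 1, 2, 3, 4, 5}" "y \<in> {0, 1, 2, 3, 4, 5}"
    and "x \<in> {0, 2, 4} \<longleftrightarrow> y \<notin> {0, 2, 4}" "{x, y} \<notin> polygon 6"
  shows "{x, y} \<in> hexagon_pairs"
proof -
  have "x = 0 \<or> x = 1 \<or> x = 2 \<or> x = 3 \<or> x = 4 \<or> x = 5"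
    "y = 0 \<or> y = 1 \<or> y = 2 \<or> y = 3 \<or> y = 4 \<or> y = 5"
    using assms(1,2) by simp_all
  then show ?thesis
    using assms(3,4)
    by (elim disjE; simp add: polygon_6_iff hexagon_pairs_def insert_commute)
qed

text \<open>The classification provides some bisection of some partition. Here the blocks have two elements, one
  in \<open>E\<close> and one outside, and two elements on the same side are not adjacent. So \<open>E\<close> alternates around the
  hexagon, and each block consists of two non-adjacent vertices of different parity, which are antipodal.\<close>

lemma hexagon_fan_relations:
  assumes opt: "optimal_fan (polygon 6) mu P'"
  shows "unimodular_complex (polygon 6) mu"
    "relations (cdim (polygon 6)) {..<6} mu = split_relations UNIV hexagon_pairs {0, 2, 4}"
proof -
  interpret optimal_fan "polygon 6" mu P' by (rule opt)
  have part': "partition_on {..<6} P'" using part unfolding polygon_6_vertices .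
  have pic: "picard (polygon 6) = 4" by (simp add: picard_def polygon_6_vertices polygon_6_dim)
  have six: "(\<Sum>N\<in>P'. card N) = 6" using card_vertices unfolding polygon_6_vertices by simp
  have "(\<Sum>N\<in>P'. 2) \<le> (\<Sum>N\<in>P'. card N)" by (rule sum_mono) (use block_card in auto)
  then have "int (card P') \<noteq> picard (polygon 6)" using six pic by simp
  then obtain E where E: "card P' = 3" "bisects E P'" "polygon 6 = avoiding {..<6} (crossing_nonfaces P' E)"
    "relations (cdim (polygon 6)) {..<6} mu = split_relations UNIV P' E" "unimodular_complex (polygon 6) mu"
    using hexagonal_case pic unfolding polygon_6_vertices by force
  show "unimodular_complex (polygon 6) mu" by (rule E(5))
  have two: "card N = 2" if N: "N \<in> P'" for N
  proof -
    have "(\<Sum>N\<in>P'. card N - 2) + (\<Sum>N\<in>P'. 2) = (\<Sum>N\<in>P'. card N)"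
      unfolding sum.distrib[symmetric] by (rule sum.cong) (use block_card in auto)
    then have "(\<Sum>N\<in>P'. card N - 2) = 0" using six E(1) by simp
    then have "card N - 2 = 0" using N finP by simp
    then show ?thesis using block_card N by fastforce
  qed
  have pair: "\<exists>x y. N = {x, y} \<and> x \<in> E \<and> y \<notin> E" if N: "N \<in> P'" for N
  proof -
    obtain x y where xy: "x \<in> N" "x \<in> E" "y \<in> N" "y \<notin> E" using E(2) N unfolding bisects_def by blast
    then have "x \<noteq> y" by blast
    then have "{x, y} = N" using xy two[OF N] fin_block[OF N] by (intro card_subset_eq) auto
    then show ?thesis using xy by blast
  qed
  have nf: "(N \<union> M) \<inter> E \<notin> polygon 6" "(N \<union> M) - E \<notin> polygon 6" if "N \<in> P'" "M \<in> P'" "N \<noteq> M" for N M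
    using that unfolding E(3) avoiding_crossing_iff by blast+
  have alt: "i \<in> E \<longleftrightarrow> j \<notin> E" if ij: "i < 6" "j < 6" "i \<noteq> j" "{i, j} \<in> polygon 6" for i j
  proof (rule ccontr)
    assume same: "\<not> (i \<in> E \<longleftrightarrow> j \<notin> E)"
    obtain N where N: "N \<in> P'" "i \<in> N" using partition_blockE[OF part', of i] ij by blast
    obtain M where M: "M \<in> P'" "j \<in> M" using partition_blockE[OF part', of j] ij by blast
    obtain x y where xy: "N = {x, y}" "x \<in> E" "y \<notin> E" using pair[OF N(1)] by blast
    obtain x' y' where xy': "M = {x', y'}" "x' \<in> E" "y' \<notin> E" using pair[OF M(1)] by blast
    show False
    proof (cases "i \<in> E")
      case True
      then have "j \<in> E" using same by blast
      then have "i = x" "j = x'" using True N M xy xy' by auto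
      then have "(N \<union> M) \<inter> E = {i, j}" "N \<noteq> M" using xy xy' ij(3) by auto
      then show False using nf(1)[OF N(1) M(1)] ij(4) by simp
    next
      case False
      then have "j \<notin> E" using same by blast
      then have "i = y" "j = y'" using False N M xy xy' by auto
      then have "(N \<union> M) - E = {i, j}" "N \<noteq> M" using xy xy' ij(3) by auto
      then show False using nf(2)[OF N(1) M(1)] ij(4) by simp
    qed
  qed
  have edge: "{0, 1} \<in> polygon 6" "{1, 2} \<in> polygon 6" "{2, 3} \<in> polygon 6" "{3, 4} \<in> polygon 6" "{4, 5} \<in> polygon 6"
    by (simp_all add: polygon_6_iff)
  have E_alt: "1 \<in> E \<longleftrightarrow> 0 \<notin> E" "2 \<in> E \<longleftrightarrow> 0 \<in> E" "3 \<in> E \<longleftrightarrow> 0 \<notin> E" "4 \<in> E \<longleftrightarrow> 0 \<in> E" "5 \<in> E \<longleftrightarrow> 0 \<notin> E"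
    using alt[of 0 1] alt[of 1 2] alt[of 2 3] alt[of 3 4] alt[of 4 5] edge by auto
  have side: "v \<in> E \<longleftrightarrow> (v \<in> {0, 2, 4} \<longleftrightarrow> 0 \<in> E)" if "v < 6" for v
  proof -
    have "v \<in> {0, 1, 2, 3, 4, 5}" using that less_6 by blast
    then show ?thesis using E_alt by auto
  qed
  have "P' \<subseteq> hexagon_pairs"
  proof
    fix N assume N: "N \<in> P'"
    obtain x y where xy: "N = {x, y}" "x \<in> E" "y \<notin> E" using pair[OF N] by blast
    have lt: "x < 6" "y < 6" using partition_block_subset[OF part' N] xy by auto
    have non: "{x, y} \<notin> polygon 6" using block_nonface[OF N] xy by simp
    have par: "x \<in> {0, 2, 4} \<longleftrightarrow> y \<notin> {0, 2, 4}" using side[OF lt(1)] side[OF lt(2)] xy by blast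
    have "x \<in> {0, 1, 2, 3, 4, 5}" "y \<in> {0, 1, 2, 3, 4, 5}" using lt less_6 by blast+
    then show "N \<in> hexagon_pairs"
      unfolding xy(1) by (rule polygon_6_nonadjacent) (rule par, rule non)
  qed
  then have PP: "P' = hexagon_pairs" by (rule partition_subset_eq[OF part' hexagon_pairs_partition])
  have lt: "v < 6" if "N \<in> hexagon_pairs" "v \<in> N" for N v
    using partition_block_subset[OF hexagon_pairs_partition that(1)] that(2) by blast
  show "relations (cdim (polygon 6)) {..<6} mu = split_relations UNIV hexagon_pairs {0, 2, 4}"
  proof (cases "0 \<in> E")
    case True
    have "split_relations UNIV hexagon_pairs E = split_relations UNIV hexagon_pairs {0, 2, 4}"
      by (rule split_relations_cong) (use True side lt in blast)
    then show ?thesis using E(4) PP by simp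
  next
    case False
    have "split_relations UNIV hexagon_pairs E \<subseteq> split_relations UNIV hexagon_pairs {0, 2, 4}"
      by (rule split_relations_complement) (use False side lt in blast)
    moreover have "split_relations UNIV hexagon_pairs {0, 2, 4} \<subseteq> split_relations UNIV hexagon_pairs E"
      by (rule split_relations_complement) (use False side lt in blast)
    ultimately show ?thesis using E(4) PP by simp
  qed
qed

text \<open>The rays of the projective plane blown up at three points, in cyclic order.\<close>

definition hexagon_vec :: "nat \<Rightarrow> int vec" where
  "hexagon_vec v = vec 2 (\<lambda>j. if j = 0 then [1, 1, 0, -1, -1, 0] ! v else [0, 1, 1, 0, -1, -1] ! v)"

lemma unimodular_pair:
  assumes uv: "u \<noteq> v" and car: "lam u \<in> carrier_vec 2" "lam v \<in> carrier_vec 2"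
    and det: "lam u $ 0 * lam v $ 1 - lam v $ 0 * lam u $ 1 = 1"
  shows "unimodular 2 lam {u, v}"
proof -
  let ?g = "\<lambda>w j. if w = u then if j = 0 then lam v $ 1 else - lam v $ 0
      else if j = 0 then - lam u $ 1 else lam u $ (0 :: nat)"
  have two: "{..<2::nat} = {0, 1}" by auto
  show ?thesis
  proof (rule unimodularI[where g = ?g])
    show "(\<Sum>w\<in>{u, v}. lam w $ i * ?g w j) = (if i = j then 1 else 0)" if "i < 2" "j < 2" for i j
    proof -
      have "i \<in> {0, 1}" "j \<in> {0, 1}" using that by auto
      then show ?thesis using uv det by (auto simp: algebra_simps)
    qed
    show "(\<Sum>j<2. ?g w j * lam z $ j) = (if w = z then 1 else 0)" if "w \<in> {u, v}" "z \<in> {u, v}" for w z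
      using that uv det unfolding two by (auto simp: algebra_simps)
  qed (use car in auto)
qed

text \<open>The coordinates of \<open>(x, y)\<close> have a closed form that is valid in all six cones: between the rays \<open>(1, 0)\<close> and
  \<open>(1, 1)\<close>, for example, they are \<open>x - y\<close> and \<open>y\<close>, and outside the two cones at a ray its coordinate is \<open>0\<close>.\<close>

lemma hexagon_fan:
  shows "fan_giving (polygon 6) hexagon_vec" "optimal_partition (polygon 6) hexagon_vec hexagon_pairs"
proof -
  have sums: "(\<Sum>v<6. c v * real_of_int (hexagon_vec v $ 0)) = c 0 + c 1 - c 3 - c 4"
    "(\<Sum>v<6. c v * real_of_int (hexagon_vec v $ 1)) = c 1 + c 2 - c 4 - c 5" for c
    unfolding less_6 by (simp_all add: hexagon_vec_def)
  have two: "(\<forall>j<2. Q j) \<longleftrightarrow> Q 0 \<and> Q 1" for Q :: "nat \<Rightarrow> bool"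
    by (auto simp: numeral_2_eq_2 less_Suc_eq)
  have car: "hexagon_vec v \<in> carrier_vec 2" for v by (simp add: hexagon_vec_def)
  have unc: "unimodular_complex (polygon 6) hexagon_vec"
    unfolding unimodular_complex_def polygon_6_dim
  proof (intro conjI ballI polygon_6_complex car)
    fix \<sigma> assume "\<sigma> \<in> polygon 6"
    then obtain i where i: "i < 6" "\<sigma> \<subseteq> {i, Suc i mod 6}" using polygon_6_pure by blast
    have "i \<in> {0, 1, 2, 3, 4, 5}" using i less_6 by blast
    then have "hexagon_vec i $ 0 * hexagon_vec (Suc i mod 6) $ 1 - hexagon_vec (Suc i mod 6) $ 0 * hexagon_vec i $ 1 = 1"
      by (auto simp: hexagon_vec_def)
    moreover have "i \<noteq> Suc i mod 6" by presburger
    ultimately have "unimodular 2 hexagon_vec {i, Suc i mod 6}" by (intro unimodular_pair car)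
    then show "\<exists>\<tau>\<in>polygon 6. \<sigma> \<subseteq> \<tau> \<and> unimodular 2 hexagon_vec \<tau>"
      using i polygon_6_edge by blast
  qed
  have coord: "c 0 = max 0 (min x (x - y))" "c 1 = max 0 (min x y)" "c 2 = max 0 (min y (y - x))"
      "c 3 = max 0 (min (- x) (y - x))" "c 4 = max 0 (min (- x) (- y))" "c 5 = max 0 (min (- y) (x - y))"
    if c: "cone_coordinates (polygon 6) c" and x: "c 0 + c 1 - c 3 - c 4 = x" and y: "c 1 + c 2 - c 4 - c 5 = y" for c x y
  proof -
    have nn: "0 \<le> c 0" "0 \<le> c 1" "0 \<le> c 2" "0 \<le> c 3" "0 \<le> c 4" "0 \<le> c 5"
      using c by (auto simp: cone_coordinates_def)
    have z: "c 0 = 0 \<or> c 2 = 0" "c 1 = 0 \<or> c 3 = 0" "c 2 = 0 \<or> c 4 = 0" "c 3 = 0 \<or> c 5 = 0"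
      "c 4 = 0 \<or> c 0 = 0" "c 5 = 0 \<or> c 1 = 0" "c 0 = 0 \<or> c 3 = 0" "c 1 = 0 \<or> c 4 = 0" "c 2 = 0 \<or> c 5 = 0"
      using c by (auto simp: cone_coordinates_def polygon_6_iff)
    consider "c 2 = 0" "c 3 = 0" "c 4 = 0" "c 5 = 0" | "c 3 = 0" "c 4 = 0" "c 5 = 0" "c 0 = 0"
      | "c 4 = 0" "c 5 = 0" "c 0 = 0" "c 1 = 0" | "c 5 = 0" "c 0 = 0" "c 1 = 0" "c 2 = 0"
      | "c 0 = 0" "c 1 = 0" "c 2 = 0" "c 3 = 0" | "c 1 = 0" "c 2 = 0" "c 3 = 0" "c 4 = 0"
      using z by blast
    then have "c 0 = max 0 (min x (x - y)) \<and> c 1 = max 0 (min x y) \<and> c 2 = max 0 (min y (y - x)) \<and>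
        c 3 = max 0 (min (- x) (y - x)) \<and> c 4 = max 0 (min (- x) (- y)) \<and> c 5 = max 0 (min (- y) (x - y))"
    proof cases
      case 1
      then have "x = c 0 + c 1" "y = c 1" using x y by auto
      then show ?thesis using 1 nn by (simp add: max_def min_def)
    next
      case 2
      then have "x = c 1" "y = c 1 + c 2" using x y by auto
      then show ?thesis using 2 nn by (simp add: max_def min_def)
    next
      case 3
      then have "x = - c 3" "y = c 2" using x y by auto
      then show ?thesis using 3 nn by (simp add: max_def min_def)
    next
      case 4
      then have "x = - c 3 - c 4" "y = - c 4" using x y by auto
      then show ?thesis using 4 nn by (simp add: max_def min_def)
    next
      case 5
      then have "x = - c 4" "y = - c 4 - c 5" using x y by auto
      then show ?thesis using 5 nn by (simp add: max_def min_def)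
    next
      case 6
      then have "x = c 0" "y = - c 5" using x y by auto
      then show ?thesis using 6 nn by (simp add: max_def min_def)
    qed
    then show "c 0 = max 0 (min x (x - y))" "c 1 = max 0 (min x y)" "c 2 = max 0 (min y (y - x))"
      "c 3 = max 0 (min (- x) (y - x))" "c 4 = max 0 (min (- x) (- y))" "c 5 = max 0 (min (- y) (x - y))"
      by blast+
  qed
  have "unique_coordinates (polygon 6) hexagon_vec"
    unfolding unique_coordinates_def polygon_6_dim polygon_6_vertices two sums
  proof (intro conjI allI impI)
    fix p :: "nat \<Rightarrow> real"
    define x where "x = p 0"
    define y where "y = p 1"
    define c where "c v = (if v = 0 then max 0 (min x (x - y)) else if v = 1 then max 0 (min x y)
        else if v = 2 then max 0 (min y (y - x)) else if v = 3 then max 0 (min (- x) (y - x))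
        else if v = 4 then max 0 (min (- x) (- y)) else if v = 5 then max 0 (min (- y) (x - y)) else 0)" for v :: nat
    have cs: "c 0 = max 0 (min x (x - y))" "c 1 = max 0 (min x y)" "c 2 = max 0 (min y (y - x))"
      "c 3 = max 0 (min (- x) (y - x))" "c 4 = max 0 (min (- x) (- y))" "c 5 = max 0 (min (- y) (x - y))"
      by (simp_all add: c_def)
    have "c v = 0" if "\<not> v < 6" for v using that by (simp add: c_def)
    then have "{v. c v \<noteq> 0} \<subseteq> {..<6}" by blast
    moreover
    have nz: "c 0 \<noteq> 0 \<longleftrightarrow> 0 < x \<and> y < x" "c 1 \<noteq> 0 \<longleftrightarrow> 0 < x \<and> 0 < y" "c 2 \<noteq> 0 \<longleftrightarrow> 0 < y \<and> x < y"
      "c 3 \<noteq> 0 \<longleftrightarrow> x < 0 \<and> x < y" "c 4 \<noteq> 0 \<longleftrightarrow> x < 0 \<and> y < 0" "c 5 \<noteq> 0 \<longleftrightarrow> y < 0 \<and> y < x"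
      unfolding cs by linarith+
    have "\<not> (c 0 \<noteq> 0 \<and> c 2 \<noteq> 0) \<and> \<not> (c 1 \<noteq> 0 \<and> c 3 \<noteq> 0) \<and> \<not> (c 2 \<noteq> 0 \<and> c 4 \<noteq> 0) \<and>
        \<not> (c 3 \<noteq> 0 \<and> c 5 \<noteq> 0) \<and> \<not> (c 4 \<noteq> 0 \<and> c 0 \<noteq> 0) \<and> \<not> (c 5 \<noteq> 0 \<and> c 1 \<noteq> 0) \<and>
        \<not> (c 0 \<noteq> 0 \<and> c 3 \<noteq> 0) \<and> \<not> (c 1 \<noteq> 0 \<and> c 4 \<noteq> 0) \<and> \<not> (c 2 \<noteq> 0 \<and> c 5 \<noteq> 0)"
      unfolding nz by (intro conjI notI; elim conjE; linarith)
    ultimately have "{v. c v \<noteq> 0} \<in> polygon 6"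
      unfolding polygon_6_iff insert_subset mem_Collect_eq by blast
    moreover have "0 \<le> c v" for v by (simp add: c_def)
    ultimately have "cone_coordinates (polygon 6) c" by (simp add: cone_coordinates_def)
    moreover have "c 0 + c 1 - c 3 - c 4 = x" "c 1 + c 2 - c 4 - c 5 = y"
      unfolding cs by linarith+
    ultimately show "\<exists>c. cone_coordinates (polygon 6) c \<and> c 0 + c 1 - c 3 - c 4 = p 0 \<and> c 1 + c 2 - c 4 - c 5 = p 1"
      by (auto simp: x_def y_def)
  next
    fix c d :: "nat \<Rightarrow> real"
    assume c: "cone_coordinates (polygon 6) c" and d: "cone_coordinates (polygon 6) d"
      and cd: "(\<lambda>v. c v - d v) \<in> relations 2 {..<6} hexagon_vec"
    then have eq: "c 0 + c 1 - c 3 - c 4 = d 0 + d 1 - d 3 - d 4" "c 1 + c 2 - c 4 - c 5 = d 1 + d 2 - d 4 - d 5"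
      unfolding relations_def mem_Collect_eq two sums by simp_all
    show "c = d"
    proof
      fix v
      show "c v = d v"
      proof (cases "v < 6")
        case True
        then have "v \<in> {0, 1, 2, 3, 4, 5}" using less_6 by blast
        then show ?thesis using coord[OF c eq] coord[OF d HOL.refl HOL.refl] by auto
      next
        case False
        have "{v. c v \<noteq> 0} \<subseteq> {..<6}" "{v. d v \<noteq> 0} \<subseteq> {..<6}"
          using c d by (auto simp: cone_coordinates_def polygon_6_iff)
        then have "v \<notin> {v. c v \<noteq> 0}" "v \<notin> {v. d v \<noteq> 0}" using False by blast+
        then show ?thesis by simp
      qed
    qed
  qed
  then show "fan_giving (polygon 6) hexagon_vec" by (rule fan_givingI[OF unc])
  show "optimal_partition (polygon 6) hexagon_vec hexagon_pairs"
    unfolding optimal_partition_def polygon_6_vertices polygon_6_dim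
  proof (intro conjI ballI hexagon_pairs_partition)
    fix N assume N: "N \<in> hexagon_pairs"
    have sub: "N \<subseteq> {..<6}" by (rule partition_block_subset[OF hexagon_pairs_partition N])
    have non: "N \<notin> polygon 6" using N by (auto simp: hexagon_pairs_def polygon_6_iff)
    have "\<sigma> \<in> polygon 6" if \<sigma>: "\<sigma> \<subset> N" for \<sigma>
    proof -
      have "card \<sigma> < 2" using psubset_card_mono[of N \<sigma>] \<sigma> hexagon_pairs_card(1) N finite_subset[OF sub] by auto
      moreover have "finite \<sigma>" using \<sigma> sub finite_subset[of \<sigma> "{..<6}"] by auto
      ultimately have "\<sigma> = {} \<or> (\<exists>v. \<sigma> = {v})"
        by (cases "card \<sigma>") (auto simp: card_1_singleton_iff less_Suc_eq numeral_2_eq_2)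
      then show ?thesis
      proof
        assume "\<exists>v. \<sigma> = {v}"
        then obtain v where v: "\<sigma> = {v}" by blast
        then have "v \<in> {..<6}" using \<sigma> sub by blast
        then show ?thesis
          unfolding v using polygon_6_vertices abstract_complex_vertex[OF polygon_6_complex] by blast
      qed (use abstract_complexD(2)[OF polygon_6_complex] in simp)
    qed
    then show "minimal_nonface (polygon 6) N"
      unfolding minimal_nonface_def polygon_6_vertices using sub non by blast
    show "vec 2 (\<lambda>j. \<Sum>v\<in>N. hexagon_vec v $ j) = 0\<^sub>v 2"
      using N by (intro eq_vecI) (auto simp: hexagon_pairs_def hexagon_vec_def)
  qed
qed

section \<open>The base complexes and the classification\<close>

lemma bd_simplex_1: "bd_simplex 1 = bd_cross_polytope 1"
proof -
  have "{..1} = {0, 1::nat}" "{..<2 * 1} = {0, 1::nat}" by auto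
  then show ?thesis unfolding bd_simplex_def bd_cross_polytope_def by auto
qed

lemma polygon_4: "polygon 4 = avoiding {..<4} {{0, 2}, {1, 3}}"
proof (rule Set.set_eqI)
  fix \<sigma>
  have four: "{..<4::nat} = {0, 1, 2, 3}" by auto
  have im: "polygon 4 = {{}} \<union> (\<lambda>i. {i}) ` {..<4} \<union> (\<lambda>i. {i, Suc i mod 4}) ` {..<4}"
    unfolding polygon_def by blast
  have poly: "polygon 4 = {{}, {0}, {1}, {2}, {3}, {0, 1}, {1, 2}, {2, 3}, {3, 0}}"
    unfolding im four by (simp add: insert_commute flip: numeral_2_eq_2)
  show "\<sigma> \<in> polygon 4 \<longleftrightarrow> \<sigma> \<in> avoiding {..<4} {{0, 2}, {1, 3}}"
  proof (cases "\<sigma> \<subseteq> {0, 1, 2, 3}")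
    case True
    have eq: "\<sigma> = T \<longleftrightarrow> (\<forall>i\<in>{0, 1, 2, 3}. i \<in> \<sigma> \<longleftrightarrow> i \<in> T)" if "T \<subseteq> {0, 1, 2, 3}" for T
      using True that by blast
    have "\<sigma> \<in> polygon 4 \<longleftrightarrow> \<not> (0 \<in> \<sigma> \<and> 2 \<in> \<sigma>) \<and> \<not> (1 \<in> \<sigma> \<and> 3 \<in> \<sigma>)"
      unfolding poly by (simp add: eq) argo
    then show ?thesis using True unfolding four avoiding_def by simp
  next
    case False
    then show ?thesis unfolding poly four avoiding_def by auto
  qed
qed

text \<open>The base complexes other than the hexagon: boundaries of cross polytopes, the first two in disguise
  as a pair of points and as a square.\<close>

definition product_base :: "int \<Rightarrow> nat set set \<Rightarrow> bool" where
  "product_base p B \<longleftrightarrow> (\<exists>V P. B = avoiding V P \<and> finite V \<and> partition_on V P \<and>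
     (\<forall>N\<in>P. card N = 2) \<and> int (card P) = p)"

lemma product_base_cross_polytope: "product_base (int d) (bd_cross_polytope d)"
  unfolding product_base_def bd_cross_polytope_avoiding
  using antipodal_pairs_partition[of d] antipodal_pairs_card[of d]
  by (intro exI[of _ "{..<2 * d}"] exI[of _ "antipodal_pairs d"]) simp

lemma product_base_square: "product_base 2 (polygon 4)"
proof -
  have "partition_on {..<4} {{0, 2}, {1, 3::nat}}"
    unfolding partition_on_def disjoint_def by auto
  moreover have "card {{0, 2}, {1, 3::nat}} = 2" by (simp add: doubleton_eq_iff)
  ultimately show ?thesis unfolding product_base_def polygon_4
    by (intro exI[of _ "{..<4}"] exI[of _ "{{0, 2}, {1, 3}}"]) auto
qed

lemma base_complexes_cases:
  assumes "1 \<le> p" "p \<le> 4" "B \<in> base_complexes p"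
  shows "product_base p B \<or> p = 4 \<and> B = polygon 6"
proof -
  have "p = 1 \<or> p = 2 \<or> p = 3 \<or> p = 4" using assms by linarith
  then show ?thesis
    using assms(3) product_base_square product_base_cross_polytope[of 1]
      product_base_cross_polytope[of 3] product_base_cross_polytope[of 4]
    by (elim disjE) (auto simp: base_complexes_def bd_simplex_1 simp del: One_nat_def)
qed

lemma product_base_exists:
  assumes "1 \<le> p" "p \<le> 4"
  shows "\<exists>B\<in>base_complexes p. product_base p B"
proof -
  have "p = 1 \<or> p = 2 \<or> p = 3 \<or> p = 4" using assms by linarith
  then show ?thesis
    using product_base_square product_base_cross_polytope[of 1]
      product_base_cross_polytope[of 3] product_base_cross_polytope[of 4]
    by (elim disjE) (auto simp: base_complexes_def bd_simplex_1 simp del: One_nat_def)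
qed

lemma base_fan:
  assumes p: "1 \<le> p" "p \<le> 4" and B: "B \<in> base_complexes p"
  shows "\<exists>mu P. optimal_fan B mu P"
    "\<exists>R. \<forall>mu P. optimal_fan B mu P \<longrightarrow> unimodular_complex B mu \<and> relations (cdim B) (\<Union>B) mu = R"
proof -
  have "(\<exists>mu P. optimal_fan B mu P) \<and>
    (\<exists>R. \<forall>mu P. optimal_fan B mu P \<longrightarrow> unimodular_complex B mu \<and> relations (cdim B) (\<Union>B) mu = R)"
    using base_complexes_cases[OF p B]
  proof
    assume "product_base p B"
    then obtain V P where V: "B = avoiding V P" "finite V" "partition_on V P" and two: "\<forall>N\<in>P. card N = 2"
      unfolding product_base_def by blast
    have two': "\<forall>N\<in>P. 2 \<le> card N" using two by simp
    note pc = partition_complex[OF V(2,3) two']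
    obtain mu P' where "fan_giving (avoiding V P) mu" "optimal_partition (avoiding V P) mu P'"
      by (rule product_fan_exists[OF V(2,3) two'])
    then have "optimal_fan B mu P'" unfolding V(1) using pc(1) by unfold_locales
    moreover have "\<forall>mu P'. optimal_fan B mu P' \<longrightarrow>
        unimodular_complex B mu \<and> relations (cdim B) (\<Union>B) mu = split_relations {0} P {}"
      unfolding V(1) pc(2) using product_fan_relations[OF V(2,3) two'] by blast
    ultimately show ?thesis by blast
  next
    assume "p = 4 \<and> B = polygon 6"
    then have B: "B = polygon 6" by simp
    have "optimal_fan B hexagon_vec hexagon_pairs"
      unfolding B using polygon_6_complex hexagon_fan by unfold_locales
    moreover have "\<forall>mu P'. optimal_fan B mu P' \<longrightarrow>
        unimodular_complex B mu \<and> relations (cdim B) (\<Union>B) mu = split_relations UNIV hexagon_pairs {0, 2, 4}"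
      unfolding B polygon_6_vertices using hexagon_fan_relations by blast
    ultimately show ?thesis by blast
  qed
  then show "\<exists>mu P. optimal_fan B mu P"
    "\<exists>R. \<forall>mu P. optimal_fan B mu P \<longrightarrow> unimodular_complex B mu \<and> relations (cdim B) (\<Union>B) mu = R"
    by blast+
qed

text \<open>The blocks of \<open>P\<close> are matched with the pairs of antipodal vertices of the base complex, and each block is
  cut into two parts that are sent to the two vertices of its pair: by an arbitrary cut in the product
  case, and by \<open>E\<close> in the hexagonal case.\<close>

lemma (in optimal_fan) pulled_back_from_base:
  assumes p: "1 \<le> picard K" "picard K \<le> 4"
  shows "\<exists>B\<in>base_complexes (picard K). \<forall>mu P0. optimal_fan B mu P0 \<longrightarrow>
    (\<exists>q. q ` V = \<Union>B \<and> K = pullback V q B \<and> R = pull_relations V q (relations (cdim B) (\<Union>B) mu))"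
proof (cases "int (card P) = picard K")
  case True
  obtain B where B: "B \<in> base_complexes (picard K)" "product_base (picard K) B"
    using product_base_exists[OF p] by blast
  then obtain V0 P0 where V0: "B = avoiding V0 P0" "finite V0" "partition_on V0 P0"
    and two: "\<forall>N\<in>P0. card N = 2" and card: "int (card P0) = picard K"
    unfolding product_base_def by blast
  have two': "\<forall>N\<in>P0. 2 \<le> card N" using two by simp
  have "card P = card P0" using True card by simp
  then obtain q where q: "q ` V = V0" "pullback V q (avoiding V0 P0) = avoiding V P"
    "\<And>E E0. pull_relations V q (split_relations {0} P0 E0) = split_relations {0} P E"
    using product_pullback[OF finV part block_card V0(2,3) two] by blast
  note pc = partition_complex[OF V0(2,3) two']
  have "\<exists>q. q ` V = \<Union>B \<and> K = pullback V q B \<and> R = pull_relations V q (relations (cdim B) (\<Union>B) mu)"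
    if mu: "optimal_fan B mu P1" for mu P1
  proof (intro exI[of _ q] conjI)
    show "q ` V = \<Union>B" unfolding V0(1) pc(2) by (rule q(1))
    show "K = pullback V q B" unfolding V0(1) q(2) by (rule product_case(1)[OF True])
    have "relations (cdim B) (\<Union>B) mu = split_relations {0} P0 {}"
      using product_fan_relations(2)[OF V0(2,3) two'] mu unfolding V0(1) pc(2) by blast
    then show "R = pull_relations V q (relations (cdim B) (\<Union>B) mu)"
      using product_case(2)[OF True] q(3) by simp
  qed
  then show ?thesis using B(1) by blast
next
  case False
  obtain E where E: "picard K = 4" "card P = 3" "bisects E P" "K = avoiding V (crossing_nonfaces P E)"
    "R = split_relations UNIV P E"
    by (rule hexagonal_case[OF False p(2)])
  have B: "polygon 6 \<in> base_complexes (picard K)" by (simp add: base_complexes_def E(1))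
  obtain \<beta> where \<beta>: "bij_betw \<beta> P hexagon_pairs"
    using finite_same_card_bij[of P hexagon_pairs] finP hexagon_pairs_card E(2)
    by (auto simp: hexagon_pairs_def)
  obtain q where q: "q ` V = {..<6}"
    "\<And>N v. N \<in> P \<Longrightarrow> v \<in> V \<Longrightarrow> q v \<in> \<beta> N \<longleftrightarrow> v \<in> N"
    "\<And>v. v \<in> V \<Longrightarrow> q v \<in> {0, 2, 4} \<longleftrightarrow> v \<in> E"
    "\<And>u v N. N \<in> P \<Longrightarrow> u \<in> N \<Longrightarrow> v \<in> N \<Longrightarrow> (u \<in> E \<longleftrightarrow> v \<in> E) \<Longrightarrow> q u = q v"
    using bisected_map[OF part E(3) hexagon_pairs_partition hexagon_pairs_bisected
        bspec[OF hexagon_pairs_card(1)] \<beta>] by blast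
  have "crossing_nonfaces hexagon_pairs {0, 2, 4} \<subseteq> Pow {..<6}"
    using partition_block_subset[OF hexagon_pairs_partition] unfolding crossing_nonfaces_def by blast
  then have "pullback V q (polygon 6) = avoiding V ((\<lambda>X. {v \<in> V. q v \<in> X}) ` crossing_nonfaces hexagon_pairs {0, 2, 4})"
    unfolding polygon_6_avoiding
    by (intro avoiding_pullback q(1) polygon_6_vertices[unfolded polygon_6_avoiding]) blast
  also have "(\<lambda>X. {v \<in> V. q v \<in> X}) ` crossing_nonfaces hexagon_pairs {0, 2, 4} = crossing_nonfaces P E"
    by (rule preimage_crossing[OF part hexagon_pairs_partition \<beta> q])
  finally have pull: "K = pullback V q (polygon 6)" using E(4) by simp
  have R: "pull_relations V q (split_relations UNIV hexagon_pairs {0, 2, 4}) = R"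
    unfolding E(5) by (rule pull_split_relations[OF part hexagon_pairs_partition \<beta> q])
  have "\<exists>q. q ` V = \<Union>(polygon 6) \<and> K = pullback V q (polygon 6) \<and>
      R = pull_relations V q (relations (cdim (polygon 6)) (\<Union>(polygon 6)) mu)"
    if mu: "optimal_fan (polygon 6) mu P1" for mu P1
    unfolding polygon_6_vertices hexagon_fan_relations(2)[OF mu] using q(1) pull R by blast
  then show ?thesis using B by blast
qed

text \<open>The notion of a pullback is invariant under isomorphism.\<close>

lemma pull_iso_inverse:
  assumes iso: "complex_iso f K L" and L: "L = pullback (\<Union>L) q B" "q ` \<Union>L = \<Union>B"
    and B: "abstract_complex B" and K: "finite (\<Union>K)"
  shows "K = pullback (\<Union>K) (\<lambda>v. q (f v)) B" "(\<lambda>v. q (f v)) ` \<Union>K = \<Union>B"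
proof -
  have inj: "inj_on f (\<Union>K)" and im: "(\<lambda>\<sigma>. f ` \<sigma>) ` K = L"
    using iso by (auto simp: complex_iso_def)
  have fV: "f ` \<Union>K = \<Union>L" unfolding im[symmetric] by blast
  then have bij: "bij_betw f (\<Union>K) (\<Union>L)" using inj by (simp add: bij_betw_def)
  show surj: "(\<lambda>v. q (f v)) ` \<Union>K = \<Union>B" using fV L(2) by (metis image_image)
  define M where "M = pullback (\<Union>K) (\<lambda>v. q (f v)) B"
  have "complex_iso f M (pullback (\<Union>L) q B)"
    unfolding M_def by (rule pullback_iso[OF bij B K surj]) simp
  then have "(\<lambda>\<sigma>. f ` \<sigma>) ` M = L" using L(1) by (simp add: complex_iso_def)
  then have "(\<lambda>\<sigma>. f ` \<sigma>) ` M = (\<lambda>\<sigma>. f ` \<sigma>) ` K" using im by simp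
  moreover have "M \<subseteq> Pow (\<Union>K)" unfolding M_def pullback_def by blast
  moreover have "K \<subseteq> Pow (\<Union>K)" by blast
  ultimately show "K = pullback (\<Union>K) (\<lambda>v. q (f v)) B"
    using inj_on_image_eq_iff[OF inj_on_image_Pow[OF inj], of K M] unfolding M_def by blast
qed

lemma (in optimal_fan) canonical_realization_of_fan:
  fixes B :: "nat set set"
  assumes B: "unimodular_complex B mu0"
    and q: "q ` V = \<Union>B" "K = pullback V q B" "R = pull_relations V q (relations (cdim B) (\<Union>B) mu0)"
  shows "\<exists>L mu f. canonical_seq B mu0 L mu \<and> complex_iso f K L \<and> dj_equiv K lam (mu \<circ> f)"
proof -
  obtain L mu f \<tau> where L: "canonical_seq B mu0 L mu" "complex_iso f (pullback V q B) L"
    and pb: "pulled_back B mu0 V q (cdim B + (card V - card (\<Union>B))) (mu \<circ> f) \<tau>"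
    by (rule pullback_realization[OF B finV q(1)])
  interpret pb: pulled_back B mu0 V q "cdim B + (card V - card (\<Union>B))" "mu \<circ> f" \<tau> by (rule pb)
  have n: "n = cdim B + (card V - card (\<Union>B))" using pb.cdim_pullback q(2) by simp
  have "char_map K (mu \<circ> f)"
    using unimodular_complex_char_map[OF pb.unimodular_pullback] q(2) by simp
  moreover have "relations n V (mu \<circ> f) = R" using pb.rel q(3) n by simp
  ultimately have "dj_equiv K lam (mu \<circ> f)" by (intro dj_equivI absK char) auto
  then show ?thesis using L q(2) by auto
qed

theorem corollary5p6:
  fixes p :: int
  assumes "1 \<le> p" and "p \<le> 4"
  shows
    "(\<forall>K :: 'a set set. pl_sphere K \<and> picard K = p \<longrightarrow>
        (\<exists>lam. fan_giving K lam \<and> (\<exists>P. optimal_partition K lam P)) \<longleftrightarrow>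
        (\<exists>B\<in>base_complexes p. \<exists>L f. wedge_seq B L \<and> complex_iso f K L)) \<and>
     (\<forall>B\<in>base_complexes p.
        \<exists>mu. fan_giving B mu \<and> (\<exists>P. optimal_partition B mu P) \<and>
          (\<forall>mu'. fan_giving B mu' \<and> (\<exists>P. optimal_partition B mu' P) \<longrightarrow> dj_equiv B mu mu')) \<and>
     (\<forall>(K :: 'a set set) lam P.
        pl_sphere K \<and> picard K = p \<and> fan_giving K lam \<and> optimal_partition K lam P \<longrightarrow>
        (\<exists>B\<in>base_complexes p.
          \<forall>mu\<^sub>0. fan_giving B mu\<^sub>0 \<and> (\<exists>P. optimal_partition B mu\<^sub>0 P) \<longrightarrow>
            (\<exists>L mu f. canonical_seq B mu\<^sub>0 L mu \<and> complex_iso f K L \<and>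
              dj_equiv K lam (mu \<circ> f))))"
proof -
  have absB: "abstract_complex B" if B: "B \<in> base_complexes p" for B
    using base_fan(1)[OF assms B] by (auto simp: optimal_fan_def)
  have base_opt: "optimal_fan B mu P" if "B \<in> base_complexes p" "fan_giving B mu" "optimal_partition B mu P" for B mu P
    using absB[OF that(1)] that(2,3) by unfold_locales
  have un: "unimodular_complex B mu" if "B \<in> base_complexes p" "optimal_fan B mu P" for B mu P
    using base_fan(2)[OF assms that(1)] that(2) by blast
  have third: "\<exists>B\<in>base_complexes p. \<forall>mu0. fan_giving B mu0 \<and> (\<exists>P. optimal_partition B mu0 P) \<longrightarrow>
      (\<exists>L mu f. canonical_seq B mu0 L mu \<and> complex_iso f K L \<and> dj_equiv K lam (mu \<circ> f))"
    if K: "abstract_complex K" "picard K = p" "fan_giving K lam" "optimal_partition K lam P"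
    for K :: "'a set set" and lam P
  proof -
    interpret optimal_fan K lam P using K(1,3,4) by unfold_locales
    obtain B where B: "B \<in> base_complexes p" and q: "\<And>mu P0. optimal_fan B mu P0 \<Longrightarrow>
      \<exists>q. q ` V = \<Union>B \<and> K = pullback V q B \<and> R = pull_relations V q (relations (cdim B) (\<Union>B) mu)"
      using pulled_back_from_base assms K(2) by blast
    have "\<exists>L mu f. canonical_seq B mu0 L mu \<and> complex_iso f K L \<and> dj_equiv K lam (mu \<circ> f)"
      if "fan_giving B mu0" "optimal_partition B mu0 P0" for mu0 P0
    proof -
      have o: "optimal_fan B mu0 P0" by (rule base_opt[OF B that])
      obtain q' where q': "q' ` V = \<Union>B" "K = pullback V q' B"
        "R = pull_relations V q' (relations (cdim B) (\<Union>B) mu0)"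
        using q[OF o] by blast
      show ?thesis by (rule canonical_realization_of_fan[OF un[OF B o] q'])
    qed
    then show ?thesis using B by blast
  qed
  have second: "\<exists>mu. fan_giving B mu \<and> (\<exists>P. optimal_partition B mu P) \<and>
      (\<forall>mu'. fan_giving B mu' \<and> (\<exists>P. optimal_partition B mu' P) \<longrightarrow> dj_equiv B mu mu')"
    if B: "B \<in> base_complexes p" for B
  proof -
    obtain mu P where mu: "optimal_fan B mu P" using base_fan(1)[OF assms B] by blast
    have "dj_equiv B mu mu'" if "fan_giving B mu'" "optimal_partition B mu' P'" for mu' P'
    proof (rule dj_equivI[OF absB[OF B]])
      show "char_map B mu" by (rule optimal_fan.char[OF mu])
      show "char_map B mu'" by (rule optimal_fan.char[OF base_opt[OF B that]])
      show "relations (cdim B) (\<Union>B) mu = relations (cdim B) (\<Union>B) mu'"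
        using base_fan(2)[OF assms B] mu base_opt[OF B that] by metis
    qed
    then show ?thesis using mu unfolding optimal_fan_def by blast
  qed
  have first: "(\<exists>lam. fan_giving K lam \<and> (\<exists>P. optimal_partition K lam P)) \<longleftrightarrow>
      (\<exists>B\<in>base_complexes p. \<exists>L f. wedge_seq B L \<and> complex_iso f K L)"
    if K: "abstract_complex K" "picard K = p" for K :: "'a set set"
  proof
    assume "\<exists>lam. fan_giving K lam \<and> (\<exists>P. optimal_partition K lam P)"
    then obtain lam P where "fan_giving K lam" "optimal_partition K lam P" by blast
    from third[OF K this] obtain B where B: "B \<in> base_complexes p"
      and ex: "\<And>mu0. fan_giving B mu0 \<and> (\<exists>P. optimal_partition B mu0 P) \<Longrightarrow>
        \<exists>L mu f. canonical_seq B mu0 L mu \<and> complex_iso f K L \<and> dj_equiv K lam (mu \<circ> f)" by blast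
    obtain mu0 where "fan_giving B mu0 \<and> (\<exists>P. optimal_partition B mu0 P)" using second[OF B] by blast
    from ex[OF this] obtain L mu f where "canonical_seq B mu0 L mu" "complex_iso f K L" by blast
    then show "\<exists>B\<in>base_complexes p. \<exists>L f. wedge_seq B L \<and> complex_iso f K L"
      using B canonical_seq_wedge_seq by blast
  next
    assume "\<exists>B\<in>base_complexes p. \<exists>L f. wedge_seq B L \<and> complex_iso f K L"
    then obtain B L f where B: "B \<in> base_complexes p" and L: "wedge_seq B L" "complex_iso f K L" by blast
    obtain q where q: "q ` \<Union>L = \<Union>B" "L = pullback (\<Union>L) q B"
      using wedge_seq_pullback[OF L(1) absB[OF B]] by blast
    have finK: "finite (\<Union>K)" using abstract_complexD(1)[OF K(1)] .
    note pull = pull_iso_inverse[OF L(2) q(2,1) absB[OF B] finK]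
    obtain mu P where mu: "optimal_fan B mu P" using base_fan(1)[OF assms B] by blast
    then have mu': "fan_giving B mu" "optimal_partition B mu P" by (auto simp: optimal_fan_def)
    obtain lam P' where "fan_giving (pullback (\<Union>K) (\<lambda>v. q (f v)) B) lam"
      "optimal_partition (pullback (\<Union>K) (\<lambda>v. q (f v)) B) lam P'"
      by (rule pullback_fan[OF un[OF B mu] mu' finK pull(2)])
    then show "\<exists>lam. fan_giving K lam \<and> (\<exists>P. optimal_partition K lam P)"
      using pull(1) by metis
  qed
  have abs: "abstract_complex K" if "pl_sphere K" for K :: "'a set set"
    using that by (simp add: pl_sphere_def)
  show ?thesis
  proof (intro conjI allI impI ballI)
    fix K :: "'a set set" assume K: "pl_sphere K \<and> picard K = p"
    show "(\<exists>lam. fan_giving K lam \<and> (\<exists>P. optimal_partition K lam P)) =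
        (\<exists>B\<in>base_complexes p. \<exists>L f. wedge_seq B L \<and> complex_iso f K L)"
      by (rule first) (use K abs in simp_all)
  next
    fix B assume "B \<in> base_complexes p"
    then show "\<exists>mu. fan_giving B mu \<and> (\<exists>P. optimal_partition B mu P) \<and>
        (\<forall>mu'. fan_giving B mu' \<and> (\<exists>P. optimal_partition B mu' P) \<longrightarrow> dj_equiv B mu mu')"
      by (rule second)
  next
    fix K :: "'a set set" and lam P
    assume K: "pl_sphere K \<and> picard K = p \<and> fan_giving K lam \<and> optimal_partition K lam P"
    show "\<exists>B\<in>base_complexes p. \<forall>mu\<^sub>0. fan_giving B mu\<^sub>0 \<and> (\<exists>P. optimal_partition B mu\<^sub>0 P) \<longrightarrow>
        (\<exists>L mu f. canonical_seq B mu\<^sub>0 L mu \<and> complex_iso f K L \<and> dj_equiv K lam (mu \<circ> f))"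
      by (rule third[where P = P]) (use K abs in simp_all)
  qed
qed

end
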